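(* Let $\Gamma$ be a smooth linear connection on a $C^\infty$-manifold $M$. Then there exists a smooth solution $f$ of the geodesic functional equations on $M$ such that $\mathrm{Geo}\,f=\mathrm{Geo}\,\Gamma$.
   Context: A linear connection $\Gamma$ on a manifold $M$ of dimension $n$ assigns to every chart $x$ functions $\Gamma^i_{jk}:\mathrm{dom}\,x\to\mathbb{R}$ with $\frac{\partial^2\bar x^i}{\partial x^j\partial x^k}+\bar\Gamma^i_{lm}\frac{\partial\bar x^l}{\partial x^j}\frac{\partial\bar x^m}{\partial x^k}=\frac{\partial\bar x^i}{\partial x^l}\Gamma^l_{jk}$ on chart overlaps; it is smooth if $M$ is $C^\infty$ and all components are $C^\infty$. $\mathrm{Geo}\,\Gamma$ is the set of all $C^2$-maps $g:I\to M$ ($I\subset\mathbb{R}$ any open interval) such that for every $\tau\in I$ there is an open interval $J\ni\tau$ in $I$ and a chart $x$ with $g(J)\subset\mathrm{dom}\,x$ and, on $J$, $\frac{d^2(x^i\circ g)}{dt^2}+(\Gamma^i_{jk}\circ g)\frac{d(x^j\circ g)}{dt}\frac{d(x^k\circ g)}{dt}=0$. A solution of the geodesic functional equations on a manifold $M$ is a continuous map $f:D\times[0,1]\to M$, with $D\subset M\times M$ open and containing the diagonal, such that for all $(a,b)\in D$ and $\alpha,\beta,\gamma\in[0,1]$: $f(a,b,0)=a$, $f(a,b,1)=b$, $(f(a,b,\alpha),f(a,b,\beta))\in D$, and $f(a,b,(1-\gamma)\alpha+\gamma\beta)=f(f(a,b,\alpha),f(a,b,\beta),\gamma)$; it is smooth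 if $f$ is $C^\infty$. $\mathrm{Geo}\,f$ is the set of maps $g:I\to M$ ($I$ an open interval) such that for every $\tau\in I$ there exist $\alpha,\beta\in I$ with $\alpha<\tau<\beta$, $(g(\alpha),g(\beta))\in D$, and $g((1-\gamma)\alpha+\gamma\beta)=f(g(\alpha),g(\beta),\gamma)$ for all $\gamma\in[0,1]$. *)

theory Defs
  imports "HOL-Analysis.Analysis"
begin

text \<open>C^k via iterated directional Frechet derivatives (meant for open U).\<close>
primrec Ck_on :: "nat \<Rightarrow> 'a::real_normed_vector set \<Rightarrow> ('a \<Rightarrow> 'b::real_normed_vector) \<Rightarrow> bool" where
  "Ck_on 0 U f = continuous_on U f"
| "Ck_on (Suc k) U f = (f differentiable_on U \<and> (\<forall>v. Ck_on k U (\<lambda>x. frechet_derivative f (at x) v)))"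

definition smooth_on :: "'a::real_normed_vector set \<Rightarrow> ('a \<Rightarrow> 'b::real_normed_vector) \<Rightarrow> bool" where
  "smooth_on U f \<longleftrightarrow> open U \<and> (\<forall>k. Ck_on k U f)"

text \<open>A chart on the topological space 'a (the manifold M = UNIV) of dimension CARD('n):
  a homeomorphism of an open set onto an open subset of R^n.\<close>
type_synonym ('a, 'n) chart = "'a set \<times> ('a \<Rightarrow> real^'n)"

definition is_chart :: "('a::topological_space, 'n::finite) chart \<Rightarrow> bool" where
  "is_chart c \<longleftrightarrow> (case c of (U, \<phi>) \<Rightarrow>
      open U \<and> open (\<phi> ` U) \<and> (\<exists>\<psi>. homeomorphism U (\<phi> ` U) \<phi> \<psi>))"

definition transition :: "('a, 'n::finite) chart \<Rightarrow> ('a, 'n) chart \<Rightarrow> real^'n \<Rightarrow> real^'n" where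
  "transition c d = snd d \<circ> inv_into (fst c) (snd c)"

definition smoothly_compatible :: "('a, 'n::finite) chart \<Rightarrow> ('a, 'n) chart \<Rightarrow> bool" where
  "smoothly_compatible c d \<longleftrightarrow>
     smooth_on (snd c ` (fst c \<inter> fst d)) (transition c d) \<and>
     smooth_on (snd d ` (fst c \<inter> fst d)) (transition d c)"

definition smooth_atlas :: "('a::topological_space, 'n::finite) chart set \<Rightarrow> bool" where
  "smooth_atlas A \<longleftrightarrow> (\<forall>c\<in>A. is_chart c) \<and> (\<Union>c\<in>A. fst c) = UNIV \<and>
     (\<forall>c\<in>A. \<forall>d\<in>A. smoothly_compatible c d)"

text \<open>The charts of the C-infinity manifold determined by A (its maximal atlas).\<close>
definition mchart :: "('a::topological_space, 'n::finite) chart set \<Rightarrow> ('a, 'n) chart \<Rightarrow> bool" where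
  "mchart A c \<longleftrightarrow> is_chart c \<and> (\<forall>d\<in>A. smoothly_compatible c d)"

text \<open>Partial derivatives of the coordinate change: at a point p of the overlap,
  dbar c d i j p = d(xbar^i)/d(x^j) and ddbar c d i j k p = d^2(xbar^i)/(d x^j d x^k),
  where c = x, d = xbar.\<close>
definition dbar :: "('a, 'n::finite) chart \<Rightarrow> ('a, 'n) chart \<Rightarrow> 'n \<Rightarrow> 'n \<Rightarrow> 'a \<Rightarrow> real" where
  "dbar c d i j p = frechet_derivative (transition c d) (at (snd c p)) (axis j 1) $ i"

definition ddbar :: "('a, 'n::finite) chart \<Rightarrow> ('a, 'n) chart \<Rightarrow> 'n \<Rightarrow> 'n \<Rightarrow> 'n \<Rightarrow> 'a \<Rightarrow> real" where
  "ddbar c d i j k p = frechet_derivative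
      (\<lambda>y. frechet_derivative (transition c d) (at y) (axis k 1)) (at (snd c p)) (axis j 1) $ i"

text \<open>A connection assigns to every chart x its components Gamma x i j k : dom x \<rightarrow> R
  (values outside dom x are irrelevant).\<close>
type_synonym ('a, 'n) connection = "('a, 'n) chart \<Rightarrow> 'n \<Rightarrow> 'n \<Rightarrow> 'n \<Rightarrow> 'a \<Rightarrow> real"

definition linear_connection :: "('a::topological_space, 'n::finite) chart set \<Rightarrow> ('a, 'n) connection \<Rightarrow> bool" where
  "linear_connection A \<Gamma> \<longleftrightarrow>
     (\<forall>x xb. mchart A x \<longrightarrow> mchart A xb \<longrightarrow> (\<forall>p \<in> fst x \<inter> fst xb. \<forall>i j k.
        ddbar x xb i j k p + (\<Sum>l\<in>UNIV. \<Sum>m\<in>UNIV. \<Gamma> xb i l m p * dbar x xb l j p * dbar x xb m k p)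
        = (\<Sum>l\<in>UNIV. dbar x xb i l p * \<Gamma> x l j k p)))"

definition smooth_connection :: "('a::topological_space, 'n::finite) chart set \<Rightarrow> ('a, 'n) connection \<Rightarrow> bool" where
  "smooth_connection A \<Gamma> \<longleftrightarrow> linear_connection A \<Gamma> \<and>
     (\<forall>x. mchart A x \<longrightarrow> (\<forall>i j k.
        smooth_on (snd x ` fst x) (\<lambda>y. \<Gamma> x i j k (inv_into (fst x) (snd x) y))))"

definition open_interval :: "real set \<Rightarrow> bool" where
  "open_interval I \<longleftrightarrow> open I \<and> is_interval I"

definition Ck_curve :: "('a::topological_space, 'n::finite) chart set \<Rightarrow> nat \<Rightarrow> real set \<Rightarrow> (real \<Rightarrow> 'a) \<Rightarrow> bool" where
  "Ck_curve A k I g \<longleftrightarrow> continuous_on I g \<and>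
     (\<forall>\<tau>\<in>I. \<exists>J x. open_interval J \<and> \<tau> \<in> J \<and> J \<subseteq> I \<and> mchart A x \<and> g ` J \<subseteq> fst x \<and>
        Ck_on k J (snd x \<circ> g))"

definition Geo_conn :: "('a::topological_space, 'n::finite) chart set \<Rightarrow> ('a, 'n) connection \<Rightarrow> real set \<Rightarrow> (real \<Rightarrow> 'a) \<Rightarrow> bool" where
  "Geo_conn A \<Gamma> I g \<longleftrightarrow> open_interval I \<and> Ck_curve A 2 I g \<and>
     (\<forall>\<tau>\<in>I. \<exists>J x. open_interval J \<and> \<tau> \<in> J \<and> J \<subseteq> I \<and> mchart A x \<and> g ` J \<subseteq> fst x \<and>
        (\<forall>t\<in>J. \<forall>i.
           vector_derivative (\<lambda>s. vector_derivative (snd x \<circ> g) (at s)) (at t) $ i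
           + (\<Sum>j\<in>UNIV. \<Sum>k\<in>UNIV. \<Gamma> x i j k (g t)
                * vector_derivative (snd x \<circ> g) (at t) $ j
                * vector_derivative (snd x \<circ> g) (at t) $ k) = 0))"

definition geo_solution :: "('a::topological_space \<times> 'a) set \<Rightarrow> ('a \<Rightarrow> 'a \<Rightarrow> real \<Rightarrow> 'a) \<Rightarrow> bool" where
  "geo_solution D f \<longleftrightarrow> open D \<and> (\<forall>a. (a, a) \<in> D) \<and>
     continuous_on (D \<times> {0..1}) (\<lambda>((a, b), t). f a b t) \<and>
     (\<forall>(a, b)\<in>D. \<forall>\<alpha>\<in>{0..1}. \<forall>\<beta>\<in>{0..1}. \<forall>\<gamma>\<in>{0..1}.
        f a b 0 = a \<and> f a b 1 = b \<and> (f a b \<alpha>, f a b \<beta>) \<in> D \<and>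
        f a b ((1 - \<gamma>) * \<alpha> + \<gamma> * \<beta>) = f (f a b \<alpha>) (f a b \<beta>) \<gamma>)"

text \<open>C-infinity on D \<times> [0,1]: in charts, locally the restriction of a C-infinity map
  defined on an open subset of R^n \<times> R^n \<times> R.\<close>
definition smooth_geo_map :: "('a::topological_space, 'n::finite) chart set \<Rightarrow> ('a \<times> 'a) set \<Rightarrow> ('a \<Rightarrow> 'a \<Rightarrow> real \<Rightarrow> 'a) \<Rightarrow> bool" where
  "smooth_geo_map A D f \<longleftrightarrow>
     (\<forall>a b t. (a, b) \<in> D \<longrightarrow> t \<in> {0..1} \<longrightarrow>
       (\<exists>x1 x2 y W F. mchart A x1 \<and> mchart A x2 \<and> mchart A y \<and>
          a \<in> fst x1 \<and> b \<in> fst x2 \<and> open W \<and> ((snd x1 a, snd x2 b), t) \<in> W \<and>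
          smooth_on W (F :: ((real^'n) \<times> (real^'n)) \<times> real \<Rightarrow> real^'n) \<and>
          (\<forall>a' b' t'. (a', b') \<in> D \<longrightarrow> t' \<in> {0..1} \<longrightarrow> a' \<in> fst x1 \<longrightarrow> b' \<in> fst x2 \<longrightarrow>
              ((snd x1 a', snd x2 b'), t') \<in> W \<longrightarrow>
              f a' b' t' \<in> fst y \<and> snd y (f a' b' t') = F ((snd x1 a', snd x2 b'), t'))))"

definition Geo_fun :: "('a::topological_space \<times> 'a) set \<Rightarrow> ('a \<Rightarrow> 'a \<Rightarrow> real \<Rightarrow> 'a) \<Rightarrow> real set \<Rightarrow> (real \<Rightarrow> 'a) \<Rightarrow> bool" where
  "Geo_fun D f I g \<longleftrightarrow> open_interval I \<and>
     (\<forall>\<tau>\<in>I. \<exists>\<alpha>\<in>I. \<exists>\<beta>\<in>I. \<alpha> < \<tau> \<and> \<tau> < \<beta> \<and> (g \<alpha>, g \<beta>) \<in> D \<and>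
        (\<forall>\<gamma>\<in>{0..1}. g ((1 - \<gamma>) * \<alpha> + \<gamma> * \<beta>) = f (g \<alpha>) (g \<beta>) \<gamma>))"

end

theory Submission
  imports Defs
begin

text \<open>In a chart, geodesics solve \<open>c'' = A (c, c')\<close> with \<open>A\<close> smooth and quadratic in the velocity. Near a
  point at rest \<open>A\<close> has small Lipschitz constant, so both the initial and the boundary value problem
  become contractive equations \<open>u = A (l y + L u)\<close> for the acceleration \<open>u = c''\<close> in the Banach space of
  bounded continuous functions. The solution depends smoothly on the parameter \<open>y\<close>, because its derivatives
  solve linear contractive equations whose coefficients are as smooth as \<open>u\<close> itself. If \<open>exp\<close> is the
  time one map and \<open>v (a, b)\<close> the initial velocity of the geodesic from \<open>a\<close> to \<open>b\<close>, then \<open>exp (a, t v (a, b))\<close> is the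
  required map, jointly smooth in \<open>(a, b, t)\<close>. Small coordinate balls are geodesically convex since the squared
  distance to the centre is convex along geodesics, and any two points are joined inside the ball by a
  unique geodesic since a geodesic trapped in a small ball is slow. To glue the local solutions, the balls
  are chosen so small that the union of two balls that meet lies in a larger ball which still has unique geodesics.\<close>

subsection \<open>Calculus of Ck_on\<close>

text \<open>Because \<open>A\<close> is quadratic in the velocity, both \<open>A\<close> and its
  derivative vanish at \<open>(p, 0)\<close>. The Lipschitz constant becomes as small as desired by
  shrinking the ball in phase space alone, so the unit time interval can stay fixed throughout. The
  boundary value problem by itself does not give joint smoothness: its solution depends smoothly on
  the end points as an element of a space of continuous curves, but joint evaluation
  \<open>(u, t) \<mapsto> u t\<close> on that space is only continuous. Homogeneity of degree 2
  converts the time \<open>t\<close> into a factor of the initial velocity, so that \<open>t\<close>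
  becomes a parameter of an initial value problem evaluated at the fixed time 1. This is why both
  problems are solved, and it also extends the solution to \<open>-1 < t < 2\<close>, as smoothness
  up to the ends of [0,1] demands. Smoothness is expressed through derivatives in fixed directions,
  so the chain rule needs a finite dimensional space in the middle. Composition with curves is
  therefore treated separately, as an operator between spaces of bounded continuous
  functions.\<close>

lemma Ck_on_SucD:
  assumes "open U" "Ck_on (Suc k) U f" "x \<in> U"
  shows "(f has_derivative frechet_derivative f (at x)) (at x)"
  using assms by (simp add: differentiable_on_eq_differentiable_at flip: frechet_derivative_works)

lemma Ck_on_cong:
  assumes "open U" "\<And>x. x \<in> U \<Longrightarrow> f x = g x" "Ck_on k U g"
  shows "Ck_on k U f"
  using assms(2,3)
proof (induction k arbitrary: f g)
  case 0
  then show ?case by (simp cong: continuous_on_cong)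
next
  case (Suc k)
  have f: "(f has_derivative frechet_derivative g (at x)) (at x)" if "x \<in> U" for x
    using Ck_on_SucD[OF \<open>open U\<close> Suc.prems(2) that] that Suc.prems(1) \<open>open U\<close>
    by (metis has_derivative_transform_within_open)
  then have "f differentiable_on U"
    unfolding differentiable_on_eq_differentiable_at[OF \<open>open U\<close>] differentiable_def by blast
  moreover have "Ck_on k U (\<lambda>x. frechet_derivative f (at x) v)" for v
  proof (rule Suc.IH)
    show "frechet_derivative f (at x) v = frechet_derivative g (at x) v" if "x \<in> U" for x
      using frechet_derivative_at[OF f[OF that]] by simp
    show "Ck_on k U (\<lambda>x. frechet_derivative g (at x) v)" using Suc.prems(2) by simp
  qed
  ultimately show ?case by simp
qed

text \<open>The entry point of the inductions on \<open>k\<close>: any formula for the derivative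
  valid on \<open>U\<close> may be used in place of \<open>frechet_derivative\<close>.\<close>

lemma Ck_on_SucI:
  assumes "open U" and f: "\<And>x. x \<in> U \<Longrightarrow> (f has_derivative f' x) (at x)"
    and "\<And>v. Ck_on k U (\<lambda>x. f' x v)"
  shows "Ck_on (Suc k) U f"
proof -
  have "f differentiable_on U"
    unfolding differentiable_on_eq_differentiable_at[OF \<open>open U\<close>] differentiable_def using f by blast
  moreover have "Ck_on k U (\<lambda>x. frechet_derivative f (at x) v)" for v
  proof (rule Ck_on_cong[OF \<open>open U\<close>])
    show "frechet_derivative f (at x) v = f' x v" if "x \<in> U" for x
      using frechet_derivative_at[OF f[OF that]] by simp
  qed (rule assms(3))
  ultimately show ?thesis by simp
qed

lemma Ck_on_subset:
  assumes "open U" "open V" "V \<subseteq> U" "Ck_on k U f"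
  shows "Ck_on k V f"
  using assms(4)
proof (induction k arbitrary: f)
  case 0
  then show ?case using assms(3) continuous_on_subset by auto
next
  case (Suc k)
  show ?case
    by (rule Ck_on_SucI[where f'="\<lambda>x. frechet_derivative f (at x)"])
      (use Suc assms Ck_on_SucD[OF assms(1) Suc.prems] in auto)
qed

lemma Ck_on_continuous:
  assumes "open U" "Ck_on k U f" shows "continuous_on U f"
proof (cases k)
  case (Suc j)
  then show ?thesis using assms(2)
    by (auto simp: differentiable_on_def continuous_on_eq_continuous_within intro: differentiable_imp_continuous_within)
qed (use assms in auto)

lemma Ck_on_Suc_imp:
  assumes "open U" "Ck_on (Suc k) U f" shows "Ck_on k U f"
  using assms(2)
proof (induction k arbitrary: f)
  case 0
  then show ?case unfolding Ck_on.simps(1) by (rule Ck_on_continuous[OF assms(1)])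
next
  case (Suc k)
  show ?case
    by (rule Ck_on_SucI[OF assms(1) Ck_on_SucD[OF assms(1) Suc.prems]])
      (use Suc in auto)
qed

lemma Ck_on_const: "open U \<Longrightarrow> Ck_on k U (\<lambda>x. c)"
  by (induction k arbitrary: c) (auto intro: Ck_on_SucI[where f'="\<lambda>x v. 0"])

lemma Ck_on_compose_linear:
  assumes "open U" "bounded_linear L" "Ck_on k U f"
  shows "Ck_on k U (\<lambda>x. L (f x))"
  using assms(3)
proof (induction k arbitrary: f)
  case 0
  then show ?case using bounded_linear.continuous_on[OF assms(2)] by auto
next
  case (Suc k)
  show ?case
    by (rule Ck_on_SucI[OF assms(1) bounded_linear.has_derivative[OF assms(2) Ck_on_SucD[OF assms(1) Suc.prems]]])
      (use Suc in auto)
qed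

lemma Ck_on_id: "open U \<Longrightarrow> Ck_on k U (\<lambda>x. x)"
  by (cases k) (auto intro!: Ck_on_SucI[where f'="\<lambda>x v. v"] Ck_on_const)

lemma Ck_on_linear: "open U \<Longrightarrow> bounded_linear L \<Longrightarrow> Ck_on k U L"
  using Ck_on_compose_linear[OF _ _ Ck_on_id] by blast

lemma Ck_on_add:
  assumes "open U" "Ck_on k U f" "Ck_on k U g"
  shows "Ck_on k U (\<lambda>x. f x + g x)"
  using assms(2,3)
proof (induction k arbitrary: f g)
  case 0
  then show ?case by (auto intro: continuous_intros)
next
  case (Suc k)
  show ?case
    by (rule Ck_on_SucI[OF assms(1) has_derivative_add[OF Ck_on_SucD[OF assms(1) Suc.prems(1)] Ck_on_SucD[OF assms(1) Suc.prems(2)]]])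
      (use Suc in auto)
qed

lemma Ck_on_sum:
  assumes "open U" "\<And>i. i \<in> I \<Longrightarrow> Ck_on k U (f i)"
  shows "Ck_on k U (\<lambda>x. \<Sum>i\<in>I. f i x)"
  using assms(2)
  by (induction I rule: infinite_finite_induct) (auto intro: Ck_on_const Ck_on_add \<open>open U\<close>)

lemma Ck_on_bilinear:
  assumes "open U" "bounded_bilinear pr" "Ck_on k U f" "Ck_on k U g"
  shows "Ck_on k U (\<lambda>x. pr (f x) (g x))"
  using assms(3,4)
proof (induction k arbitrary: f g)
  case 0
  then show ?case using bounded_bilinear.continuous_on[OF assms(2)] by auto
next
  case (Suc k)
  note D = bounded_bilinear.FDERIV[OF assms(2) Ck_on_SucD[OF assms(1) Suc.prems(1)] Ck_on_SucD[OF assms(1) Suc.prems(2)]]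
  note P = Ck_on_Suc_imp[OF assms(1) Suc.prems(1)] Ck_on_Suc_imp[OF assms(1) Suc.prems(2)]
  show ?case
    by (rule Ck_on_SucI[OF assms(1) D], assumption) (use Suc P assms(1) in \<open>auto intro!: Ck_on_add\<close>)
qed

lemma Ck_on_scaleR: "open U \<Longrightarrow> Ck_on k U f \<Longrightarrow> Ck_on k U g \<Longrightarrow> Ck_on k U (\<lambda>x. f x *\<^sub>R g x)"
  by (rule Ck_on_bilinear[OF _ bounded_bilinear_scaleR])

lemma Ck_on_mult: "open U \<Longrightarrow> Ck_on k U f \<Longrightarrow> Ck_on k U g \<Longrightarrow> Ck_on k U (\<lambda>x. f x * g x :: real)"
  by (rule Ck_on_bilinear[OF _ bounded_bilinear_mult])

lemma Ck_on_uminus: "open U \<Longrightarrow> Ck_on k U f \<Longrightarrow> Ck_on k U (\<lambda>x. - f x)"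
  by (rule Ck_on_compose_linear[OF _ bounded_linear_minus[OF bounded_linear_ident]])

lemma Ck_on_Pair:
  assumes "open U" "Ck_on k U f" "Ck_on k U g"
  shows "Ck_on k U (\<lambda>x. (f x, g x))"
proof -
  have "Ck_on k U (\<lambda>x. (f x, 0) + (0, g x))"
    by (intro Ck_on_add assms Ck_on_compose_linear[OF assms(1) _ assms(2)] Ck_on_compose_linear[OF assms(1) _ assms(3)]
        bounded_linear_Pair bounded_linear_ident bounded_linear_zero)
  then show ?thesis by simp
qed

lemma linear_euclidean_expand:
  fixes f :: "'a::euclidean_space \<Rightarrow> 'b::real_vector"
  assumes "linear f" shows "f v = (\<Sum>b\<in>Basis. (v \<bullet> b) *\<^sub>R f b)"
proof -
  have "f v = f (\<Sum>b\<in>Basis. (v \<bullet> b) *\<^sub>R b)" by (simp add: euclidean_representation)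
  also have "\<dots> = (\<Sum>b\<in>Basis. (v \<bullet> b) *\<^sub>R f b)"
    using assms by (simp add: linear_sum linear_scale)
  finally show ?thesis .
qed

text \<open>\<open>Ck_on\<close> controls the derivative of \<open>g\<close> in fixed directions
  only, whereas the chain rule applies it to a moving vector. Expanding that vector in a basis of
  \<open>'b\<close> fixes the directions; this is where finite dimension enters.\<close>

lemma Ck_on_compose:
  fixes f :: "'a::real_normed_vector \<Rightarrow> 'b::euclidean_space" and g :: "'b \<Rightarrow> 'c::real_normed_vector"
  assumes "open U" "open V" "f ` U \<subseteq> V" "Ck_on k U f" "Ck_on k V g"
  shows "Ck_on k U (\<lambda>x. g (f x))"
  using assms(4,5)
proof (induction k arbitrary: g)
  case 0
  then show ?case using assms(3) continuous_on_compose2[of V g U f] by auto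
next
  case (Suc k)
  have Df: "(f has_derivative frechet_derivative f (at x)) (at x)" if "x \<in> U" for x
    using Ck_on_SucD[OF assms(1) Suc.prems(1) that] .
  have Dg: "(g has_derivative frechet_derivative g (at x)) (at x)" if "x \<in> V" for x
    using Ck_on_SucD[OF assms(2) Suc.prems(2) that] .
  have D: "((\<lambda>x. g (f x)) has_derivative (\<lambda>v. frechet_derivative g (at (f x)) (frechet_derivative f (at x) v))) (at x)"
    if "x \<in> U" for x
    using diff_chain_at[OF Df[OF that] Dg] that assms(3) by (auto simp: o_def)
  show ?case
  proof (rule Ck_on_SucI[OF assms(1) D])
    fix v
    have "Ck_on k U (\<lambda>x. \<Sum>b\<in>Basis. (frechet_derivative f (at x) v \<bullet> b) *\<^sub>R frechet_derivative g (at (f x)) b)"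
    proof (intro Ck_on_sum Ck_on_scaleR assms(1))
      fix b :: 'b
      show "Ck_on k U (\<lambda>x. frechet_derivative f (at x) v \<bullet> b)"
        using Suc.prems(1) by (intro Ck_on_compose_linear[OF assms(1) bounded_linear_inner_left]) auto
      show "Ck_on k U (\<lambda>x. frechet_derivative g (at (f x)) b)"
        by (rule Suc.IH[OF Ck_on_Suc_imp[OF assms(1) Suc.prems(1)]]) (use Suc.prems(2) in auto)
    qed
    then show "Ck_on k U (\<lambda>x. frechet_derivative g (at (f x)) (frechet_derivative f (at x) v))"
    proof (rule Ck_on_cong[OF assms(1), rotated])
      fix x assume "x \<in> U"
      then have "linear (frechet_derivative g (at (f x)))"
        using Dg assms(3) has_derivative_linear by blast
      then show "frechet_derivative g (at (f x)) (frechet_derivative f (at x) v) =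
        (\<Sum>b\<in>Basis. (frechet_derivative f (at x) v \<bullet> b) *\<^sub>R frechet_derivative g (at (f x)) b)"
        using linear_euclidean_expand by blast
    qed
  qed
qed

subsection \<open>Inverting the identity minus a contraction\<close>

text \<open>Instead of summing a Neumann series, \<open>R v\<close> is the fixed point of
  \<open>w \<mapsto> T w + v\<close>. Uniqueness of the fixed point yields linearity, and the
  equation itself yields the bound \<open>1 / (1 - q)\<close>.\<close>

lemma contraction_inverse:
  fixes T :: "'e::{real_normed_vector,complete_space} \<Rightarrow>\<^sub>L 'e"
  assumes "\<And>w. norm (T w) \<le> q * norm w" "0 \<le> q" "q < 1"
  obtains R :: "'e \<Rightarrow>\<^sub>L 'e" where "\<And>w. R (w - T w) = w" "\<And>w. R w = T (R w) + w"
proof -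
  have ex: "\<exists>!w. T w + v = w" for v
    by (rule banach_fix_type[of q])
      (use assms in \<open>auto simp: dist_norm simp flip: blinfun.diff_right\<close>)
  define R where "R v = (THE w. T w + v = w)" for v
  have R: "T (R v) + v = R v" for v
    using theI'[OF ex] unfolding R_def .
  have R_eq: "R v = w" if "T w + v = w" for v w
    using ex[of v] R[of v] that by blast
  have "bounded_linear R"
  proof (rule bounded_linear_intro)
    show "R (x + y) = R x + R y" for x y
      by (rule R_eq) (metis R add.assoc add.commute add.left_commute blinfun.add_right)
    show "R (r *\<^sub>R x) = r *\<^sub>R R x" for r x
      by (rule R_eq) (metis R blinfun.scaleR_right scaleR_add_right)
    show "norm (R x) \<le> norm x * (1 / (1 - q))" for x
    proof -
      have "norm (R x) \<le> q * norm (R x) + norm x"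
        using norm_triangle_ineq[of "T (R x)" x] assms(1)[of "R x"] R[of x] by simp
      then have "(1 - q) * norm (R x) \<le> norm x" by (simp add: algebra_simps)
      then show ?thesis using assms(3) by (simp add: pos_le_divide_eq mult.commute)
    qed
  qed
  then have "blinfun_apply (Blinfun R) = R" by (rule bounded_linear_Blinfun_apply)
  moreover have "R (w - T w) = w" for w by (rule R_eq) simp
  moreover have "R w = T (R w) + w" for w using R by simp
  ultimately show ?thesis using that[of "Blinfun R"] by metis
qed

text \<open>Differentiability of \<open>u\<close> need not be known beforehand: a bounded inverse
  recovers \<open>u\<close> from \<open>u - T u\<close>. This is how implicitly defined maps are
  differentiated below.\<close>

lemma has_derivative_of_contraction:
  fixes u :: "'y::real_normed_vector \<Rightarrow> 'e::{real_normed_vector,complete_space}" and T :: "'e \<Rightarrow>\<^sub>L 'e"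
  assumes "\<And>w. norm (T w) \<le> q * norm w" "0 \<le> q" "q < 1"
    and "((\<lambda>y. u y - blinfun_apply T (u y)) has_derivative B) (at x)"
  obtains u' where "(u has_derivative u') (at x)" "\<And>h. u' h = T (u' h) + B h"
proof -
  obtain R :: "'e \<Rightarrow>\<^sub>L 'e" where R: "\<And>w. R (w - T w) = w" "\<And>w. R w = T (R w) + w"
    using contraction_inverse[OF assms(1,2,3)] by blast
  have "((\<lambda>y. R (u y - T (u y))) has_derivative (\<lambda>h. R (B h))) (at x)"
    by (rule bounded_linear.has_derivative[OF blinfun.bounded_linear_right assms(4)])
  then show ?thesis using that[of "\<lambda>h. R (B h)"] R by simp
qed

text \<open>In the product rule, the derivative of \<open>w\<close> would be multiplied by
  \<open>S x = 0\<close>, so continuity of \<open>w\<close> is enough: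
  \<open>S y (w y - w x)\<close> is of the order of \<open>norm (y - x)\<close> times a quantity
  tending to 0.\<close>

lemma has_derivative_vanishing_blinfun:
  fixes S :: "'y::real_normed_vector \<Rightarrow> 'e::real_normed_vector \<Rightarrow>\<^sub>L 'f::real_normed_vector"
  assumes S: "(S has_derivative S') (at x)" and "S x = 0" and w: "continuous (at x) w"
  shows "((\<lambda>y. S y (w y)) has_derivative (\<lambda>h. S' h (w x))) (at x)"
proof -
  have "((\<lambda>y. S y (w x)) has_derivative (\<lambda>h. S' h (w x))) (at x)"
    by (rule bounded_linear.has_derivative[OF blinfun.bounded_linear_left S])
  moreover have "((\<lambda>y. S y (w y - w x)) has_derivative (\<lambda>h. 0)) (at x)"
  proof -
    obtain K where K: "\<And>h. norm (S' h) \<le> norm h * K" "K \<ge> 0"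
      using bounded_linear.nonneg_bounded[OF has_derivative_bounded_linear[OF S]] by blast
    have "((\<lambda>y. norm (S y - S x - S' (y - x)) / norm (y - x)) \<longlongrightarrow> 0) (at x)"
      using S by (simp add: has_derivative_iff_norm)
    moreover have "((\<lambda>y. norm (w y - w x)) \<longlongrightarrow> 0) (at x)"
      using w by (simp add: continuous_at LIM_zero tendsto_norm_zero)
    ultimately have lim: "((\<lambda>y. (norm (S y - S x - S' (y - x)) / norm (y - x) + K) * norm (w y - w x)) \<longlongrightarrow> 0) (at x)"
      using tendsto_mult[OF tendsto_add[OF _ tendsto_const[of K]], of _ 0 "at x" _ 0] by force
    have "((\<lambda>y. norm (S y (w y - w x)) / norm (y - x)) \<longlongrightarrow> 0) (at x)"
    proof (rule Lim_null_comparison[OF _ lim])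
      show "\<forall>\<^sub>F y in at x. norm (norm (S y (w y - w x)) / norm (y - x))
          \<le> (norm (S y - S x - S' (y - x)) / norm (y - x) + K) * norm (w y - w x)"
      proof (rule eventually_at_filter[THEN iffD2], rule always_eventually, safe)
        fix y assume "y \<noteq> x"
        then have pos: "norm (y - x) > 0" by simp
        have "norm (S y (w y - w x)) \<le> norm (S y) * norm (w y - w x)" by (rule norm_blinfun)
        also have "norm (S y) \<le> norm (S y - S x - S' (y - x)) + norm (S' (y - x))"
          using norm_triangle_ineq[of "S y - S x - S' (y - x)" "S' (y - x)"] \<open>S x = 0\<close> by simp
        also have "\<dots> \<le> norm (S y - S x - S' (y - x)) + norm (y - x) * K" using K by simp
        finally have "norm (S y (w y - w x)) \<le> (norm (S y - S x - S' (y - x)) + norm (y - x) * K) * norm (w y - w x)"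
          by (simp add: mult_right_mono)
        then have "norm (S y (w y - w x)) / norm (y - x)
          \<le> (norm (S y - S x - S' (y - x)) + norm (y - x) * K) * norm (w y - w x) / norm (y - x)"
          using pos by (simp add: divide_right_mono)
        also have "\<dots> = (norm (S y - S x - S' (y - x)) / norm (y - x) + K) * norm (w y - w x)"
          using pos by (simp add: field_simps)
        finally show "norm (norm (S y (w y - w x)) / norm (y - x))
          \<le> (norm (S y - S x - S' (y - x)) / norm (y - x) + K) * norm (w y - w x)" by simp
      qed
    qed
    then show ?thesis by (simp add: has_derivative_iff_norm bounded_linear_zero)
  qed
  ultimately have "((\<lambda>y. S y (w x) + S y (w y - w x)) has_derivative (\<lambda>h. S' h (w x) + 0)) (at x)"
    by (rule has_derivative_add)
  then show ?thesis by (simp flip: blinfun.add_right)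
qed

text \<open>Differentiating the equation gives one of the same kind for the derivative of
  \<open>w\<close>, with the same \<open>T\<close> and a right-hand side that is C^k as soon as
  \<open>w\<close> is; hence the induction on \<open>k\<close> with \<open>w\<close> and
  \<open>r\<close> generalised.\<close>

lemma Ck_on_linear_fixpoint:
  fixes w :: "'y::real_normed_vector \<Rightarrow> 'e::{real_normed_vector,complete_space}"
    and T :: "'y \<Rightarrow> 'e \<Rightarrow>\<^sub>L 'e"
  assumes "open P" and q: "0 \<le> q" "q < 1" and T: "Ck_on k P T" "\<And>y v. y \<in> P \<Longrightarrow> norm (T y v) \<le> q * norm v"
    and "Ck_on k P r" "\<And>y. y \<in> P \<Longrightarrow> w y = blinfun_apply (T y) (w y) + r y"
  shows "Ck_on k P w"
  using T(1) assms(6,7)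
proof (induction k arbitrary: w r)
  case 0
  have "isCont w y" if y: "y \<in> P" for y
  proof -
    have "isCont T y" "isCont r y"
      using 0 y \<open>open P\<close> by (auto simp: continuous_on_eq_continuous_at)
    then have "((\<lambda>z. (norm (T z - T y) * norm (w y) + norm (r z - r y)) / (1 - q)) \<longlongrightarrow> (norm (T y - T y) * norm (w y) + norm (r y - r y)) / (1 - q)) (at y)"
      unfolding isCont_def using q by (intro tendsto_intros) auto
    then have lim: "((\<lambda>z. (norm (T z - T y) * norm (w y) + norm (r z - r y)) / (1 - q)) \<longlongrightarrow> 0) (at y)" by simp
    have "\<forall>\<^sub>F z in at y. z \<in> P"
      using \<open>open P\<close> y by (metis eventually_at_topological)
    then have "\<forall>\<^sub>F z in at y. norm (w z - w y) \<le> (norm (T z - T y) * norm (w y) + norm (r z - r y)) / (1 - q)"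
    proof eventually_elim
      case (elim z)
      \<comment> \<open>Absorbing the term \<open>T z (w z - w y)\<close> into the left-hand side
        costs a factor \<open>1 - q\<close> and leaves only increments of the continuous
        data.\<close>
      have eq: "w z - w y = T z (w z - w y) + (T z - T y) (w y) + (r z - r y)"
      proof -
        have "w z - w y = (T z (w z) + r z) - (T y (w y) + r y)"
          using 0(3)[OF elim] 0(3)[OF y] by metis
        also have "\<dots> = T z (w z - w y) + (T z - T y) (w y) + (r z - r y)"
          by (simp add: blinfun.diff_right blinfun.diff_left)
        finally show ?thesis .
      qed
      have "norm (w z - w y) \<le> norm (T z (w z - w y)) + norm ((T z - T y) (w y)) + norm (r z - r y)"
        using arg_cong[OF eq, of norm] norm_triangle_ineq[of "T z (w z - w y)" "(T z - T y) (w y)"]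
          norm_triangle_ineq[of "T z (w z - w y) + (T z - T y) (w y)" "r z - r y"] by linarith
      also have "\<dots> \<le> q * norm (w z - w y) + norm (T z - T y) * norm (w y) + norm (r z - r y)"
        using T(2)[OF elim] norm_blinfun by (intro add_mono) auto
      finally have "(1 - q) * norm (w z - w y) \<le> norm (T z - T y) * norm (w y) + norm (r z - r y)"
        by (simp add: algebra_simps)
      then show ?case using q by (simp add: pos_le_divide_eq mult.commute)
    qed
    then have "((\<lambda>z. w z - w y) \<longlongrightarrow> 0) (at y)" by (rule Lim_null_comparison[OF _ lim])
    then show ?thesis by (simp add: isCont_def LIM_zero_iff)
  qed
  then show ?case using \<open>open P\<close> by (simp add: continuous_at_imp_continuous_on)
next
  case (Suc k)
  have Ck: "Ck_on k P T" "Ck_on k P r"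
    using Ck_on_Suc_imp[OF \<open>open P\<close>] Suc.prems by blast+
  have wk: "Ck_on k P w" by (rule Suc.IH[OF Ck Suc.prems(3)])
  have "\<exists>w'. (w has_derivative w') (at y) \<and> (\<forall>h. w' h = T y (w' h) + (frechet_derivative T (at y) h (w y) + frechet_derivative r (at y) h))"
    if y: "y \<in> P" for y
  proof -
    \<comment> \<open>The operator is frozen at \<open>y\<close>: \<open>w z - T y (w z)\<close>
      equals \<open>(T z - T y) (w z) + r z\<close>, whose operator factor vanishes at
      \<open>z = y\<close>, so continuity of \<open>w\<close> suffices to differentiate it.\<close>
    have "isCont w y" using Ck_on_continuous[OF \<open>open P\<close> wk] y \<open>open P\<close> by (simp add: continuous_on_eq_continuous_at)
    moreover have "((\<lambda>z. T z - T y) has_derivative frechet_derivative T (at y)) (at y)"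
      using Ck_on_SucD[OF \<open>open P\<close> Suc.prems(1) y] by (auto intro!: derivative_eq_intros)
    ultimately have "((\<lambda>z. (T z - T y) (w z)) has_derivative (\<lambda>h. frechet_derivative T (at y) h (w y))) (at y)"
      by (intro has_derivative_vanishing_blinfun) auto
    then have "((\<lambda>z. (T z - T y) (w z) + r z) has_derivative (\<lambda>h. frechet_derivative T (at y) h (w y) + frechet_derivative r (at y) h)) (at y)"
      by (rule has_derivative_add[OF _ Ck_on_SucD[OF \<open>open P\<close> Suc.prems(2) y]])
    moreover have "(T z - T y) (w z) + r z = w z - T y (w z)" if "z \<in> P" for z
      using Suc.prems(3)[OF that] by (simp add: blinfun.diff_left algebra_simps)
    ultimately have "((\<lambda>z. w z - T y (w z)) has_derivative (\<lambda>h. frechet_derivative T (at y) h (w y) + frechet_derivative r (at y) h)) (at y)"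
      by (rule has_derivative_transform_within_open[OF _ \<open>open P\<close> y])
    from has_derivative_of_contraction[OF T(2)[OF y] q this] show ?thesis by metis
  qed
  then obtain w' where w': "\<And>y. y \<in> P \<Longrightarrow> (w has_derivative w' y) (at y)"
    "\<And>y h. y \<in> P \<Longrightarrow> w' y h = T y (w' y h) + (frechet_derivative T (at y) h (w y) + frechet_derivative r (at y) h)"
    by metis
  show ?case
  proof (rule Ck_on_SucI[OF \<open>open P\<close> w'(1)])
    fix h
    have "Ck_on k P (\<lambda>y. frechet_derivative T (at y) h (w y) + frechet_derivative r (at y) h)"
      by (intro Ck_on_add \<open>open P\<close> Ck_on_bilinear[OF \<open>open P\<close> bounded_bilinear_blinfun_apply] wk)
        (use Suc.prems in auto)
    then show "Ck_on k P (\<lambda>y. w' y h)"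
      by (rule Suc.IH[OF Ck(1) _ w'(2)])
  qed
qed

subsection \<open>Superposition operators on bounded continuous functions\<close>

text \<open>The superposition (Nemytskii) operator. \<open>Bcontfun\<close> is meaningful only if
  the composite is bounded and continuous, which is secured either by values in a compact set
  (\<open>bcomp_apply\<close>) or by linearity (\<open>bcomp_linear_apply\<close>).\<close>

definition bcomp :: "('z::metric_space \<Rightarrow> 'x::metric_space) \<Rightarrow> ('t::topological_space \<Rightarrow>\<^sub>C 'z) \<Rightarrow> ('t \<Rightarrow>\<^sub>C 'x)"
  where "bcomp A z = Bcontfun (\<lambda>t. A (apply_bcontfun z t))"

lemma bcomp_apply:
  assumes "compact B" "continuous_on B A" "\<And>t. apply_bcontfun z t \<in> B"
  shows "apply_bcontfun (bcomp A z) t = A (apply_bcontfun z t)"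
proof -
  have "continuous_on UNIV (\<lambda>t. A (apply_bcontfun z t))"
    by (rule continuous_on_compose2[OF assms(2)]) (use assms(3) in auto)
  moreover have "bounded (range (\<lambda>t. A (apply_bcontfun z t)))"
    by (rule bounded_subset[OF compact_imp_bounded[OF compact_continuous_image[OF assms(2,1)]]]) (use assms(3) in auto)
  ultimately show ?thesis
    unfolding bcomp_def by (subst Bcontfun_inverse) (auto simp: bcontfun_def)
qed

lemma bcomp_linear_apply:
  assumes "bounded_linear f"
  shows "apply_bcontfun (bcomp f z) t = f (apply_bcontfun z t)"
proof -
  have "continuous_on UNIV (\<lambda>t. f (apply_bcontfun z t))"
    by (intro bounded_linear.continuous_on[OF assms]) auto
  moreover have "bounded (range (\<lambda>t. f (apply_bcontfun z t)))"
    using bounded_linear_image[OF bounded_apply_bcontfun[of z] assms] by (simp add: image_image)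
  ultimately show ?thesis
    unfolding bcomp_def by (subst Bcontfun_inverse) (auto simp: bcontfun_def)
qed

lemma bounded_linear_bcomp:
  assumes "bounded_linear f"
  shows "bounded_linear (bcomp f)"
proof -
  obtain K where K: "K \<ge> 0" "\<And>x. norm (f x) \<le> norm x * K"
    using bounded_linear.nonneg_bounded[OF assms] by blast
  show ?thesis
  proof (rule bounded_linear_intro)
    show "norm (bcomp f z) \<le> norm z * K" for z
    proof (rule norm_bound)
      show "norm (apply_bcontfun (bcomp f z) t) \<le> norm z * K" for t
        using K(2)[of "apply_bcontfun z t"] mult_right_mono[OF norm_bounded[of z t] K(1)]
        by (simp add: bcomp_linear_apply[OF assms])
    qed
  qed (auto intro!: bcontfun_eqI simp: bcomp_linear_apply assms linear_add linear_scale bounded_linear.linear)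
qed

definition bscale :: "('t::topological_space \<Rightarrow>\<^sub>C real) \<Rightarrow> ('t \<Rightarrow>\<^sub>C 'x::real_normed_vector) \<Rightarrow> ('t \<Rightarrow>\<^sub>C 'x)"
  where "bscale s g = Bcontfun (\<lambda>t. apply_bcontfun s t *\<^sub>R apply_bcontfun g t)"

lemma bscale_apply: "apply_bcontfun (bscale s g) t = apply_bcontfun s t *\<^sub>R apply_bcontfun g t"
proof -
  have "norm (apply_bcontfun s t *\<^sub>R apply_bcontfun g t) \<le> norm s * norm g" for t
    using mult_mono[OF norm_bounded[of s t] norm_bounded[of g t]] by simp
  then have "(\<lambda>t. apply_bcontfun s t *\<^sub>R apply_bcontfun g t) \<in> bcontfun"
    by (intro bcontfun_normI continuous_intros) auto
  then show ?thesis unfolding bscale_def by (simp add: Bcontfun_inverse)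
qed

lemma bounded_bilinear_bscale: "bounded_bilinear bscale"
proof
  show "\<exists>K. \<forall>a b. norm (bscale a b) \<le> norm a * norm (b :: 'a \<Rightarrow>\<^sub>C 'b) * K"
  proof (intro exI[of _ 1] allI norm_bound)
    show "norm (apply_bcontfun (bscale s g) t) \<le> norm s * norm g * 1" for s t and g :: "'a \<Rightarrow>\<^sub>C 'b"
      using mult_mono[OF norm_bounded[of s t] norm_bounded[of g t]] by (simp add: bscale_apply)
  qed
qed (auto intro!: bcontfun_eqI simp: bscale_apply algebra_simps)

section \<open>Differentiability of superposition operators\<close>

text \<open>The partial derivatives of \<open>A\<close> are uniformly continuous on the compact set
  \<open>B\<close>, and the mean value inequality is applied on a segment, which stays in
  \<open>B\<close> by convexity. Uniformity in the base point is what lets the estimate pass to the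
  sup norm.\<close>

lemma uniform_linearization:
  fixes A :: "'z::euclidean_space \<Rightarrow> 'x::real_normed_vector"
  assumes "open \<Omega>" "compact B" "convex B" "B \<subseteq> \<Omega>" "Ck_on (Suc 0) \<Omega> A" "e > 0"
  shows "\<exists>d>0. \<forall>a\<in>B. \<forall>b\<in>B. norm (b - a) < d \<longrightarrow>
    norm (A b - A a - frechet_derivative A (at a) (b - a)) \<le> e * norm (b - a)"
proof -
  let ?A' = "\<lambda>x. frechet_derivative A (at x)"
  \<comment> \<open>The norm of a linear map is bounded by a sum over the basis, which multiplies
    the error by the dimension.\<close>
  define e' where "e' = e / real DIM('z)"
  have "e' > 0" using assms(6) by (simp add: e'_def)
  have "\<forall>i\<in>Basis. \<exists>d>0. \<forall>x\<in>B. \<forall>y\<in>B. dist y x < d \<longrightarrow> dist (?A' y i) (?A' x i) < e'"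
  proof
    fix i :: 'z
    have "continuous_on B (\<lambda>x. ?A' x i)"
      using assms(5) by (auto intro: continuous_on_subset[OF _ assms(4)])
    then have "uniformly_continuous_on B (\<lambda>x. ?A' x i)"
      using compact_uniformly_continuous assms(2) by blast
    then show "\<exists>d>0. \<forall>x\<in>B. \<forall>y\<in>B. dist y x < d \<longrightarrow> dist (?A' y i) (?A' x i) < e'"
      using \<open>e' > 0\<close> unfolding uniformly_continuous_on_def by blast
  qed
  then obtain d where d: "\<And>i. i \<in> Basis \<Longrightarrow> d i > 0"
    "\<And>i x y. i \<in> Basis \<Longrightarrow> x \<in> B \<Longrightarrow> y \<in> B \<Longrightarrow> dist y x < d i \<Longrightarrow> dist (?A' y i) (?A' x i) < e'"
    by metis
  define D where "D = Min (d ` (Basis :: 'z set))"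
  have D: "D > 0" "\<And>i. i \<in> Basis \<Longrightarrow> D \<le> d i"
    using d(1) by (auto simp: D_def)
  have lin: "linear (?A' x)" if "x \<in> B" for x
    using Ck_on_SucD[OF assms(1,5)] assms(4) that has_derivative_linear by blast
  have on: "onorm (\<lambda>v. ?A' x v - ?A' a v) \<le> e" if "x \<in> B" "a \<in> B" "norm (x - a) < D" for x a
  proof (rule onorm_bound)
    show "norm (?A' x v - ?A' a v) \<le> e * norm v" for v
    proof -
      have "?A' x v - ?A' a v = (\<Sum>b\<in>Basis. (v \<bullet> b) *\<^sub>R (?A' x b - ?A' a b))"
        using linear_euclidean_expand[OF lin[OF that(1)], of v] linear_euclidean_expand[OF lin[OF that(2)], of v]
        by (simp add: scaleR_diff_right sum_subtractf)
      also have "norm \<dots> \<le> (\<Sum>b\<in>(Basis::'z set). norm v * e')"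
      proof (rule sum_norm_le)
        fix b :: 'z assume b: "b \<in> Basis"
        have "norm (?A' x b - ?A' a b) \<le> e'"
          using d(2)[OF b that(2,1)] D(2)[OF b] that(3) by (simp add: dist_norm)
        then show "norm ((v \<bullet> b) *\<^sub>R (?A' x b - ?A' a b)) \<le> norm v * e'"
          using Basis_le_norm[OF b, of v] by (simp add: mult_mono)
      qed
      also have "\<dots> = e * norm v" by (simp add: e'_def)
      finally show ?thesis .
    qed
  qed (use assms in auto)
  show ?thesis
  proof (intro exI[of _ D] conjI ballI impI D)
    fix a b assume ab: "a \<in> B" "b \<in> B" "norm (b - a) < D"
    have seg: "closed_segment a b \<subseteq> B"
      using ab assms(3) by (simp add: closed_segment_subset)
    have "norm (A b - A a - ?A' a (b - a)) \<le> norm (b - a) * e"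
    proof (rule differentiable_bound_linearization[where S="closed_segment a b"])
      show "a + t *\<^sub>R (b - a) \<in> closed_segment a b" if "t \<in> {0..1}" for t
        using that unfolding closed_segment_def by (auto intro!: exI[of _ t] simp: algebra_simps)
      show "(A has_derivative ?A' x) (at x within closed_segment a b)" if "x \<in> closed_segment a b" for x
        using Ck_on_SucD[OF assms(1,5), of x] that seg assms(4) has_derivative_at_withinI by blast
      show "onorm (?A' x - ?A' a) \<le> e" if "x \<in> closed_segment a b" for x
      proof -
        have "norm (x - a) < D" using segment_bound(1)[OF that] ab(3) by simp
        then show ?thesis using on[of x a] that seg ab by (auto simp: fun_diff_def)
      qed
    qed simp
    then show "norm (A b - A a - ?A' a (b - a)) \<le> e * norm (b - a)" by (simp add: mult.commute)
  qed
qed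

text \<open>The derivative of \<open>A\<close> along \<open>z\<close> applied to \<open>w\<close>,
  written with products of coordinates of \<open>w\<close> and superpositions of partial derivatives
  of \<open>A\<close>. It is thus assembled from operators of the kind already treated, so that
  inductions on smoothness close.\<close>

definition bcomp_deriv :: "('z::euclidean_space \<Rightarrow> 'x::real_normed_vector) \<Rightarrow> ('t::topological_space \<Rightarrow>\<^sub>C 'z) \<Rightarrow> ('t \<Rightarrow>\<^sub>C 'z) \<Rightarrow> ('t \<Rightarrow>\<^sub>C 'x)"
  where "bcomp_deriv A z w = (\<Sum>b\<in>Basis. bscale (bcomp (\<lambda>x. x \<bullet> b) w) (bcomp (\<lambda>x. frechet_derivative A (at x) b) z))"

lemma bounded_linear_bcomp_deriv: "bounded_linear (bcomp_deriv A z)"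
  unfolding bcomp_deriv_def
  by (intro bounded_linear_sum bounded_linear_compose[OF bounded_bilinear.bounded_linear_left[OF bounded_bilinear_bscale]]
      bounded_linear_bcomp bounded_linear_inner_left)

lemma apply_bcontfun_sum: "apply_bcontfun (\<Sum>i\<in>I. f i) t = (\<Sum>i\<in>I. apply_bcontfun (f i) t)"
  by (induction I rule: infinite_finite_induct) auto

lemma bcomp_deriv_apply:
  fixes A :: "'z::euclidean_space \<Rightarrow> 'x::real_normed_vector"
  assumes "open \<Omega>" "compact B" "B \<subseteq> \<Omega>" "Ck_on (Suc 0) \<Omega> A" "\<And>t. apply_bcontfun z t \<in> B"
  shows "apply_bcontfun (bcomp_deriv A z w) t = frechet_derivative A (at (apply_bcontfun z t)) (apply_bcontfun w t)"
proof -
  have "linear (frechet_derivative A (at (apply_bcontfun z t)))"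
    using Ck_on_SucD[OF assms(1,4)] assms(3,5) has_derivative_linear by blast
  moreover have "continuous_on B (\<lambda>x. frechet_derivative A (at x) b)" for b
    using assms(4) by (auto intro: continuous_on_subset[OF _ assms(3)])
  ultimately show ?thesis
    by (simp add: bcomp_deriv_def apply_bcontfun_sum bscale_apply bcomp_linear_apply bounded_linear_inner_left
        bcomp_apply[OF assms(2) _ assms(5)] linear_euclidean_expand)
qed

lemma bcomp_linearization:
  fixes A :: "'z::euclidean_space \<Rightarrow> 'x::real_normed_vector"
  assumes "open \<Omega>" "compact B" "convex B" "B \<subseteq> \<Omega>" "Ck_on (Suc 0) \<Omega> A" "e > 0"
  shows "\<exists>d>0. \<forall>z1 z2 :: 't::topological_space \<Rightarrow>\<^sub>C 'z. (\<forall>t. apply_bcontfun z1 t \<in> B) \<longrightarrow> (\<forall>t. apply_bcontfun z2 t \<in> B) \<longrightarrow>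
    norm (z2 - z1) < d \<longrightarrow> norm (bcomp A z2 - bcomp A z1 - bcomp_deriv A z1 (z2 - z1)) \<le> e * norm (z2 - z1)"
proof -
  obtain d where d: "d > 0" "\<And>a b. a \<in> B \<Longrightarrow> b \<in> B \<Longrightarrow> norm (b - a) < d \<Longrightarrow>
    norm (A b - A a - frechet_derivative A (at a) (b - a)) \<le> e * norm (b - a)"
    using uniform_linearization[OF assms] by blast
  have cont: "continuous_on B A"
    using Ck_on_continuous[OF assms(1,5)] assms(4) continuous_on_subset by blast
  show ?thesis
  proof (intro exI[of _ d] conjI allI impI d norm_bound)
    fix z1 z2 :: "'t \<Rightarrow>\<^sub>C 'z" and t
    assume z: "\<forall>t. apply_bcontfun z1 t \<in> B" "\<forall>t. apply_bcontfun z2 t \<in> B" "norm (z2 - z1) < d"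
    have n: "norm (apply_bcontfun z2 t - apply_bcontfun z1 t) \<le> norm (z2 - z1)"
      using norm_bounded[of "z2 - z1" t] by simp
    have "norm (apply_bcontfun (bcomp A z2 - bcomp A z1 - bcomp_deriv A z1 (z2 - z1)) t)
      \<le> e * norm (apply_bcontfun z2 t - apply_bcontfun z1 t)"
      using d(2)[of "apply_bcontfun z1 t" "apply_bcontfun z2 t"] z n
      by (simp add: bcomp_apply[OF assms(2) cont] bcomp_deriv_apply[OF assms(1,2,4,5)])
    also have "\<dots> \<le> e * norm (z2 - z1)" using n assms(6) by simp
    finally show "norm (apply_bcontfun (bcomp A z2 - bcomp A z1 - bcomp_deriv A z1 (z2 - z1)) t) \<le> e * norm (z2 - z1)" .
  qed
qed

text \<open>The map \<open>z\<close> is only assumed Lipschitz at \<open>y\<close>, so that this also applies to a solution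
  whose differentiability is still to be shown.\<close>

lemma has_derivative_bcomp_diff:
  fixes A :: "'z::euclidean_space \<Rightarrow> 'x::real_normed_vector" and z :: "'y::real_normed_vector \<Rightarrow> 't::topological_space \<Rightarrow>\<^sub>C 'z"
  assumes "open \<Omega>" "compact B" "convex B" "B \<subseteq> \<Omega>" "Ck_on (Suc 0) \<Omega> A"
    and "open P" "y \<in> P" "\<And>y t. y \<in> P \<Longrightarrow> apply_bcontfun (z y) t \<in> B"
    and lip: "\<forall>\<^sub>F y' in at y. norm (z y' - z y) \<le> K * norm (y' - y)"
  shows "((\<lambda>y'. bcomp A (z y') - bcomp_deriv A (z y) (z y')) has_derivative (\<lambda>h. 0)) (at y)"
  unfolding has_derivative_iff_norm
proof (intro conjI bounded_linear_zero tendstoI)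
  interpret bounded_linear "bcomp_deriv A (z y)" by (rule bounded_linear_bcomp_deriv)
  fix e :: real assume "e > 0"
  define e' where "e' = e / (2 * (\<bar>K\<bar> + 1))"
  have "e' > 0" using \<open>e > 0\<close> by (simp add: e'_def)
  from bcomp_linearization[OF assms(1-5) this, where 't='t]
  obtain d where d: "d > 0" "\<And>z1 z2 :: 't \<Rightarrow>\<^sub>C 'z. (\<forall>t. apply_bcontfun z1 t \<in> B) \<Longrightarrow> (\<forall>t. apply_bcontfun z2 t \<in> B) \<Longrightarrow>
    norm (z2 - z1) < d \<Longrightarrow> norm (bcomp A z2 - bcomp A z1 - bcomp_deriv A z1 (z2 - z1)) \<le> e' * norm (z2 - z1)"
    by blast
  have "\<forall>\<^sub>F y' in at y. y' \<in> P" using assms(6,7) by (metis eventually_at_topological)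
  moreover have "\<forall>\<^sub>F y' in at y. dist y' y < d / (\<bar>K\<bar> + 1)"
  proof -
    have "0 < d / (\<bar>K\<bar> + 1)" using d(1) by simp
    then show ?thesis unfolding eventually_at by blast
  qed
  moreover have "\<forall>\<^sub>F y' in at y. y' \<noteq> y" by (simp add: eventually_at_filter)
  ultimately show "\<forall>\<^sub>F y' in at y. dist (norm (bcomp A (z y') - bcomp_deriv A (z y) (z y') -
      (bcomp A (z y) - bcomp_deriv A (z y) (z y)) - 0) / norm (y' - y)) 0 < e"
    using lip
  proof eventually_elim
    case (elim y')
    then have pos: "norm (y' - y) > 0" by simp
    have K: "norm (z y' - z y) \<le> (\<bar>K\<bar> + 1) * norm (y' - y)"
      using elim(4) pos by (smt (verit) mult_right_mono)
    also have "\<dots> < d" using elim(2) by (simp add: dist_norm field_simps)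
    finally have "norm (z y' - z y) < d" .
    then have "norm (bcomp A (z y') - bcomp A (z y) - bcomp_deriv A (z y) (z y' - z y)) \<le> e' * norm (z y' - z y)"
      using d(2) assms(7,8) elim(1) by blast
    also have "\<dots> \<le> e' * ((\<bar>K\<bar> + 1) * norm (y' - y))" using K \<open>e' > 0\<close> by simp
    also have "\<dots> = e / 2 * norm (y' - y)" by (simp add: e'_def field_simps)
    also have "\<dots> < e * norm (y' - y)" using pos \<open>e > 0\<close> by simp
    finally show ?case using pos by (simp add: diff algebra_simps pos_divide_less_eq)
  qed
qed

lemma has_derivative_imp_lipschitz_at:
  assumes "(z has_derivative z') (at y)"
  obtains K where "\<forall>\<^sub>F y' in at y. norm (z y' - z y) \<le> K * norm (y' - y)"
proof -
  obtain K where K: "\<And>h. norm (z' h) \<le> norm h * K"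
    using bounded_linear.bounded[OF has_derivative_bounded_linear[OF assms]] by blast
  obtain d where d: "d > 0" "\<And>y'. norm (y' - y) < d \<Longrightarrow> norm (z y' - z y - z' (y' - y)) \<le> 1 * norm (y' - y)"
    using assms zero_less_one unfolding has_derivative_at_alt by blast
  have "\<forall>\<^sub>F y' in at y. dist y' y < d" using d(1) by (auto simp: eventually_at)
  then have "\<forall>\<^sub>F y' in at y. norm (z y' - z y) \<le> (K + 1) * norm (y' - y)"
  proof eventually_elim
    case (elim y')
    then have "norm (z y' - z y - z' (y' - y)) \<le> norm (y' - y)" using d(2)[of y'] by (simp add: dist_norm)
    then show ?case
      using K[of "y' - y"] norm_triangle_sub[of "z y' - z y" "z' (y' - y)"] by (simp add: algebra_simps)
  qed
  then show ?thesis using that by blast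
qed

text \<open>The derivative involves superpositions with the partial derivatives of \<open>A\<close>,
  to which the induction hypothesis applies because \<open>A\<close> is generalised.
  \<open>Ck_on_compose\<close> does not cover this case, since the middle space is a function
  space.\<close>

lemma Ck_on_bcomp:
  fixes A :: "'z::euclidean_space \<Rightarrow> 'x::real_normed_vector" and z :: "'y::real_normed_vector \<Rightarrow> 't::topological_space \<Rightarrow>\<^sub>C 'z"
  assumes "open \<Omega>" "compact B" "convex B" "B \<subseteq> \<Omega>" "open P" "\<And>y t. y \<in> P \<Longrightarrow> apply_bcontfun (z y) t \<in> B"
    and "Ck_on k P z" "Ck_on k \<Omega> A"
  shows "Ck_on k P (\<lambda>y. bcomp A (z y))"
  using assms(7,8)
proof (induction k arbitrary: A)
  case 0
  have cont: "continuous_on B A"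
    using 0 assms(4) continuous_on_subset by auto
  have uc: "uniformly_continuous_on B A"
    using compact_uniformly_continuous[OF cont assms(2)] .
  have "continuous_on P (\<lambda>y. bcomp A (z y))"
    unfolding continuous_on_iff
  proof (intro ballI allI impI)
    fix y and e :: real assume "y \<in> P" "e > 0"
    then have "0 < e / 2" by simp
    then obtain d where d: "d > 0" "\<And>a b. a \<in> B \<Longrightarrow> b \<in> B \<Longrightarrow> dist b a < d \<Longrightarrow> dist (A b) (A a) < e / 2"
      using uniformly_continuous_onE[OF uc] by metis
    have "continuous_on P z" using 0(1) by simp
    then obtain d' where d': "d' > 0" "\<And>y'. y' \<in> P \<Longrightarrow> dist y' y < d' \<Longrightarrow> dist (z y') (z y) < d"
      using \<open>y \<in> P\<close> d(1) unfolding continuous_on_iff by meson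
    have "dist (bcomp A (z y')) (bcomp A (z y)) < e" if y': "y' \<in> P" "dist y' y < d'" for y'
    proof -
      have "dist (bcomp A (z y')) (bcomp A (z y)) \<le> e / 2"
      proof (rule dist_bound)
        show "dist (apply_bcontfun (bcomp A (z y')) t) (apply_bcontfun (bcomp A (z y)) t) \<le> e / 2" for t
          using d(2)[of "apply_bcontfun (z y) t" "apply_bcontfun (z y') t"]
            dist_fun_lt_imp_dist_val_lt[OF d'(2)[OF y'], of t] assms(6) y' \<open>y \<in> P\<close>
          by (simp add: bcomp_apply[OF assms(2) cont])
      qed
      then show ?thesis using \<open>e > 0\<close> by simp
    qed
    then show "\<exists>d>0. \<forall>x'\<in>P. dist x' y < d \<longrightarrow> dist (bcomp A (z x')) (bcomp A (z y)) < e"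
      using d'(1) by blast
  qed
  then show ?case by simp
next
  case (Suc k)
  have A1: "Ck_on (Suc 0) \<Omega> A"
    using Suc.prems(2) Ck_on_continuous[OF assms(1)] by auto
  have D: "((\<lambda>y. bcomp A (z y)) has_derivative (\<lambda>h. bcomp_deriv A (z y) (frechet_derivative z (at y) h))) (at y)"
    if y: "y \<in> P" for y
  proof -
    have z: "(z has_derivative frechet_derivative z (at y)) (at y)"
      using Ck_on_SucD[OF assms(5) Suc.prems(1) y] .
    obtain K where K: "\<forall>\<^sub>F y' in at y. norm (z y' - z y) \<le> K * norm (y' - y)"
      using has_derivative_imp_lipschitz_at[OF z] .
    \<comment> \<open>The nonlinear remainder has derivative 0 by
      \<open>has_derivative_bcomp_diff\<close>; the linear part is added back with the chain
      rule.\<close>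
    have "((\<lambda>y'. bcomp A (z y') - bcomp_deriv A (z y) (z y') + bcomp_deriv A (z y) (z y')) has_derivative
      (\<lambda>h. 0 + bcomp_deriv A (z y) (frechet_derivative z (at y) h))) (at y)"
      by (rule has_derivative_add[OF has_derivative_bcomp_diff[OF assms(1-4) A1 assms(5) y assms(6) K]
            bounded_linear.has_derivative[OF bounded_linear_bcomp_deriv z]])
    then show ?thesis by simp
  qed
  show ?case
  proof (rule Ck_on_SucI[OF assms(5) D])
    fix h
    show "Ck_on k P (\<lambda>y. bcomp_deriv A (z y) (frechet_derivative z (at y) h))"
      unfolding bcomp_deriv_def
      by (intro Ck_on_sum assms(5) Ck_on_bilinear[OF assms(5) bounded_bilinear_bscale] Suc.IH
          Ck_on_compose_linear[OF assms(5) bounded_linear_bcomp] bounded_linear_inner_left Ck_on_Suc_imp[OF assms(5) Suc.prems(1)])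
        (use Suc.prems in auto)
  qed
qed

section \<open>Smooth dependence of contractive fixed points on a parameter\<close>

text \<open>\<open>\<epsilon>\<close> is a Lipschitz constant of \<open>A\<close> on
  \<open>B\<close>, \<open>\<Lambda>\<close> a bound for \<open>L\<close>, and
  \<open>\<kappa>\<close> the radius of the complete ball on which
  \<open>w \<mapsto> A (l y + L w)\<close> contracts. The fixed point is first shown to be Lipschitz
  in \<open>y\<close>, which makes \<open>has_derivative_bcomp_diff\<close> applicable; only then is
  it differentiated, and after that it gains one derivative at a time.\<close>

lemma smooth_fixed_point:
  fixes A :: "'z::euclidean_space \<Rightarrow> 'x::{real_normed_vector,complete_space}"
    and l :: "'y::real_normed_vector \<Rightarrow> ('t::metric_space \<Rightarrow>\<^sub>C 'z)"
    and L :: "('t \<Rightarrow>\<^sub>C 'x) \<Rightarrow> ('t \<Rightarrow>\<^sub>C 'z)"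
  assumes "open P" "open \<Omega>" "compact B" "convex B" "B \<subseteq> \<Omega>"
    and A: "\<And>k. Ck_on k \<Omega> A" and l: "\<And>k. Ck_on k P l" and L: "bounded_linear L"
    and eps: "\<And>x v. x \<in> B \<Longrightarrow> norm (frechet_derivative A (at x) v) \<le> \<epsilon> * norm v"
    and Lam: "\<And>w. norm (L w) \<le> \<Lambda> * norm w" and "0 \<le> \<epsilon>" "0 \<le> \<Lambda>" "\<epsilon> * \<Lambda> < 1" "0 \<le> \<kappa>"
    and into: "\<And>y w t. y \<in> P \<Longrightarrow> norm w \<le> \<kappa> \<Longrightarrow> apply_bcontfun (l y + L w) t \<in> B"
    and kap: "\<And>x. x \<in> B \<Longrightarrow> norm (A x) \<le> \<kappa>"
  obtains u where "\<And>y. y \<in> P \<Longrightarrow> norm (u y) \<le> \<kappa>"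
    and "\<And>y t. y \<in> P \<Longrightarrow> apply_bcontfun (u y) t = A (apply_bcontfun (l y + L (u y)) t)"
    and "\<And>y w. y \<in> P \<Longrightarrow> norm w \<le> \<kappa> \<Longrightarrow> (\<And>t. apply_bcontfun w t = A (apply_bcontfun (l y + L w) t)) \<Longrightarrow> w = u y"
    and "\<And>k. Ck_on k P u"
proof -
  interpret L: bounded_linear L by (rule L)
  have A1: "Ck_on (Suc 0) \<Omega> A" by (rule A)
  have cont: "continuous_on B A"
    using Ck_on_continuous[OF assms(2) A] assms(5) continuous_on_subset by blast
  have lipA: "norm (A a - A b) \<le> \<epsilon> * norm (a - b)" if "a \<in> B" "b \<in> B" for a b
    by (rule differentiable_bound[OF assms(4), of A "\<lambda>x. frechet_derivative A (at x)"])
      (use that assms(5) in \<open>auto intro!: onorm_bound eps \<open>0 \<le> \<epsilon>\<close> has_derivative_at_withinI[OF Ck_on_SucD[OF assms(2) A1]]\<close>)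
  have lip: "norm (bcomp A z1 - bcomp A z2) \<le> \<epsilon> * norm (z1 - z2)"
    if "\<And>t. apply_bcontfun z1 t \<in> B" "\<And>t. apply_bcontfun z2 t \<in> B" for z1 z2 :: "'t \<Rightarrow>\<^sub>C 'z"
  proof (rule norm_bound)
    fix t
    have "norm (apply_bcontfun (bcomp A z1 - bcomp A z2) t) \<le> \<epsilon> * norm (apply_bcontfun z1 t - apply_bcontfun z2 t)"
      using lipA that by (simp add: bcomp_apply[OF assms(3) cont])
    also have "\<dots> \<le> \<epsilon> * norm (z1 - z2)"
      using norm_bounded[of "z1 - z2" t] \<open>0 \<le> \<epsilon>\<close> by (simp add: mult_left_mono)
    finally show "norm (apply_bcontfun (bcomp A z1 - bcomp A z2) t) \<le> \<epsilon> * norm (z1 - z2)" .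
  qed
  have contr: "norm (bcomp A (l y1 + L w1) - bcomp A (l y2 + L w2)) \<le> \<epsilon> * norm (l y1 - l y2) + \<epsilon> * \<Lambda> * norm (w1 - w2)"
    if "y1 \<in> P" "y2 \<in> P" "norm w1 \<le> \<kappa>" "norm w2 \<le> \<kappa>" for y1 y2 w1 w2
  proof -
    have "norm (bcomp A (l y1 + L w1) - bcomp A (l y2 + L w2)) \<le> \<epsilon> * norm ((l y1 + L w1) - (l y2 + L w2))"
      using into that by (intro lip) auto
    also have "(l y1 + L w1) - (l y2 + L w2) = (l y1 - l y2) + L (w1 - w2)" by (simp add: L.diff)
    also have "norm \<dots> \<le> norm (l y1 - l y2) + \<Lambda> * norm (w1 - w2)"
      using norm_triangle_ineq Lam by (meson add_left_mono order_trans)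
    finally show ?thesis using \<open>0 \<le> \<epsilon>\<close> by (simp add: mult_left_mono distrib_left mult.assoc)
  qed
  have ex: "\<exists>!w. w \<in> cball 0 \<kappa> \<and> bcomp A (l y + L w) = w" if y: "y \<in> P" for y
  proof -
    have "\<exists>!w\<in>cball 0 \<kappa>. bcomp A (l y + L w) = w"
    proof (rule Banach_fix)
      show "complete (cball (0::'t \<Rightarrow>\<^sub>C 'x) \<kappa>)" by (simp add: complete_eq_closed)
      show "(\<lambda>w. bcomp A (l y + L w)) ` cball 0 \<kappa> \<subseteq> cball 0 \<kappa>"
        using into[OF y] kap by (auto intro!: norm_bound simp: bcomp_apply[OF assms(3) cont])
      show "dist (bcomp A (l y + L w1)) (bcomp A (l y + L w2)) \<le> (\<epsilon> * \<Lambda>) * dist w1 w2"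
        if "w1 \<in> cball 0 \<kappa>" "w2 \<in> cball 0 \<kappa>" for w1 w2
        using contr[OF y y, of w1 w2] that by (simp add: dist_norm)
    qed (use \<open>0 \<le> \<epsilon>\<close> \<open>0 \<le> \<Lambda>\<close> \<open>\<epsilon> * \<Lambda> < 1\<close> \<open>0 \<le> \<kappa>\<close> in auto)
    then show ?thesis by blast
  qed
  define u where "u y = (THE w. w \<in> cball 0 \<kappa> \<and> bcomp A (l y + L w) = w)" for y
  have u: "norm (u y) \<le> \<kappa>" "bcomp A (l y + L (u y)) = u y" if "y \<in> P" for y
    using theI'[OF ex[OF that]] unfolding u_def by auto
  define z where "z y = l y + L (u y)" for y
  have zB: "apply_bcontfun (z y) t \<in> B" if "y \<in> P" for y t
    unfolding z_def by (rule into[OF that u(1)[OF that]])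
  have dl: "(l has_derivative frechet_derivative l (at y)) (at y)" if "y \<in> P" for y
    using Ck_on_SucD[OF assms(1) l that] .
  \<comment> \<open>Subtracting the equations at \<open>y'\<close> and \<open>y\<close> and
    absorbing the term with factor \<open>\<epsilon> * \<Lambda> < 1\<close> bounds the increment of
    \<open>u\<close> by that of \<open>l\<close>.\<close>
  have lipz: "\<exists>K. \<forall>\<^sub>F y' in at y. norm (z y' - z y) \<le> K * norm (y' - y)" if y: "y \<in> P" for y
  proof -
    obtain K where "\<forall>\<^sub>F y' in at y. norm (l y' - l y) \<le> K * norm (y' - y)"
      using has_derivative_imp_lipschitz_at[OF dl[OF y]] .
    moreover have "\<forall>\<^sub>F y' in at y. y' \<in> P" using assms(1) y by (metis eventually_at_topological)
    ultimately have "\<forall>\<^sub>F y' in at y. norm (z y' - z y) \<le> (1 + \<Lambda> * (\<epsilon> / (1 - \<epsilon> * \<Lambda>))) * K * norm (y' - y)"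
    proof eventually_elim
      case (elim y')
      have "norm (u y' - u y) \<le> \<epsilon> * norm (l y' - l y) + \<epsilon> * \<Lambda> * norm (u y' - u y)"
        using contr[OF elim(2) y u(1)[OF elim(2)] u(1)[OF y]] u(2) elim(2) y by metis
      then have "(1 - \<epsilon> * \<Lambda>) * norm (u y' - u y) \<le> \<epsilon> * norm (l y' - l y)" by (simp add: algebra_simps)
      then have un: "norm (u y' - u y) \<le> \<epsilon> / (1 - \<epsilon> * \<Lambda>) * norm (l y' - l y)"
        using \<open>\<epsilon> * \<Lambda> < 1\<close> by (simp add: pos_le_divide_eq mult.commute)
      have "norm (z y' - z y) = norm ((l y' - l y) + L (u y' - u y))" by (simp add: z_def L.diff add_diff_add)
      also have "\<dots> \<le> norm (l y' - l y) + \<Lambda> * norm (u y' - u y)"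
        using norm_triangle_ineq Lam by (meson add_left_mono order_trans)
      also have "\<dots> \<le> norm (l y' - l y) + \<Lambda> * (\<epsilon> / (1 - \<epsilon> * \<Lambda>) * norm (l y' - l y))"
        by (intro add_left_mono mult_left_mono un \<open>0 \<le> \<Lambda>\<close>)
      also have "\<dots> = (1 + \<Lambda> * (\<epsilon> / (1 - \<epsilon> * \<Lambda>))) * norm (l y' - l y)" by (simp add: algebra_simps)
      also have "\<dots> \<le> (1 + \<Lambda> * (\<epsilon> / (1 - \<epsilon> * \<Lambda>))) * (K * norm (y' - y))"
        using \<open>0 \<le> \<epsilon>\<close> \<open>0 \<le> \<Lambda>\<close> \<open>\<epsilon> * \<Lambda> < 1\<close> by (intro mult_left_mono[OF elim(1)]) auto
      finally show ?case by simp
    qed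
    then show ?thesis by blast
  qed
  have bil: "bounded_bilinear (\<lambda>w g. bscale (bcomp (\<lambda>x. x \<bullet> b) (L w)) g)" for b
    by (rule bounded_bilinear.comp1[OF bounded_bilinear_bscale bounded_linear_compose[OF bounded_linear_bcomp[OF bounded_linear_inner_left] L]])
  \<comment> \<open>The operator \<open>w \<mapsto> bcomp_deriv A (z y) (L w)\<close>. Building it
    with \<open>prod_left\<close> exhibits it as a bounded linear image of superpositions, so it is
    C^k in the operator norm and not merely pointwise.\<close>
  define T where "T y = (\<Sum>b\<in>Basis. bounded_bilinear.prod_left (\<lambda>w g. bscale (bcomp (\<lambda>x. x \<bullet> b) (L w)) g)
      (bcomp (\<lambda>x. frechet_derivative A (at x) b) (z y)))" for y
  have T: "T y w = bcomp_deriv A (z y) (L w)" for y w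
    by (simp add: T_def bcomp_deriv_def blinfun.sum_left bounded_bilinear.prod_left.rep_eq[OF bil])
  have Tn: "norm (T y w) \<le> \<epsilon> * \<Lambda> * norm w" if y: "y \<in> P" for y w
    unfolding T
  proof (rule norm_bound)
    fix t
    have "norm (apply_bcontfun (bcomp_deriv A (z y) (L w)) t) \<le> \<epsilon> * norm (apply_bcontfun (L w) t)"
      using eps[OF zB[OF y]] by (simp add: bcomp_deriv_apply[OF assms(2,3,5) A1 zB[OF y]])
    also have "\<dots> \<le> \<epsilon> * (\<Lambda> * norm w)"
      using norm_bounded[of "L w" t] Lam[of w] \<open>0 \<le> \<epsilon>\<close> by (intro mult_left_mono) auto
    finally show "norm (apply_bcontfun (bcomp_deriv A (z y) (L w)) t) \<le> \<epsilon> * \<Lambda> * norm w" by simp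
  qed
  have el: "0 \<le> \<epsilon> * \<Lambda>" using \<open>0 \<le> \<epsilon>\<close> \<open>0 \<le> \<Lambda>\<close> by simp
  have "\<exists>u'. (u has_derivative u') (at y) \<and> (\<forall>h. u' h = T y (u' h) + bcomp_deriv A (z y) (frechet_derivative l (at y) h))"
    if y: "y \<in> P" for y
  proof -
    interpret N: bounded_linear "bcomp_deriv A (z y)" by (rule bounded_linear_bcomp_deriv)
    obtain K where K: "\<forall>\<^sub>F y' in at y. norm (z y' - z y) \<le> K * norm (y' - y)" using lipz[OF y] by blast
    have "((\<lambda>y'. bcomp A (z y') - bcomp_deriv A (z y) (z y') + bcomp_deriv A (z y) (l y')) has_derivative
      (\<lambda>h. 0 + bcomp_deriv A (z y) (frechet_derivative l (at y) h))) (at y)"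
      by (rule has_derivative_add[OF has_derivative_bcomp_diff[OF assms(2-5) A1 assms(1) y zB K]
            bounded_linear.has_derivative[OF bounded_linear_bcomp_deriv dl[OF y]]])
    \<comment> \<open>Splitting \<open>z y'\<close> into \<open>l y' + L (u y')\<close> collects the
      unknown in \<open>u y' - T y (u y')\<close> and leaves a side whose derivative is already
      known.\<close>
    moreover have "bcomp A (z y') - bcomp_deriv A (z y) (z y') + bcomp_deriv A (z y) (l y') = u y' - T y (u y')"
      if "y' \<in> P" for y'
      using u(2)[OF that] by (simp add: T z_def[of y'] N.add)
    ultimately have "((\<lambda>y'. u y' - T y (u y')) has_derivative
      (\<lambda>h. 0 + bcomp_deriv A (z y) (frechet_derivative l (at y) h))) (at y)"
      by (rule has_derivative_transform_within_open[OF _ assms(1) y])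
    from has_derivative_of_contraction[OF Tn[OF y] el \<open>\<epsilon> * \<Lambda> < 1\<close> this]
    show ?thesis by (metis add_0)
  qed
  then obtain u' where u': "\<And>y. y \<in> P \<Longrightarrow> (u has_derivative u' y) (at y)"
    "\<And>y h. y \<in> P \<Longrightarrow> u' y h = T y (u' y h) + bcomp_deriv A (z y) (frechet_derivative l (at y) h)"
    by metis
  have "Ck_on k P u" for k
  proof (induction k)
    case 0
    have "continuous_on P u"
      using u'(1) has_derivative_continuous continuous_at_imp_continuous_on by blast
    then show ?case by simp
  next
    case (Suc k)
    have z: "Ck_on k P z"
      unfolding z_def by (intro Ck_on_add assms(1) l Ck_on_compose_linear[OF assms(1) L] Suc)
    have dA: "Ck_on k \<Omega> (\<lambda>x. frechet_derivative A (at x) b)" for b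
      using A[of "Suc k"] by simp
    have bA: "Ck_on k P (\<lambda>y. bcomp (\<lambda>x. frechet_derivative A (at x) b) (z y))" for b
      by (rule Ck_on_bcomp[OF assms(2-5,1) zB z dA])
    have TC: "Ck_on k P T"
      unfolding T_def
      by (intro Ck_on_sum assms(1) Ck_on_compose_linear[OF assms(1) bounded_bilinear.bounded_linear_prod_left[OF bil]] bA)
    show ?case
    proof (rule Ck_on_SucI[OF assms(1) u'(1)])
      fix h
      have dl: "Ck_on k P (\<lambda>y. frechet_derivative l (at y) h)" using l[of "Suc k"] by simp
      have "Ck_on k P (\<lambda>y. bcomp_deriv A (z y) (frechet_derivative l (at y) h))"
        unfolding bcomp_deriv_def
        by (intro Ck_on_sum assms(1) Ck_on_bilinear[OF assms(1) bounded_bilinear_bscale] bA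
            Ck_on_compose_linear[OF assms(1) bounded_linear_bcomp] bounded_linear_inner_left dl)
      then show "Ck_on k P (\<lambda>y. u' y h)"
        using Ck_on_linear_fixpoint[OF assms(1) el \<open>\<epsilon> * \<Lambda> < 1\<close> TC Tn, of "\<lambda>y. bcomp_deriv A (z y) (frechet_derivative l (at y) h)" "\<lambda>y. u' y h"] u'(2)
        by blast
    qed
  qed
  moreover have "apply_bcontfun (u y) t = A (apply_bcontfun (l y + L (u y)) t)" if "y \<in> P" for y t
    using u(2)[OF that] bcomp_apply[OF assms(3) cont into[OF that u(1)[OF that]]] by metis
  moreover have "w = u y" if y: "y \<in> P" "norm w \<le> \<kappa>" "\<And>t. apply_bcontfun w t = A (apply_bcontfun (l y + L w) t)" for y w
  proof -
    have "bcomp A (l y + L w) = w"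
      using y(3) by (intro bcontfun_eqI) (simp only: bcomp_apply[OF assms(3) cont into[OF y(1,2)]])
    then have "w \<in> cball 0 \<kappa> \<and> bcomp A (l y + L w) = w" using y(2) by simp
    then show ?thesis unfolding u_def by (rule the1_equality[OF ex[OF y(1)], symmetric])
  qed
  ultimately show ?thesis using that[of u] u(1) by blast
qed

subsection \<open>Integration of bounded continuous functions over the unit interval\<close>

text \<open>The bounded continuous functions live on the whole real line; a function on
  \<open>{0..1}\<close> is represented by its constant extension beyond both ends.\<close>

abbreviation cl :: "real \<Rightarrow> real" where "cl \<equiv> clamp 0 1"

lemma cl_unit: "cl t \<in> {0..1}"
  using clamp_in_interval[of 0 "1::real" t] by simp

lemma cl_unit_eq: "t \<in> {0..1} \<Longrightarrow> cl t = t"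
  using clamp_cancel_cbox[of t 0 "1::real"] by simp

lemma continuous_on_cl: "continuous_on S cl"
  using clamp_continuous_on[of 0 "1::real" "\<lambda>x. x"] by (simp add: continuous_on_id)

lemma bcontfun_clE:
  fixes f :: "real \<Rightarrow> 'b::metric_space"
  assumes "continuous_on {0..1} f"
  obtains g :: "real \<Rightarrow>\<^sub>C 'b" where "\<And>t. apply_bcontfun g t = f (cl t)"
  using continuous_on_cbox_bcontfunE[of 0 1 f] assms by auto

text \<open>The primitive vanishing at 0, again extended constantly. As the interval has length 1,
  integration costs no constant in the estimates.\<close>

definition bint :: "(real \<Rightarrow>\<^sub>C 'x::banach) \<Rightarrow> (real \<Rightarrow>\<^sub>C 'x)"
  where "bint u = Bcontfun (\<lambda>t. integral {0..cl t} (apply_bcontfun u))"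

lemma bint_bound:
  fixes u :: "real \<Rightarrow>\<^sub>C 'x::banach"
  shows "norm (integral {0..cl t} (apply_bcontfun u)) \<le> norm u"
proof -
  have "norm (integral {0..cl t} (apply_bcontfun u)) \<le> norm u * (cl t - 0)"
    by (rule integral_bound) (use cl_unit norm_bounded in auto)
  also have "\<dots> \<le> norm u" using cl_unit[of t] by (simp add: mult_left_le)
  finally show ?thesis .
qed

lemma bint_apply: "apply_bcontfun (bint u) t = integral {0..cl t} (apply_bcontfun u)"
proof -
  have "continuous_on {0..1} (\<lambda>t. integral {0..t} (apply_bcontfun u))"
    by (intro indefinite_integral_continuous_1 integrable_continuous_real) simp
  then have "continuous_on UNIV (\<lambda>t. integral {0..cl t} (apply_bcontfun u))"
    by (rule continuous_on_compose2[OF _ continuous_on_cl]) (use cl_unit in auto)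
  then have "(\<lambda>t. integral {0..cl t} (apply_bcontfun u)) \<in> bcontfun"
    using bint_bound by (rule bcontfun_normI)
  then show ?thesis unfolding bint_def by (simp add: Bcontfun_inverse)
qed

lemma norm_bint_le: "norm (bint u) \<le> norm u"
  by (rule norm_bound) (simp add: bint_apply bint_bound)

lemma bounded_linear_bint: "bounded_linear bint"
proof (rule bounded_linear_intro[where K=1])
  show "bint (u + v) = bint u + bint v" for u v :: "real \<Rightarrow>\<^sub>C 'a"
    by (auto intro!: bcontfun_eqI integral_add integrable_continuous_real simp: bint_apply)
  show "bint (r *\<^sub>R u) = r *\<^sub>R bint u" for r and u :: "real \<Rightarrow>\<^sub>C 'a"
    by (auto intro!: bcontfun_eqI simp: bint_apply)
qed (simp add: norm_bint_le)

lemma bint_has_vector_derivative: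
  assumes "t \<in> {0..1}"
  shows "(apply_bcontfun (bint u) has_vector_derivative apply_bcontfun u t) (at t within {0..1})"
proof (rule has_vector_derivative_transform[OF assms])
  show "((\<lambda>t. integral {0..t} (apply_bcontfun u)) has_vector_derivative apply_bcontfun u t) (at t within {0..1})"
    by (rule integral_has_vector_derivative) (use assms in auto)
qed (simp add: bint_apply cl_unit_eq)

lemma bint_eq_diff:
  assumes "\<And>t. t \<in> {0..1} \<Longrightarrow> (c has_vector_derivative apply_bcontfun u t) (at t within {0..1})"
  shows "apply_bcontfun (bint u) t = c (cl t) - c 0"
proof -
  have "(apply_bcontfun u has_integral (c (cl t) - c 0)) {0..cl t}"
    by (rule fundamental_theorem_of_calculus)
      (use cl_unit[of t] in \<open>auto intro: has_vector_derivative_within_subset[OF assms]\<close>)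
  then show ?thesis by (simp add: bint_apply integral_unique)
qed

lemma bint_0: "apply_bcontfun (bint u) 0 = 0"
  by (simp add: bint_apply cl_unit_eq)

lemma bounded_linear_const_bcontfun: "bounded_linear (const_bcontfun :: 'x::real_normed_vector \<Rightarrow> 't::topological_space \<Rightarrow>\<^sub>C 'x)"
  by (rule bounded_linear_intro[where K=1]) (auto intro!: bcontfun_eqI norm_bound)

definition bpair :: "('t::topological_space \<Rightarrow>\<^sub>C 'x::real_normed_vector) \<Rightarrow> ('t \<Rightarrow>\<^sub>C 'z::real_normed_vector) \<Rightarrow> ('t \<Rightarrow>\<^sub>C ('x \<times> 'z))"
  where "bpair f g = bcomp (\<lambda>x. (x, 0)) f + bcomp (\<lambda>x. (0, x)) g"

lemma bounded_linear_inl: "bounded_linear (\<lambda>x. (x, 0))" and bounded_linear_inr: "bounded_linear (\<lambda>x. (0, x))"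
  by (intro bounded_linear_Pair bounded_linear_ident bounded_linear_zero)+

lemma bpair_apply: "apply_bcontfun (bpair f g) t = (apply_bcontfun f t, apply_bcontfun g t)"
  by (simp add: bpair_def bcomp_linear_apply bounded_linear_inl bounded_linear_inr)

lemma bounded_linear_bpair:
  assumes "bounded_linear f" "bounded_linear g" shows "bounded_linear (\<lambda>y. bpair (f y) (g y))"
  unfolding bpair_def
  by (intro bounded_linear_add bounded_linear_compose[OF bounded_linear_bcomp] bounded_linear_inl bounded_linear_inr assms)

subsection \<open>The integral equation of a second order initial or boundary value problem\<close>

text \<open>A curve \<open>c\<close> on the unit interval is recovered from \<open>u = c''\<close> and
  \<open>y = (c 0, \<xi>)\<close>, where \<open>c' 0 = \<xi> + \<theta> u\<close>. The choice \<open>\<theta> = 0\<close> gives the initial value problem, and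
  \<open>\<theta> u = - (bint (bint u)) 1\<close> with \<open>\<xi> = c 1 - c 0\<close> gives the boundary value problem.\<close>

definition vel :: "((real \<Rightarrow>\<^sub>C 'x::banach) \<Rightarrow> 'x) \<Rightarrow> 'x \<times> 'x \<Rightarrow> (real \<Rightarrow>\<^sub>C 'x) \<Rightarrow> (real \<Rightarrow>\<^sub>C 'x)"
  where "vel \<theta> y u = const_bcontfun (snd y + \<theta> u) + bint u"

definition pos :: "((real \<Rightarrow>\<^sub>C 'x::banach) \<Rightarrow> 'x) \<Rightarrow> 'x \<times> 'x \<Rightarrow> (real \<Rightarrow>\<^sub>C 'x) \<Rightarrow> (real \<Rightarrow>\<^sub>C 'x)"
  where "pos \<theta> y u = const_bcontfun (fst y) + bint (vel \<theta> y u)"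

definition state :: "((real \<Rightarrow>\<^sub>C 'x::banach) \<Rightarrow> 'x) \<Rightarrow> 'x \<times> 'x \<Rightarrow> (real \<Rightarrow>\<^sub>C 'x) \<Rightarrow> (real \<Rightarrow>\<^sub>C ('x \<times> 'x))"
  where "state \<theta> y u = bpair (pos \<theta> y u) (vel \<theta> y u)"

definition bvp :: "(real \<Rightarrow>\<^sub>C 'x::banach) \<Rightarrow> 'x"
  where "bvp u = - apply_bcontfun (bint (bint u)) 1"

lemma bounded_linear_apply_bcontfun: "bounded_linear (\<lambda>u. apply_bcontfun u t)"
  by (rule bounded_linear_intro[where K=1]) (auto simp: norm_bounded)

lemma bounded_linear_bvp: "bounded_linear bvp"
  unfolding bvp_def
  by (intro bounded_linear_minus bounded_linear_compose[OF bounded_linear_apply_bcontfun]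
      bounded_linear_compose[OF bounded_linear_bint] bounded_linear_bint)

lemma norm_bvp_le: "norm (bvp u) \<le> norm u"
proof -
  have "norm (bvp u) \<le> norm (bint (bint u))" unfolding bvp_def norm_minus_cancel by (rule norm_bounded)
  also have "\<dots> \<le> norm u" by (rule order_trans[OF norm_bint_le norm_bint_le])
  finally show ?thesis .
qed

text \<open>By joint linearity in \<open>(y, u)\<close>. Data and unknown separate into the form
  \<open>l y + L u\<close> that \<open>smooth_fixed_point\<close> requires.\<close>

lemma state_split:
  assumes "bounded_linear \<theta>"
  shows "state \<theta> y u = state \<theta> y 0 + state \<theta> 0 u"
proof -
  interpret l: bounded_linear \<theta> by (rule assms)
  interpret b: bounded_linear bint by (rule bounded_linear_bint)
  have v: "vel \<theta> y u = vel \<theta> y 0 + vel \<theta> 0 u"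
    by (rule bcontfun_eqI) (simp add: vel_def l.zero b.zero)
  have "pos \<theta> y u = pos \<theta> y 0 + pos \<theta> 0 u"
    unfolding pos_def v by (rule bcontfun_eqI) (simp add: b.add)
  with v show ?thesis
    by (intro bcontfun_eqI) (simp add: state_def bpair_apply)
qed

lemma bounded_linear_state1:
  fixes \<theta> :: "(real \<Rightarrow>\<^sub>C 'x::banach) \<Rightarrow> 'x"
  assumes "bounded_linear \<theta>"
  shows "bounded_linear (\<lambda>y. state \<theta> y 0)"
proof -
  interpret l: bounded_linear \<theta> by (rule assms)
  interpret b: bounded_linear "bint :: (real \<Rightarrow>\<^sub>C 'x) \<Rightarrow> _" by (rule bounded_linear_bint)
  show ?thesis
    unfolding state_def pos_def vel_def l.zero b.zero add_0_right
    by (intro bounded_linear_bpair bounded_linear_add bounded_linear_compose[OF bounded_linear_bint]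
        bounded_linear_compose[OF bounded_linear_const_bcontfun] bounded_linear_fst bounded_linear_snd)
qed

lemma bounded_linear_state2:
  assumes "bounded_linear \<theta>"
  shows "bounded_linear (state \<theta> 0)"
  unfolding state_def pos_def vel_def fst_zero snd_zero add_0 const_bcontfun_0_eq_0
  by (intro bounded_linear_bpair bounded_linear_add bounded_linear_compose[OF bounded_linear_bint]
      bounded_linear_compose[OF bounded_linear_const_bcontfun] assms bounded_linear_bint)

text \<open>The velocity is at most \<open>norm (\<theta> u) + norm (bint u)\<close>, hence
  \<open>2 * norm u\<close>, and its integral obeys the same bound. The 4 is the
  \<open>\<Lambda>\<close> of the fixed point problem, to be beaten by a Lipschitz constant
  1/16.\<close>

lemma norm_state2_le:
  assumes "\<And>u. norm (\<theta> u) \<le> norm u"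
  shows "norm (state \<theta> 0 u) \<le> 4 * norm u"
proof -
  have v: "norm (vel \<theta> 0 u) \<le> 2 * norm u"
  proof (rule norm_bound)
    show "norm (apply_bcontfun (vel \<theta> 0 u) t) \<le> 2 * norm u" for t
      using norm_triangle_ineq[of "\<theta> u" "apply_bcontfun (bint u) t"] assms[of u]
        norm_bounded[of "bint u" t] norm_bint_le[of u] by (simp add: vel_def)
  qed
  show ?thesis
  proof (rule norm_bound)
    fix t
    have "norm (apply_bcontfun (state \<theta> 0 u) t) \<le> norm (apply_bcontfun (bint (vel \<theta> 0 u)) t) + norm (apply_bcontfun (vel \<theta> 0 u) t)"
      using norm_Pair_le by (simp add: state_def bpair_apply pos_def)
    also have "\<dots> \<le> norm (vel \<theta> 0 u) + norm (vel \<theta> 0 u)"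
      by (intro add_mono norm_bounded order_trans[OF norm_bounded norm_bint_le])
    finally show "norm (apply_bcontfun (state \<theta> 0 u) t) \<le> 4 * norm u" using v by simp
  qed
qed

text \<open>With zero acceleration the curve is straight; \<open>snd y\<close> enters once as the
  velocity and at most once as displacement.\<close>

lemma norm_state1_le:
  assumes "bounded_linear \<theta>"
  shows "norm (apply_bcontfun (state \<theta> y 0) t - (p, 0)) \<le> norm (fst y - p) + 2 * norm (snd y)"
proof -
  interpret l: bounded_linear \<theta> by (rule assms)
  interpret b: bounded_linear bint by (rule bounded_linear_bint)
  have "vel \<theta> y 0 = const_bcontfun (snd y)" by (simp add: vel_def l.zero b.zero)
  then have "apply_bcontfun (state \<theta> y 0) t - (p, 0) = (fst y - p + apply_bcontfun (bint (const_bcontfun (snd y))) t, snd y)"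
    by (simp add: state_def pos_def bpair_apply)
  then have "norm (apply_bcontfun (state \<theta> y 0) t - (p, 0)) \<le> norm (fst y - p + apply_bcontfun (bint (const_bcontfun (snd y))) t) + norm (snd y)"
    using norm_Pair_le by metis
  moreover have "norm (const_bcontfun (snd y) :: real \<Rightarrow>\<^sub>C 'a) \<le> norm (snd y)"
    by (rule norm_bound) simp
  then have "norm (apply_bcontfun (bint (const_bcontfun (snd y))) t) \<le> norm (snd y)"
    using norm_bounded[of "bint (const_bcontfun (snd y))" t] norm_bint_le[of "const_bcontfun (snd y)"] by linarith
  ultimately show ?thesis
    using norm_triangle_ineq[of "fst y - p" "apply_bcontfun (bint (const_bcontfun (snd y))) t"] by linarith
qed

text \<open>The velocity is an explicit argument, which makes this a first order system. Derivatives
  are taken within \<open>S\<close>, so they are one-sided at the ends of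
  \<open>{0..1}\<close>.\<close>

definition geod_eq :: "('x::real_normed_vector \<times> 'x \<Rightarrow> 'x) \<Rightarrow> real set \<Rightarrow> (real \<Rightarrow> 'x) \<Rightarrow> (real \<Rightarrow> 'x) \<Rightarrow> bool"
  where "geod_eq A S c c' \<longleftrightarrow> (\<forall>t\<in>S. (c has_vector_derivative c' t) (at t within S) \<and>
    (c' has_vector_derivative A (c t, c' t)) (at t within S))"

lemma geod_eq_state:
  assumes "\<And>t. apply_bcontfun u t = A (apply_bcontfun (state \<theta> y u) t)"
  shows "geod_eq A {0..1} (apply_bcontfun (pos \<theta> y u)) (apply_bcontfun (vel \<theta> y u))"
  unfolding geod_eq_def
proof (intro ballI conjI)
  fix t :: real assume t: "t \<in> {0..1}"
  have "apply_bcontfun (pos \<theta> y u) = (\<lambda>t. fst y + apply_bcontfun (bint (vel \<theta> y u)) t)"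
    by (auto simp: pos_def)
  then show "(apply_bcontfun (pos \<theta> y u) has_vector_derivative apply_bcontfun (vel \<theta> y u) t) (at t within {0..1})"
    using has_vector_derivative_add[OF has_vector_derivative_const bint_has_vector_derivative[OF t, of "vel \<theta> y u"]] by simp
  have "apply_bcontfun (vel \<theta> y u) = (\<lambda>t. (snd y + \<theta> u) + apply_bcontfun (bint u) t)"
    by (auto simp: vel_def)
  moreover have "A (apply_bcontfun (pos \<theta> y u) t, apply_bcontfun (vel \<theta> y u) t) = apply_bcontfun u t"
    using assms[of t] by (simp add: state_def bpair_apply)
  ultimately show "(apply_bcontfun (vel \<theta> y u) has_vector_derivative A (apply_bcontfun (pos \<theta> y u) t, apply_bcontfun (vel \<theta> y u) t)) (at t within {0..1})"
    using has_vector_derivative_add[OF has_vector_derivative_const bint_has_vector_derivative[OF t, of u]] by simp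
qed

lemma state_of_geod:
  assumes "geod_eq A {0..1} c c'" and u: "\<And>t. apply_bcontfun u t = A (c (cl t), c' (cl t))"
    and "c 0 = fst y" "c' 0 = snd y + \<theta> u"
  shows "apply_bcontfun (state \<theta> y u) t = (c (cl t), c' (cl t))"
proof -
  have g: "(c has_vector_derivative c' t) (at t within {0..1})"
    "(c' has_vector_derivative apply_bcontfun u t) (at t within {0..1})" if "t \<in> {0..1}" for t
    using assms(1) that by (auto simp: geod_eq_def u cl_unit_eq)
  have v: "apply_bcontfun (vel \<theta> y u) t = c' (cl t)" for t
    using bint_eq_diff[OF g(2), of t] assms(4) by (simp add: vel_def)
  have "apply_bcontfun (bint (vel \<theta> y u)) t = c (cl t) - c 0"
    by (rule bint_eq_diff) (use g(1) in \<open>simp add: v cl_unit_eq\<close>)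
  with v show ?thesis using assms(3) by (simp add: state_def bpair_apply pos_def)
qed

lemma geod_acceleration:
  fixes A :: "'x::real_normed_vector \<times> 'x \<Rightarrow> 'x"
  assumes "geod_eq A {0..1} c c'" "continuous_on W A" "\<And>t. t \<in> {0..1} \<Longrightarrow> (c t, c' t) \<in> W"
  obtains u where "\<And>t. apply_bcontfun u t = A (c (cl t), c' (cl t))"
proof -
  have "continuous_on {0..1} c" "continuous_on {0..1} c'"
    using assms(1) unfolding geod_eq_def continuous_on_eq_continuous_within
    using has_vector_derivative_continuous by blast+
  then have "continuous_on {0..1} (\<lambda>t. A (c t, c' t))"
    by (intro continuous_on_compose2[OF assms(2)] continuous_intros) (use assms(3) in auto)
  then show ?thesis using that bcontfun_clE by metis
qed

text \<open>Integrating \<open>c''\<close> twice gives \<open>c 1 - c 0 - c' 0\<close>. Every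
  geodesic therefore satisfies the condition that the choice \<open>\<theta> = bvp\<close> imposes
  on the initial velocity.\<close>

lemma geod_bvp_initial_velocity:
  fixes A :: "'x::banach \<times> 'x \<Rightarrow> 'x"
  assumes "geod_eq A {0..1} c c'" and u: "\<And>t. apply_bcontfun u t = A (c (cl t), c' (cl t))"
  shows "c' 0 = (c 1 - c 0) + bvp u"
proof -
  have g: "(c has_vector_derivative c' t) (at t within {0..1})"
    "(c' has_vector_derivative apply_bcontfun u t) (at t within {0..1})" if "t \<in> {0..1}" for t
    using assms(1) that by (auto simp: geod_eq_def u cl_unit_eq)
  have b: "apply_bcontfun (bint u) t = c' (cl t) - c' 0" for t
    by (rule bint_eq_diff[OF g(2)])
  have "apply_bcontfun (bint (bint u)) 1 = (\<lambda>t. c t - t *\<^sub>R c' 0) (cl 1) - (\<lambda>t. c t - t *\<^sub>R c' 0) 0"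
  proof (rule bint_eq_diff)
    fix t :: real assume t: "t \<in> {0..1}"
    show "((\<lambda>t. c t - t *\<^sub>R c' 0) has_vector_derivative apply_bcontfun (bint u) t) (at t within {0..1})"
      using g(1)[OF t] t by (auto intro!: derivative_eq_intros simp: b cl_unit_eq)
  qed
  then show ?thesis by (simp add: bvp_def cl_unit_eq)
qed

text \<open>The budget within radius \<open>\<delta>\<close>: data below \<open>\<delta> / 8\<close>
  contribute at most \<open>3 * \<delta> / 8\<close>, an acceleration up to
  \<open>\<delta> / 8\<close> at most \<open>4 * \<delta> / 8\<close>. The contraction constant is
  \<open>4 * (1 / 16)\<close>, and the bound on \<open>A\<close> returns accelerations to their
  ball.\<close>

lemma smooth_geodesic_problem:
  fixes A :: "'x::euclidean_space \<times> 'x \<Rightarrow> 'x"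
  assumes "open \<Omega>" "\<And>k. Ck_on k \<Omega> A" "0 < \<delta>" "cball (p, 0) \<delta> \<subseteq> \<Omega>"
    and "\<And>z v. z \<in> cball (p, 0) \<delta> \<Longrightarrow> norm (frechet_derivative A (at z) v) \<le> 1 / 16 * norm v"
    and "\<And>z. z \<in> cball (p, 0) \<delta> \<Longrightarrow> norm (A z) \<le> \<delta> / 16"
    and l: "bounded_linear \<theta>" "\<And>u. norm (\<theta> u) \<le> norm u"
  obtains u where "\<And>y. y \<in> ball p (\<delta>/8) \<times> ball 0 (\<delta>/8) \<Longrightarrow> norm (u y) \<le> \<delta> / 8"
    and "\<And>y t. y \<in> ball p (\<delta>/8) \<times> ball 0 (\<delta>/8) \<Longrightarrow> apply_bcontfun (state \<theta> y (u y)) t \<in> cball (p, 0) \<delta>"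
    and "\<And>y t. y \<in> ball p (\<delta>/8) \<times> ball 0 (\<delta>/8) \<Longrightarrow> apply_bcontfun (u y) t = A (apply_bcontfun (state \<theta> y (u y)) t)"
    and "\<And>y w. y \<in> ball p (\<delta>/8) \<times> ball 0 (\<delta>/8) \<Longrightarrow> norm w \<le> \<delta> / 8 \<Longrightarrow>
      (\<And>t. apply_bcontfun w t = A (apply_bcontfun (state \<theta> y w) t)) \<Longrightarrow> w = u y"
    and "\<And>k. Ck_on k (ball p (\<delta>/8) \<times> ball 0 (\<delta>/8)) u"
proof -
  let ?P = "ball p (\<delta>/8) \<times> ball (0::'x) (\<delta>/8)"
  have P: "open ?P" by (intro open_Times open_ball)
  have into: "apply_bcontfun (state \<theta> y 0 + state \<theta> 0 w) t \<in> cball (p, 0) \<delta>"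
    if "y \<in> ?P" "norm w \<le> \<delta> / 8" for y w t
  proof -
    have "norm (apply_bcontfun (state \<theta> y 0) t - (p, 0)) \<le> 3 * \<delta> / 8"
      using norm_state1_le[OF l(1), of y t p] that(1) by (cases y) (auto simp: dist_norm norm_minus_commute)
    moreover have "norm (apply_bcontfun (state \<theta> 0 w) t) \<le> 4 * \<delta> / 8"
      using norm_bounded[of "state \<theta> 0 w" t] norm_state2_le[OF l(2), of w] that(2) by linarith
    ultimately have "norm (apply_bcontfun (state \<theta> y 0) t - (p, 0) + apply_bcontfun (state \<theta> 0 w) t) \<le> \<delta>"
      using norm_triangle_ineq[of "apply_bcontfun (state \<theta> y 0) t - (p, 0)" "apply_bcontfun (state \<theta> 0 w) t"] assms(3)
      by linarith
    then show ?thesis by (simp add: dist_norm norm_minus_commute algebra_simps)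
  qed
  have ls: "Ck_on k ?P (\<lambda>y. state \<theta> y 0)" for k
    by (rule Ck_on_linear[OF P bounded_linear_state1[OF l(1)]])
  have kap: "norm (A z) \<le> \<delta> / 8" if "z \<in> cball (p, 0) \<delta>" for z
    using assms(6)[OF that] assms(3) by simp
  obtain u where u: "\<And>y. y \<in> ?P \<Longrightarrow> norm (u y) \<le> \<delta> / 8"
    "\<And>y t. y \<in> ?P \<Longrightarrow> apply_bcontfun (u y) t = A (apply_bcontfun (state \<theta> y 0 + state \<theta> 0 (u y)) t)"
    "\<And>y w. y \<in> ?P \<Longrightarrow> norm w \<le> \<delta> / 8 \<Longrightarrow> (\<And>t. apply_bcontfun w t = A (apply_bcontfun (state \<theta> y 0 + state \<theta> 0 w) t)) \<Longrightarrow> w = u y"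
    "\<And>k. Ck_on k ?P u"
    by (rule smooth_fixed_point[OF P assms(1) compact_cball convex_cball assms(4,2) ls bounded_linear_state2[OF l(1)]
          assms(5) norm_state2_le[OF l(2)] _ _ _ _ into kap]) (use assms(3) in auto)
  show ?thesis
  proof (rule that[of u])
    show "apply_bcontfun (state \<theta> y (u y)) t \<in> cball (p, 0) \<delta>" if "y \<in> ?P" for y t
      unfolding state_split[OF l(1), of y "u y"] by (rule into[OF that u(1)[OF that]])
    show "apply_bcontfun (u y) t = A (apply_bcontfun (state \<theta> y (u y)) t)" if "y \<in> ?P" for y t
      unfolding state_split[OF l(1), of y "u y"] by (rule u(2)[OF that])
    show "w = u y" if "y \<in> ?P" "norm w \<le> \<delta> / 8" "\<And>t. apply_bcontfun w t = A (apply_bcontfun (state \<theta> y w) t)" for y w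
      using u(3)[OF that(1,2)] that(3) state_split[OF l(1), of y w] by metis
  qed (use u in auto)
qed

subsection \<open>Elementary estimates along geodesics\<close>

text \<open>Starting at an instant of maximal speed \<open>m\<close>, the velocity changes by at
  most \<open>K m^2 s\<close> during a time \<open>s\<close>, so the curve moves by at least
  \<open>s m - K m^2 s^2\<close>, which cannot exceed \<open>D\<close>. The hypothesis
  \<open>4 K D < 1\<close> excludes the fast alternative.\<close>

lemma speed_bound:
  fixes c :: "real \<Rightarrow> 'x::real_normed_vector"
  assumes c: "\<And>t. t \<in> {0..1} \<Longrightarrow> (c has_vector_derivative c' t) (at t within {0..1})"
    and c': "\<And>t. t \<in> {0..1} \<Longrightarrow> (c' has_vector_derivative a t) (at t within {0..1})"
    and a: "\<And>t. t \<in> {0..1} \<Longrightarrow> norm (a t) \<le> K * (norm (c' t))\<^sup>2"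
    and D: "\<And>s t. s \<in> {0..1} \<Longrightarrow> t \<in> {0..1} \<Longrightarrow> norm (c s - c t) \<le> D"
    and "0 < K" "4 * K * D < 1" "t \<in> {0..1}"
  shows "norm (c' t) \<le> 4 * D"
proof -
  have "continuous_on {0..1} c'"
    unfolding continuous_on_eq_continuous_within using has_vector_derivative_continuous[OF c'] by blast
  then have "continuous_on {0..1} (\<lambda>t. norm (c' t))" by (intro continuous_intros)
  then obtain t0 where t0: "t0 \<in> {0..1}" "\<And>t. t \<in> {0..1} \<Longrightarrow> norm (c' t) \<le> norm (c' t0)"
    using continuous_attains_sup[of "{0..1::real}" "\<lambda>t. norm (c' t)"] by auto
  define m where "m = norm (c' t0)"
  have "m \<le> 4 * D"
  proof (cases "m = 0")
    case True then show ?thesis using D[OF t0(1) t0(1)] by simp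
  next
    case False
    then have "m > 0" by (simp add: m_def)
    \<comment> \<open>\<open>s m - K m^2 s^2\<close> is largest at \<open>s = 1 / (2 K m)\<close>;
      the cap 1/2 leaves room for the step on one side of \<open>t0\<close>. Without the cap,
      \<open>K s m = 1/2\<close> gives \<open>1/2 \<le> K D + 1/4\<close>, a contradiction; with it,
      \<open>K m < 1\<close> gives \<open>m / 2 \<le> D + m / 4\<close>.\<close>
    define s where "s = min (1/2) (1 / (2 * K * m))"
    have s: "0 < s" "s \<le> 1/2" using \<open>m > 0\<close> \<open>0 < K\<close> by (auto simp: s_def)
    define t1 where "t1 = (if t0 \<le> 1/2 then t0 + s else t0 - s)"
    have t1: "t1 \<in> {0..1}" "\<bar>t1 - t0\<bar> = s" using s t0(1) by (auto simp: t1_def)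
    have seg: "closed_segment t0 t1 \<subseteq> {0..1}"
      using t0(1) t1(1) by (meson closed_segment_subset convex_real_interval(5))
    have on: "onorm (\<lambda>h. h *\<^sub>R a t) \<le> K * m\<^sup>2" if "t \<in> {0..1}" for t
    proof (rule onorm_bound)
      have "norm (a t) \<le> K * m\<^sup>2"
        using a[OF that] t0(2)[OF that] \<open>0 < K\<close> by (smt (verit) m_def mult_left_mono norm_ge_zero power_mono)
      then show "norm (h *\<^sub>R a t) \<le> K * m\<^sup>2 * norm h" for h
        by (simp add: mult.commute mult_left_mono)
    qed (use \<open>0 < K\<close> in simp)
    have v: "norm (c' x - c' t0) \<le> K * m\<^sup>2 * s" if "x \<in> closed_segment t0 t1" for x
    proof -
      have "norm (c' x - c' t0) \<le> K * m\<^sup>2 * norm (x - t0)"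
        by (rule differentiable_bound[OF convex_real_interval(5)[of 0 1], of c' "\<lambda>t h. h *\<^sub>R a t"])
          (use c' on that seg t0 in \<open>auto simp: has_vector_derivative_def\<close>)
      also have "\<dots> \<le> K * m\<^sup>2 * s"
        using segment_bound(1)[OF that] t1(2) \<open>0 < K\<close> by (intro mult_left_mono) auto
      finally show ?thesis .
    qed
    have "norm (c t1 - c t0 - (t1 - t0) *\<^sub>R c' t0) \<le> norm (t1 - t0) * (K * m\<^sup>2 * s)"
    proof (rule vector_differentiable_bound_linearization[where S="closed_segment t0 t1"])
      show "(c has_vector_derivative c' x) (at x within closed_segment t0 t1)" if "x \<in> closed_segment t0 t1" for x
        using that seg by (intro has_vector_derivative_within_subset[OF c]) auto
    qed (use v in auto)
    moreover have "norm ((t1 - t0) *\<^sub>R c' t0) = s * m" using t1(2) by (simp add: m_def)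
    ultimately have main: "s * m \<le> D + s * (K * m\<^sup>2 * s)"
      using D[OF t1(1) t0(1)] t1(2) norm_triangle_sub[of "(t1 - t0) *\<^sub>R c' t0" "c t1 - c t0"]
      by (simp add: norm_minus_commute flip: m_def)
    show ?thesis
    proof (cases "K * m \<ge> 1")
      case True
      then have "1 / (2 * K * m) \<le> 1 / 2" by (simp add: field_simps)
      then have "s = 1 / (2 * K * m)" by (simp add: s_def)
      then have q: "K * (s * m) = 1 / 2" using \<open>m > 0\<close> \<open>0 < K\<close> by (simp add: field_simps)
      have "K * (s * m) \<le> K * D + (K * (s * m)) * (K * (s * m))"
        using mult_left_mono[OF main, of K] \<open>0 < K\<close> by (simp add: algebra_simps power2_eq_square)
      then show ?thesis using q \<open>4 * K * D < 1\<close> by simp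
    next
      case False
      then have "1 / 2 \<le> 1 / (2 * K * m)" using \<open>m > 0\<close> \<open>0 < K\<close> by (simp add: field_simps)
      then have s2: "s = 1 / 2" by (simp add: s_def)
      have "K * m\<^sup>2 \<le> m" using False \<open>m > 0\<close> by (simp add: power2_eq_square flip: mult.assoc)
      moreover have "m / 2 \<le> D + K * m\<^sup>2 / 4" using main unfolding s2 by simp
      ultimately show ?thesis by simp
    qed
  qed
  then show ?thesis using t0(2)[OF assms(7)] by (simp add: m_def)
qed

text \<open>The slope is monotone: if it is nonnegative at \<open>t\<close>, then \<open>h\<close>
  does not fall between \<open>t\<close> and 1; otherwise \<open>h\<close> does not rise between 0
  and \<open>t\<close>.\<close>

lemma second_derivative_nonneg_le_max:
  fixes h :: "real \<Rightarrow> real"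
  assumes h: "\<And>t. t \<in> {0..1} \<Longrightarrow> (h has_vector_derivative h' t) (at t within {0..1})"
    and h': "\<And>t. t \<in> {0..1} \<Longrightarrow> (h' has_vector_derivative h'' t) (at t within {0..1})"
    and nn: "\<And>t. t \<in> {0..1} \<Longrightarrow> h'' t \<ge> 0" and t: "t \<in> {0..1}"
  shows "h t \<le> max (h 0) (h 1)"
proof -
  have mvt: "\<exists>x\<in>{a..b}. f b - f a = (b - a) * f' x"
    if "\<And>t. t \<in> {0..1} \<Longrightarrow> (f has_vector_derivative f' t) (at t within {0..1})" "0 \<le> a" "a \<le> b" "b \<le> 1"
    for f f' :: "real \<Rightarrow> real" and a b
  proof -
    have "(f has_derivative (\<lambda>h. h * f' x)) (at x within {a..b})" if "a \<le> x" "x \<le> b" for x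
      using has_vector_derivative_within_subset[OF \<open>\<And>t. t \<in> {0..1} \<Longrightarrow> (f has_vector_derivative f' t) (at t within {0..1})\<close>[of x], of "{a..b}"]
        that \<open>0 \<le> a\<close> \<open>b \<le> 1\<close> by (simp add: has_vector_derivative_def)
    from mvt_very_simple[OF \<open>a \<le> b\<close> this] show ?thesis .
  qed
  have mono: "h' a \<le> h' b" if ab: "0 \<le> a" "a \<le> b" "b \<le> 1" for a b
  proof -
    obtain x where x: "x \<in> {a..b}" "h' b - h' a = (b - a) * h'' x" using mvt[of h' h'' a b] h' ab by blast
    then have "h'' x \<ge> 0" using that by (intro nn) auto
    then show ?thesis using x(2) ab mult_nonneg_nonneg[of "b - a" "h'' x"] by linarith
  qed
  show ?thesis
  proof (cases "h' t \<ge> 0")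
    case True
    obtain x where x: "x \<in> {t..1}" "h 1 - h t = (1 - t) * h' x" using mvt[of h h' t 1] h t by (meson atLeastAtMost_iff order_refl)
    then have "h' x \<ge> 0" using mono[of t x] True t by auto
    then show ?thesis using x(2) t mult_nonneg_nonneg[of "1 - t" "h' x"] by (smt (verit) atLeastAtMost_iff)
  next
    case False
    obtain x where x: "x \<in> {0..t}" "h t - h 0 = (t - 0) * h' x" using mvt[of h h' 0 t] h t by (meson atLeastAtMost_iff order_refl)
    then have "h' x \<le> 0" using mono[of x t] False t by auto
    then show ?thesis using x(2) t mult_nonneg_nonpos[of t "h' x"] by (smt (verit) atLeastAtMost_iff)
  qed
qed

text \<open>Half the second derivative of the squared distance to \<open>p\<close> is
  \<open>c' \<bullet> c' + (c - p) \<bullet> A (c, c')\<close>. The last term is at most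
  \<open>K * \<delta>\<close> times the squared speed and so cannot outweigh the first.\<close>

lemma geod_in_ball:
  fixes A :: "'x::real_inner \<times> 'x \<Rightarrow> 'x"
  assumes g: "geod_eq A {0..1} c c'"
    and A: "\<And>t. t \<in> {0..1} \<Longrightarrow> norm (A (c t, c' t)) \<le> K * (norm (c' t))\<^sup>2"
    and \<delta>: "\<And>t. t \<in> {0..1} \<Longrightarrow> norm (c t - p) \<le> \<delta>" and "0 \<le> K" "K * \<delta> \<le> 1"
    and "c 0 \<in> ball p r" "c 1 \<in> ball p r" "t \<in> {0..1}"
  shows "c t \<in> ball p r"
proof -
  define h where "h t = (c t - p) \<bullet> (c t - p)" for t
  define h' where "h' t = 2 * ((c t - p) \<bullet> c' t)" for t
  define h'' where "h'' t = 2 * (c' t \<bullet> c' t + (c t - p) \<bullet> A (c t, c' t))" for t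
  have gd: "((\<lambda>t. c t - p) has_vector_derivative c' t) (at t within {0..1})"
    "(c' has_vector_derivative A (c t, c' t)) (at t within {0..1})" if "t \<in> {0..1}" for t
    using g that by (auto simp: geod_eq_def intro!: derivative_eq_intros)
  have "h t \<le> max (h 0) (h 1)"
  proof (rule second_derivative_nonneg_le_max[of h h' h''])
    fix t :: real assume t: "t \<in> {0..1}"
    show "(h has_vector_derivative h' t) (at t within {0..1})"
      unfolding h_def h'_def
      using bounded_bilinear.has_vector_derivative[OF bounded_bilinear_inner gd(1)[OF t] gd(1)[OF t]]
      by (simp add: inner_commute)
    show "(h' has_vector_derivative h'' t) (at t within {0..1})"
      unfolding h'_def h''_def
      using bounded_linear.has_vector_derivative[OF bounded_linear_mult_right
          bounded_bilinear.has_vector_derivative[OF bounded_bilinear_inner gd(1)[OF t] gd(2)[OF t]], of 2]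
      by (simp add: add.commute)
    have "\<bar>(c t - p) \<bullet> A (c t, c' t)\<bar> \<le> norm (c t - p) * norm (A (c t, c' t))"
      by (rule Cauchy_Schwarz_ineq2)
    also have "\<dots> \<le> \<delta> * (K * (norm (c' t))\<^sup>2)"
      using A[OF t] \<delta>[OF t] order_trans[OF norm_ge_zero \<delta>[OF t]] by (intro mult_mono) auto
    also have "\<dots> \<le> (norm (c' t))\<^sup>2"
      using mult_right_mono[OF \<open>K * \<delta> \<le> 1\<close>, of "(norm (c' t))\<^sup>2"] by (simp add: algebra_simps)
    finally show "h'' t \<ge> 0" by (simp add: h''_def dot_square_norm)
  qed fact
  then have "(norm (c t - p))\<^sup>2 \<le> max ((norm (c 0 - p))\<^sup>2) ((norm (c 1 - p))\<^sup>2)"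
    by (simp add: h_def dot_square_norm)
  also have "\<dots> < r\<^sup>2"
    using assms(6,7) by (auto simp: dist_norm norm_minus_commute power_strict_mono)
  finally have "norm (c t - p) < r"
    using assms(6) by (metis ball_eq_empty empty_iff linorder_not_le norm_ge_zero not_le power_less_imp_less_base less_imp_le)
  then show ?thesis by (simp add: dist_norm norm_minus_commute)
qed

subsection \<open>Sprays\<close>

text \<open>Homogeneity is demanded for all real \<open>s\<close>, including 0 and negative values,
  so that reparametrisations may be constant or reverse the direction. Smoothness includes zero
  velocity, around which the local analysis takes place.\<close>

definition spray :: "'x::euclidean_space set \<Rightarrow> ('x \<times> 'x \<Rightarrow> 'x) \<Rightarrow> bool"
  where "spray \<Omega> A \<longleftrightarrow> open \<Omega> \<and> (\<forall>k. Ck_on k (\<Omega> \<times> UNIV) A) \<and>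
    (\<forall>x\<in>\<Omega>. \<forall>v s. A (x, s *\<^sub>R v) = s\<^sup>2 *\<^sub>R A (x, v))"

text \<open>Homogeneity extends a bound on the unit sphere to \<open>K\<close> times the squared
  speed. This forces the derivative of \<open>A\<close> at \<open>(p, 0)\<close> to vanish, and
  continuity of the partial derivatives keeps it small nearby.\<close>

lemma spray_estimates:
  fixes A :: "'x::euclidean_space \<times> 'x \<Rightarrow> 'x"
  assumes sp: "spray \<Omega> A" and p: "p \<in> \<Omega>"
  obtains K \<delta> where "0 < K" "0 < \<delta>" "K * \<delta> \<le> 1 / 16" "cball p \<delta> \<subseteq> \<Omega>"
    and "\<And>x v. x \<in> cball p \<delta> \<Longrightarrow> norm (A (x, v)) \<le> K * (norm v)\<^sup>2"
    and "\<And>z v. z \<in> cball (p, 0) \<delta> \<Longrightarrow> norm (frechet_derivative A (at z) v) \<le> 1 / 16 * norm v"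
proof -
  have \<Omega>: "open \<Omega>" "open (\<Omega> \<times> (UNIV :: 'x set))" and Ck: "\<And>k. Ck_on k (\<Omega> \<times> UNIV) A"
    and hom: "\<And>x v s. x \<in> \<Omega> \<Longrightarrow> A (x, s *\<^sub>R v) = s\<^sup>2 *\<^sub>R A (x, v)"
    using sp by (auto simp: spray_def intro: open_Times)
  obtain \<rho> where \<rho>: "\<rho> > 0" "cball p \<rho> \<subseteq> \<Omega>"
    using \<Omega>(1) p open_contains_cball by blast
  have "compact (A ` (cball p \<rho> \<times> sphere 0 1))"
    by (intro compact_continuous_image compact_Times compact_cball compact_sphere
        continuous_on_subset[OF Ck_on_continuous[OF \<Omega>(2) Ck]]) (use \<rho> in auto)
  then have "bounded (A ` (cball p \<rho> \<times> sphere 0 1))" by (rule compact_imp_bounded)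
  then obtain K0 where K0: "\<forall>y\<in>A ` (cball p \<rho> \<times> sphere 0 1). norm y \<le> K0"
    unfolding bounded_iff by blast
  define K where "K = max K0 1"
  have "K > 0" by (simp add: K_def)
  have K: "norm (A (x, v)) \<le> K * (norm v)\<^sup>2" if x: "x \<in> cball p \<rho>" for x v
  proof (cases "v = 0")
    case True
    have "x \<in> \<Omega>" using x \<rho> by blast
    from hom[OF this, of 0 0] show ?thesis using True by simp
  next
    case False
    have "(x, v /\<^sub>R norm v) \<in> cball p \<rho> \<times> sphere 0 1" using x False by simp
    then have "norm (A (x, v /\<^sub>R norm v)) \<le> K"
      using K0 unfolding K_def by (metis image_eqI max.coboundedI1)
    moreover have "A (x, norm v *\<^sub>R (v /\<^sub>R norm v)) = (norm v)\<^sup>2 *\<^sub>R A (x, v /\<^sub>R norm v)"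
      using x \<rho> by (intro hom) auto
    ultimately show ?thesis using False by (simp add: mult.commute mult_left_mono)
  qed
  have A0: "A (p, 0) = 0" using K[of p 0] \<rho> by simp
  have "(A has_derivative (\<lambda>h. 0)) (at (p, 0))"
    unfolding has_derivative_at_alt
  proof (intro conjI bounded_linear_zero allI impI)
    fix e :: real assume "e > 0"
    show "\<exists>d>0. \<forall>z. norm (z - (p, 0)) < d \<longrightarrow> norm (A z - A (p, 0) - 0) \<le> e * norm (z - (p, 0))"
    proof (intro exI[of _ "min \<rho> (e / K)"] conjI allI impI)
      fix z :: "'x \<times> 'x" assume z: "norm (z - (p, 0)) < min \<rho> (e / K)"
      obtain x v where xv: "z = (x, v)" by (cases z)
      have n: "norm (x - p) \<le> norm (z - (p, 0))" "norm v \<le> norm (z - (p, 0))"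
        using norm_fst_le[of "x - p" v] norm_snd_le[of v "x - p"] by (simp_all add: xv)
      have "norm (A z) \<le> K * (norm v)\<^sup>2"
        unfolding xv using n z by (intro K) (auto simp: dist_norm norm_minus_commute)
      also have "\<dots> = (K * norm v) * norm v" by (simp add: power2_eq_square)
      also have "\<dots> \<le> e * norm (z - (p, 0))"
      proof (rule mult_mono)
        have "norm v < e / K" using n z by linarith
        then show "K * norm v \<le> e" using \<open>K > 0\<close> by (simp add: field_simps)
      qed (use n \<open>e > 0\<close> in auto)
      finally show "norm (A z - A (p, 0) - 0) \<le> e * norm (z - (p, 0))" by (simp add: A0)
    qed (use \<rho> \<open>e > 0\<close> \<open>K > 0\<close> in auto)
  qed
  then have D0: "frechet_derivative A (at (p, 0)) = (\<lambda>h. 0)" by (metis frechet_derivative_at)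
  define e where "e = 1 / (16 * real DIM('x \<times> 'x))"
  have "e > 0" unfolding e_def using DIM_positive[where 'a="'x \<times> 'x"] by (intro divide_pos_pos mult_pos_pos) simp_all
  have "\<exists>d>0. \<forall>z. dist z (p, 0) < d \<longrightarrow> norm (frechet_derivative A (at z) b) \<le> e" for b
  proof -
    have "continuous_on (\<Omega> \<times> UNIV) (\<lambda>z. frechet_derivative A (at z) b)"
      using Ck[of "Suc 0"] unfolding Ck_on.simps by blast
    then have "isCont (\<lambda>z. frechet_derivative A (at z) b) (p, 0)"
      using continuous_on_eq_continuous_at[OF \<Omega>(2)] p by blast
    then show ?thesis
      using \<open>e > 0\<close> unfolding continuous_at_eps_delta dist_norm D0 by (metis diff_zero less_imp_le)
  qed
  then obtain d where d: "\<And>b. d b > 0" "\<And>b z. dist z (p, 0) < d b \<Longrightarrow> norm (frechet_derivative A (at z) b) \<le> e"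
    by metis
  define D where "D = Min (d ` (Basis :: ('x \<times> 'x) set))"
  have D: "D > 0" "\<And>i. i \<in> Basis \<Longrightarrow> D \<le> d i"
    unfolding D_def using d(1) by (auto simp: Min_gr_iff)
  \<comment> \<open>\<open>D / 2\<close> passes from the closed ball to the strict inequality of the
    continuity estimate; \<open>1 / (16 * K)\<close> makes \<open>K * \<delta>\<close> small, as
    convexity and the speed bound require.\<close>
  define \<delta> where "\<delta> = min \<rho> (min (D / 2) (1 / (16 * K)))"
  have "\<delta> > 0" using \<rho> D \<open>K > 0\<close> by (simp add: \<delta>_def)
  have "\<delta> \<le> 1 / (16 * K)" by (simp add: \<delta>_def)
  then have "K * \<delta> \<le> 1 / 16" using \<open>K > 0\<close> by (simp add: field_simps)
  moreover have sub: "cball p \<delta> \<subseteq> cball p \<rho>" by (auto simp: \<delta>_def)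
  moreover have "norm (frechet_derivative A (at z) v) \<le> 1 / 16 * norm v" if z: "z \<in> cball (p, 0) \<delta>" for z v
  proof -
    have "dist z (p, 0) < D" using z D by (auto simp: \<delta>_def dist_commute)
    have "dist (fst z) p \<le> dist z (p, 0)" using dist_fst_le[of z "(p, 0)"] by simp
    then have "fst z \<in> cball p \<delta>" using z by (simp add: dist_commute)
    then have "z \<in> \<Omega> \<times> UNIV" using sub \<rho> by (cases z) auto
    then have "linear (frechet_derivative A (at z))"
      using Ck_on_SucD[OF \<Omega>(2) Ck] has_derivative_linear by blast
    then have "frechet_derivative A (at z) v = (\<Sum>b\<in>Basis. (v \<bullet> b) *\<^sub>R frechet_derivative A (at z) b)"
      by (rule linear_euclidean_expand)
    also have "norm \<dots> \<le> (\<Sum>b\<in>(Basis :: ('x \<times> 'x) set). norm v * e)"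
    proof (rule sum_norm_le)
      fix b :: "'x \<times> 'x" assume b: "b \<in> Basis"
      have "norm (frechet_derivative A (at z) b) \<le> e"
        using d(2)[of z b] D(2)[OF b] \<open>dist z (p, 0) < D\<close> by linarith
      then show "norm ((v \<bullet> b) *\<^sub>R frechet_derivative A (at z) b) \<le> norm v * e"
        using Basis_le_norm[OF b, of v] by (simp add: mult_mono)
    qed
    also have "\<dots> = real DIM('x \<times> 'x) * e * norm v" by simp
    also have "\<dots> = 1 / 16 * norm v"
      unfolding e_def using DIM_positive[where 'a="'x \<times> 'x"] by (simp del: DIM_prod)
    finally show ?thesis .
  qed
  ultimately show ?thesis
    using that[of K \<delta>] \<open>K > 0\<close> \<open>\<delta> > 0\<close> \<rho> K by blast
qed

text \<open>The chain rule multiplies the acceleration by the square of \<open>\<beta>\<close>,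
  which homogeneity of degree 2 absorbs, also for zero or negative \<open>\<beta>\<close>.\<close>

lemma geod_eq_affine:
  assumes g: "geod_eq A S c c'" and hom: "\<And>t v s. t \<in> S \<Longrightarrow> A (c t, s *\<^sub>R v) = s\<^sup>2 *\<^sub>R A (c t, v)"
    and T: "\<And>t. t \<in> T \<Longrightarrow> \<alpha> + t * \<beta> \<in> S"
  shows "geod_eq A T (\<lambda>t. c (\<alpha> + t * \<beta>)) (\<lambda>t. \<beta> *\<^sub>R c' (\<alpha> + t * \<beta>))"
  unfolding geod_eq_def
proof (intro ballI conjI)
  fix t assume t: "t \<in> T"
  have a: "((\<lambda>t. \<alpha> + t * \<beta>) has_vector_derivative \<beta>) (at t within T)"
    by (auto intro!: derivative_eq_intros)
  have sub: "(\<lambda>t. \<alpha> + t * \<beta>) ` T \<subseteq> S" using T by auto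
  have "(c has_vector_derivative c' (\<alpha> + t * \<beta>)) (at (\<alpha> + t * \<beta>) within (\<lambda>t. \<alpha> + t * \<beta>) ` T)"
    and 2: "(c' has_vector_derivative A (c (\<alpha> + t * \<beta>), c' (\<alpha> + t * \<beta>))) (at (\<alpha> + t * \<beta>) within (\<lambda>t. \<alpha> + t * \<beta>) ` T)"
    using g T[OF t] sub by (auto simp: geod_eq_def intro: has_vector_derivative_within_subset)
  from vector_diff_chain_within[OF a this(1)]
  show "((\<lambda>t. c (\<alpha> + t * \<beta>)) has_vector_derivative \<beta> *\<^sub>R c' (\<alpha> + t * \<beta>)) (at t within T)"
    by (simp add: o_def)
  have "((\<lambda>t. c' (\<alpha> + t * \<beta>)) has_vector_derivative \<beta> *\<^sub>R A (c (\<alpha> + t * \<beta>), c' (\<alpha> + t * \<beta>))) (at t within T)"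
    using vector_diff_chain_within[OF a 2] by (simp add: o_def)
  from bounded_linear.has_vector_derivative[OF bounded_linear_scaleR_right this, of \<beta>]
  show "((\<lambda>t. \<beta> *\<^sub>R c' (\<alpha> + t * \<beta>)) has_vector_derivative A (c (\<alpha> + t * \<beta>), \<beta> *\<^sub>R c' (\<alpha> + t * \<beta>))) (at t within T)"
    using hom[OF T[OF t]] by (simp add: power2_eq_square)
qed

lemma geod_eq_cong:
  assumes "geod_eq A S c c'" "\<And>t. t \<in> S \<Longrightarrow> d t = c t"
  shows "geod_eq A S d c'"
  using assms unfolding geod_eq_def by (metis has_vector_derivative_transform)

lemma geod_eq_subset: "geod_eq A S c c' \<Longrightarrow> T \<subseteq> S \<Longrightarrow> geod_eq A T c c'"
  unfolding geod_eq_def by (meson has_vector_derivative_within_subset subsetD)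

section \<open>Local existence, uniqueness and convexity of geodesic segments\<close>

text \<open>Three scales are nested: initial value problems at \<open>\<delta>\<close>, boundary
  value problems at \<open>\<eta>\<close>, end points within \<open>r0\<close>. The gaps allow a
  solution of the second problem, run at speed \<open>t\<close>, to be recognised as a solution of
  the first, and any geodesic confined to the \<open>r0\<close>-ball as a solution of the second.
  The last clause covers every \<open>r \<le> r0\<close> because radii are shrunk again
  later.\<close>

theorem local_geodesics:
  fixes A :: "'x::euclidean_space \<times> 'x \<Rightarrow> 'x"
  assumes sp: "spray \<Omega> A" and p: "p \<in> \<Omega>"
  obtains r0 F where "0 < r0" "ball p r0 \<subseteq> \<Omega>"
    and "\<And>k. Ck_on k ((ball p r0 \<times> ball p r0) \<times> {-1<..<2::real}) F"
    and "\<And>c c' d d' t. geod_eq A {0..1} c c' \<Longrightarrow> geod_eq A {0..1} d d' \<Longrightarrow>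
      c ` {0..1} \<subseteq> ball p r0 \<Longrightarrow> d ` {0..1} \<subseteq> ball p r0 \<Longrightarrow> c 0 = d 0 \<Longrightarrow> c 1 = d 1 \<Longrightarrow> t \<in> {0..1} \<Longrightarrow> c t = d t"
    and "\<And>r a b. r \<le> r0 \<Longrightarrow> a \<in> ball p r \<Longrightarrow> b \<in> ball p r \<Longrightarrow>
      F ((a, b), 0) = a \<and> F ((a, b), 1) = b \<and> (\<forall>t\<in>{0..1}. F ((a, b), t) \<in> ball p r) \<and>
      (\<exists>c'. geod_eq A {0..1} (\<lambda>t. F ((a, b), t)) c')"
proof -
  obtain K \<delta> where K: "0 < K" "0 < \<delta>" "K * \<delta> \<le> 1 / 16" "cball p \<delta> \<subseteq> \<Omega>"
    and quad: "\<And>x v. x \<in> cball p \<delta> \<Longrightarrow> norm (A (x, v)) \<le> K * (norm v)\<^sup>2"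
    and der: "\<And>z v. z \<in> cball (p, 0) \<delta> \<Longrightarrow> norm (frechet_derivative A (at z) v) \<le> 1 / 16 * norm v"
    by (rule spray_estimates[OF sp p]) (use that in blast)
  have \<Omega>: "open \<Omega>" "open (\<Omega> \<times> (UNIV :: 'x set))" and Ck: "\<And>k. Ck_on k (\<Omega> \<times> UNIV) A"
    and hom: "\<And>x v s. x \<in> \<Omega> \<Longrightarrow> A (x, s *\<^sub>R v) = s\<^sup>2 *\<^sub>R A (x, v)"
    using sp by (auto simp: spray_def intro: open_Times)
  have cbD: "x \<in> cball p e" "norm v \<le> e" if "(x, v) \<in> cball (p, 0) e" for x v :: 'x and e
  proof -
    have "dist (p, 0) (x, v) \<le> e" using that by simp
    then show "x \<in> cball p e" "norm v \<le> e"
      using dist_fst_le[of "(p, 0)" "(x, v)"] dist_snd_le[of "(p, 0)" "(x, v)"] by auto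
  qed
  have cbI: "(x, v) \<in> cball (p, 0) e" if "norm (x - p) + norm v \<le> e" for x v :: 'x and e
  proof -
    have "dist (x, v) (p, 0) \<le> e"
      using norm_Pair_le[of "x - p" v] that by (simp add: dist_norm)
    then show ?thesis by (simp add: dist_commute)
  qed
  have sub: "cball (p, 0 :: 'x) e \<subseteq> \<Omega> \<times> UNIV" if "e \<le> \<delta>" for e
  proof
    fix z :: "'x \<times> 'x" assume "z \<in> cball (p, 0) e"
    then have "fst z \<in> cball p e" using cbD(1)[of "fst z" "snd z"] by simp
    then have "fst z \<in> \<Omega>" using K(4) that by auto
    then show "z \<in> \<Omega> \<times> UNIV" by (simp add: mem_Times_iff)
  qed
  have small: "norm (A z) \<le> e / 16" if z: "z \<in> cball (p, 0) e" "0 < e" "e \<le> \<delta>" for z e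
  proof -
    obtain x v where xv: "z = (x, v)" by (cases z)
    have x: "x \<in> cball p \<delta>" and v: "norm v \<le> e" using cbD[of x v e] z xv by auto
    have "norm (A z) \<le> K * (norm v)\<^sup>2" unfolding xv by (rule quad[OF x])
    also have "\<dots> \<le> K * (e * e)"
      using v K(1) z(2) mult_mono[OF v v] by (intro mult_left_mono) (simp_all add: power2_eq_square)
    also have "\<dots> \<le> (K * \<delta>) * e" using K(1) z by simp
    also have "\<dots> \<le> 1 / 16 * e" using K(3) z by (intro mult_right_mono) auto
    finally show ?thesis by simp
  qed
  have contA: "continuous_on (cball (p, 0) \<delta>) A"
    by (rule continuous_on_subset[OF Ck_on_continuous[OF \<Omega>(2) Ck[of 0]] sub]) simp
  \<comment> \<open>Initial velocities of segments are at most \<open>\<eta> / 4\<close>; multiplied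
    by a time of modulus below 2 they stay within \<open>\<delta> / 32\<close>, inside the domain
    \<open>\<delta> / 8\<close> of the initial value problem.\<close>
  define \<eta> where "\<eta> = \<delta> / 16"
  have \<eta>: "0 < \<eta>" "\<eta> \<le> \<delta>" using K(2) by (auto simp: \<eta>_def)
  define P1 where "P1 = ball p (\<delta>/8) \<times> ball (0::'x) (\<delta>/8)"
  define P2 where "P2 = ball p (\<eta>/8) \<times> ball (0::'x) (\<eta>/8)"
  define iv :: "(real \<Rightarrow>\<^sub>C 'x) \<Rightarrow> 'x" where "iv = (\<lambda>u. 0)"
  have iv: "bounded_linear iv" by (simp add: iv_def bounded_linear_zero)
  obtain u1 where u1:
    "\<And>y w. y \<in> P1 \<Longrightarrow> norm w \<le> \<delta> / 8 \<Longrightarrow> (\<And>t. apply_bcontfun w t = A (apply_bcontfun (state iv y w) t)) \<Longrightarrow> w = u1 y"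
    "\<And>k. Ck_on k P1 u1"
    unfolding P1_def
    by (rule smooth_geodesic_problem[OF \<Omega>(2) Ck K(2) sub[OF order_refl] der small[OF _ K(2) order_refl] iv])
      (auto simp: iv_def)
  obtain u2 where u2: "\<And>y. y \<in> P2 \<Longrightarrow> norm (u2 y) \<le> \<eta> / 8"
    "\<And>y t. y \<in> P2 \<Longrightarrow> apply_bcontfun (state bvp y (u2 y)) t \<in> cball (p, 0) \<eta>"
    "\<And>y t. y \<in> P2 \<Longrightarrow> apply_bcontfun (u2 y) t = A (apply_bcontfun (state bvp y (u2 y)) t)"
    "\<And>y w. y \<in> P2 \<Longrightarrow> norm w \<le> \<eta> / 8 \<Longrightarrow> (\<And>t. apply_bcontfun w t = A (apply_bcontfun (state bvp y w) t)) \<Longrightarrow> w = u2 y"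
    "\<And>k. Ck_on k P2 u2"
    unfolding P2_def
    by (rule smooth_geodesic_problem[OF \<Omega>(2) Ck \<eta>(1) sub[OF \<eta>(2)] der small[OF _ \<eta>] bounded_linear_bvp norm_bvp_le])
      (use \<eta> in auto)
  \<comment> \<open>\<open>ex\<close> is the exponential map. \<open>vl\<close> reads the initial
    velocity off the boundary value solution, as \<open>\<xi> + bvp u\<close> with
    \<open>\<xi> = b - a\<close>.\<close>
  define ex where "ex y = fst (apply_bcontfun (state iv y (u1 y)) 1)" for y
  define vl where "vl = (\<lambda>(a, b). (b - a) + bvp (u2 (a, b - a)))"
  define F where "F = (\<lambda>(y, t). ex (fst y, t *\<^sub>R vl y))"
  \<comment> \<open>Two points of the \<open>r0\<close>-ball differ by less than
    \<open>2 * r0 = \<eta> / 8\<close>, the bound on boundary data. A geodesic in that ball has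
    speed at most \<open>8 * r0\<close>, so position and velocity together stay within
    \<open>9 * r0 < \<eta>\<close>.\<close>
  define r0 where "r0 = \<eta> / 16"
  have r0: "0 < r0" "r0 \<le> \<delta>" "16 * r0 = \<eta>" "256 * r0 = \<delta>" using K(2) by (auto simp: r0_def \<eta>_def)
  have P2I: "(a, b - a) \<in> P2" if "a \<in> ball p r0" "b \<in> ball p r0" for a b
  proof -
    have "norm (b - a) < 2 * r0"
      using that norm_triangle_ineq[of "b - p" "p - a"] by (simp add: dist_norm norm_minus_commute)
    then show ?thesis using that r0 by (auto simp: P2_def dist_norm norm_minus_commute)
  qed
  have vl_le: "norm (vl (a, b)) \<le> \<eta> / 4" if "a \<in> ball p r0" "b \<in> ball p r0" for a b
  proof -
    have "norm (vl (a, b)) \<le> norm (b - a) + norm (u2 (a, b - a))"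
      unfolding vl_def using norm_triangle_ineq norm_bvp_le by (force intro: order_trans add_left_mono)
    moreover have "norm (b - a) \<le> \<eta> / 8" using P2I[OF that] by (simp add: P2_def less_imp_le)
    ultimately show ?thesis using u2(1)[OF P2I[OF that]] by simp
  qed
  have P1I: "(a, t *\<^sub>R vl (a, b)) \<in> P1" if "a \<in> ball p r0" "b \<in> ball p r0" "t \<in> {-1<..<2}" for a b t
  proof -
    have "\<bar>t\<bar> * norm (vl (a, b)) \<le> 2 * (\<eta> / 4)"
      using vl_le[OF that(1,2)] that(3) by (intro mult_mono) auto
    then show ?thesis using that(1) r0 by (auto simp: P1_def)
  qed
  have openP: "open P1" "open P2" by (auto simp: P1_def P2_def intro: open_Times)
  have exC: "Ck_on k P1 ex" for k
  proof -
    have "Ck_on k P1 (\<lambda>y. state iv y 0 + state iv 0 (u1 y))"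
      by (intro Ck_on_add openP Ck_on_linear[OF openP(1) bounded_linear_state1[OF iv]]
          Ck_on_compose_linear[OF openP(1) bounded_linear_state2[OF iv]] u1(2))
    then have "Ck_on k P1 (\<lambda>y. state iv y (u1 y))" by (simp flip: state_split[OF iv])
    then show ?thesis
      unfolding ex_def
      by (intro Ck_on_compose_linear[OF openP(1) bounded_linear_compose[OF bounded_linear_fst bounded_linear_apply_bcontfun]])
  qed
  define B2 where "B2 = ball p r0 \<times> ball p r0"
  have "open B2" by (simp add: B2_def open_Times)
  have vlC: "Ck_on k B2 vl" for k
  proof -
    have l: "bounded_linear (\<lambda>y::'x \<times> 'x. (fst y, snd y - fst y))"
      by (intro bounded_linear_Pair bounded_linear_sub bounded_linear_fst bounded_linear_snd)
    have "Ck_on k B2 (\<lambda>y. u2 (fst y, snd y - fst y))"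
      by (rule Ck_on_compose[OF \<open>open B2\<close> openP(2) _ Ck_on_linear[OF \<open>open B2\<close> l] u2(5)])
        (use P2I in \<open>auto simp: B2_def\<close>)
    then have "Ck_on k B2 (\<lambda>y. (snd y - fst y) + bvp (u2 (fst y, snd y - fst y)))"
      by (rule Ck_on_add[OF \<open>open B2\<close> Ck_on_linear[OF \<open>open B2\<close> bounded_linear_sub[OF bounded_linear_snd bounded_linear_fst]]
            Ck_on_compose_linear[OF \<open>open B2\<close> bounded_linear_bvp]])
    then show ?thesis by (simp add: vl_def case_prod_unfold)
  qed
  have FC: "Ck_on k (B2 \<times> {-1<..<2}) F" for k
  proof -
    have o: "open (B2 \<times> {-1<..<2::real})" using \<open>open B2\<close> by (simp add: open_Times)
    have "Ck_on k (B2 \<times> {-1<..<2::real}) (\<lambda>z. vl (fst z))"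
      by (rule Ck_on_compose[OF o \<open>open B2\<close> _ Ck_on_linear[OF o bounded_linear_fst] vlC]) auto
    then have q: "Ck_on k (B2 \<times> {-1<..<2::real}) (\<lambda>z. (fst (fst z), snd z *\<^sub>R vl (fst z)))"
      by (rule Ck_on_Pair[OF o Ck_on_linear[OF o bounded_linear_compose[OF bounded_linear_fst bounded_linear_fst]]
            Ck_on_scaleR[OF o Ck_on_linear[OF o bounded_linear_snd]]])
    have "Ck_on k (B2 \<times> {-1<..<2::real}) (\<lambda>z. ex (fst (fst z), snd z *\<^sub>R vl (fst z)))"
      by (rule Ck_on_compose[OF o openP(1) _ q exC]) (use P1I in \<open>auto simp: B2_def\<close>)
    then show ?thesis by (simp add: F_def case_prod_unfold)
  qed
  \<comment> \<open>Contractivity gives uniqueness only among solutions of small acceleration. The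
    speed bound shows that every geodesic confined to the small ball is of this kind.\<close>
  have uniq: "c t = fst (apply_bcontfun (state bvp (c 0, c 1 - c 0) (u2 (c 0, c 1 - c 0))) t)"
    if g: "geod_eq A {0..1} c c'" and cb: "c ` {0..1} \<subseteq> ball p r0" and t: "t \<in> {0..1}" for c c' t
  proof -
    have cp: "norm (c s - p) < r0" if "s \<in> {0..1}" for s
      using cb that by (auto simp: dist_norm norm_minus_commute image_subset_iff)
    have "norm (c' s) \<le> 4 * (2 * r0)" if s: "s \<in> {0..1}" for s
    proof (rule speed_bound[OF _ _ _ _ K(1) _ s])
      show "norm (A (c s, c' s)) \<le> K * (norm (c' s))\<^sup>2" if "s \<in> {0..1}" for s
        using cp[OF that] r0 by (intro quad) (auto simp: dist_norm norm_minus_commute)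
      show "norm (c s - c t) \<le> 2 * r0" if "s \<in> {0..1}" "t \<in> {0..1}" for s t
        using norm_triangle_ineq[of "c s - p" "p - c t"] cp[OF that(1)] cp[OF that(2)] by (simp add: norm_minus_commute)
      have "K * \<delta> = 256 * (K * r0)" by (simp flip: r0(4))
      then show "4 * K * (2 * r0) < 1" using K(3) by linarith
    qed (use g in \<open>auto simp: geod_eq_def\<close>)
    then have cc: "(c s, c' s) \<in> cball (p, 0) \<eta>" if "s \<in> {0..1}" for s
      using cp[OF that] that r0 by (intro cbI) (smt (verit))
    then obtain u where u: "\<And>s. apply_bcontfun u s = A (c (cl s), c' (cl s))"
      using geod_acceleration[OF g continuous_on_subset[OF contA]] \<eta>(2) by (metis subset_cball)
    have "norm u \<le> \<eta> / 16" by (rule norm_bound) (use small[OF cc[OF cl_unit] \<eta>] in \<open>simp add: u\<close>)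
    then have un: "norm u \<le> \<eta> / 8" using \<eta> by simp
    have v: "c' 0 = snd (c 0, c 1 - c 0) + bvp u"
      using geod_bvp_initial_velocity[of A c c' u, OF g u] by simp
    have st: "apply_bcontfun (state bvp (c 0, c 1 - c 0) u) s = (c (cl s), c' (cl s))" for s
      by (rule state_of_geod[of A c c' u, OF g u]) (use v in simp_all)
    have "c 0 \<in> ball p r0" "c 1 \<in> ball p r0"
      using cp[of 0] cp[of 1] by (simp_all add: dist_norm norm_minus_commute)
    then have "u = u2 (c 0, c 1 - c 0)" by (intro u2(4) P2I un) (simp_all add: u st)
    then show ?thesis using st[of t] t by (simp add: cl_unit_eq)
  qed
  have main: "\<exists>c'. F ((a, b), 0) = a \<and> F ((a, b), 1) = b \<and> geod_eq A {0..1} (\<lambda>t. F ((a, b), t)) c' \<and>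
      (\<forall>t\<in>{0..1}. (F ((a, b), t), c' t) \<in> cball (p, 0) \<eta>)"
    if a: "a \<in> ball p r0" and b: "b \<in> ball p r0" for a b
  proof -
    define y where "y = (a, b - a)"
    have y: "y \<in> P2" unfolding y_def by (rule P2I[OF a b])
    define c where "c = apply_bcontfun (pos bvp y (u2 y))"
    define c' where "c' = apply_bcontfun (vel bvp y (u2 y))"
    have g: "geod_eq A {0..1} c c'" unfolding c_def c'_def by (rule geod_eq_state[OF u2(3)[OF y]])
    have cc: "(c t, c' t) \<in> cball (p, 0) \<eta>" for t
      using u2(2)[OF y, of t] by (simp add: state_def bpair_apply c_def c'_def)
    have c0: "c 0 = a" by (simp add: c_def pos_def bint_0 y_def)
    have c'0: "c' 0 = vl (a, b)" by (simp add: c'_def vel_def bint_0 y_def vl_def)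
    have "apply_bcontfun (bint (const_bcontfun w)) 1 = (\<lambda>t. t *\<^sub>R w) (cl 1) - (\<lambda>t. t *\<^sub>R w) 0" for w :: 'x
      by (rule bint_eq_diff) (auto intro!: derivative_eq_intros)
    then have bc: "apply_bcontfun (bint (const_bcontfun w)) 1 = w" for w :: 'x by (simp add: cl_unit_eq)
    \<comment> \<open>At time 1 the double integral of the acceleration cancels against
      \<open>bvp\<close>, which was chosen for this.\<close>
    have c1: "c 1 = b"
      by (simp add: c_def pos_def vel_def bounded_linear.linear[OF bounded_linear_bint] linear_add bc bvp_def y_def)
    have Fc: "F ((a, b), t) = c t" if t: "t \<in> {0..1}" for t
    proof -
      \<comment> \<open>Run at speed \<open>t\<close>, the curve starts at \<open>a\<close> with
        velocity \<open>t *\<^sub>R vl (a, b)\<close> and reaches \<open>c t\<close> at time 1.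
        Uniqueness for the initial value problem identifies that point with the value of
        \<open>F\<close>.\<close>
      let ?c = "\<lambda>s. c (0 + s * t)" and ?c' = "\<lambda>s. t *\<^sub>R c' (0 + s * t)"
      have inO: "c s \<in> \<Omega>" for s using cbD(1)[OF cc, of s] K(4) \<eta>(2) subset_cball[OF \<eta>(2)] by blast
      have gt: "geod_eq A {0..1} ?c ?c'"
        by (rule geod_eq_affine[OF g]) (use t hom inO in \<open>auto simp: mult_le_one\<close>)
      have cct: "(?c s, ?c' s) \<in> cball (p, 0) \<delta>" for s
      proof (rule cbI)
        have "norm (?c s - p) \<le> \<eta>" using cbD(1)[OF cc] by (simp add: dist_norm norm_minus_commute)
        moreover have "norm (?c' s) \<le> 1 * \<eta>"
          using cbD(2)[OF cc[of "0 + s * t"]] t unfolding norm_scaleR by (intro mult_mono) auto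
        ultimately show "norm (?c s - p) + norm (?c' s) \<le> \<delta>" using \<eta>_def K(2) by simp
      qed
      then obtain u where u: "\<And>s. apply_bcontfun u s = A (?c (cl s), ?c' (cl s))"
        using geod_acceleration[OF gt contA] by metis
      have "norm u \<le> \<delta> / 16" by (rule norm_bound) (use small[OF cct K(2) order_refl] in \<open>simp add: u\<close>)
      then have un: "norm u \<le> \<delta> / 8" using K(2) by simp
      have st: "apply_bcontfun (state iv (a, t *\<^sub>R vl (a, b)) u) s = (?c (cl s), ?c' (cl s))" for s
        by (rule state_of_geod[of A ?c ?c' u, OF gt u]) (simp_all add: c0 c'0 iv_def)
      have "u = u1 (a, t *\<^sub>R vl (a, b))"
        using t by (intro u1(1) P1I a b un) (simp_all add: u st)
      then show ?thesis using st[of 1] by (simp add: F_def ex_def cl_unit_eq)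
    qed
    have "geod_eq A {0..1} (\<lambda>t. F ((a, b), t)) c'" by (rule geod_eq_cong[OF g Fc])
    then show ?thesis using Fc c0 c1 cc by (intro exI[of _ c']) auto
  qed
  show ?thesis
  proof (rule that[of r0 F])
    show "ball p r0 \<subseteq> \<Omega>" using r0(2) K(4) by (meson ball_subset_cball order_trans subset_cball)
    show "Ck_on k ((ball p r0 \<times> ball p r0) \<times> {-1<..<2}) F" for k using FC by (simp add: B2_def)
    show "c t = d t" if "geod_eq A {0..1} c c'" "geod_eq A {0..1} d d'" "c ` {0..1} \<subseteq> ball p r0" "d ` {0..1} \<subseteq> ball p r0"
      "c 0 = d 0" "c 1 = d 1" "t \<in> {0..1}" for c c' d d' t
      using uniq[OF that(1,3,7)] uniq[OF that(2,4,7)] that(5,6) by simp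
    show "F ((a, b), 0) = a \<and> F ((a, b), 1) = b \<and> (\<forall>t\<in>{0..1}. F ((a, b), t) \<in> ball p r) \<and>
      (\<exists>c'. geod_eq A {0..1} (\<lambda>t. F ((a, b), t)) c')" if r: "r \<le> r0" and ab: "a \<in> ball p r" "b \<in> ball p r" for r a b
    proof -
      have "a \<in> ball p r0" "b \<in> ball p r0" using r ab by auto
      from main[OF this] obtain c' where c': "F ((a, b), 0) = a" "F ((a, b), 1) = b"
        "geod_eq A {0..1} (\<lambda>t. F ((a, b), t)) c'" "\<And>t. t \<in> {0..1} \<Longrightarrow> (F ((a, b), t), c' t) \<in> cball (p, 0) \<eta>"
        by blast
      \<comment> \<open>The convexity argument works for each \<open>r\<close>, because the bounds
        on position and acceleration hold in the larger ball already.\<close>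
      have "F ((a, b), t) \<in> ball p r" if t: "t \<in> {0..1}" for t
      proof (rule geod_in_ball[OF c'(3) _ _ _ _ _ _ t])
        show "norm (A (F ((a, b), t), c' t)) \<le> K * (norm (c' t))\<^sup>2" if "t \<in> {0..1}" for t
          using cbD(1)[OF c'(4)[OF that]] \<eta>(2) by (intro quad) auto
        show "norm (F ((a, b), t) - p) \<le> \<delta>" if "t \<in> {0..1}" for t
          using cbD(1)[OF c'(4)[OF that]] \<eta>(2) by (simp add: dist_norm norm_minus_commute)
      qed (use K c' ab in auto)
      then show ?thesis using c' by blast
    qed
  qed (use r0 in auto)
qed

subsection \<open>Charts\<close>

lemma is_chartD:
  assumes "is_chart c"
  shows "open (fst c)" "open (snd c ` fst c)" "inj_on (snd c) (fst c)" "continuous_on (fst c) (snd c)"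
    "continuous_on (snd c ` fst c) (inv_into (fst c) (snd c))"
proof -
  obtain U \<phi> where c: "c = (U, \<phi>)" by (cases c)
  obtain \<psi> where o: "open U" "open (\<phi> ` U)" and h: "homeomorphism U (\<phi> ` U) \<phi> \<psi>"
    using assms by (auto simp: is_chart_def c)
  show i: "inj_on (snd c) (fst c)"
    using h by (auto simp: c homeomorphism_def intro: inj_on_inverseI[of _ \<psi>])
  have "inv_into U \<phi> y = \<psi> y" if "y \<in> \<phi> ` U" for y
    using that h i by (auto simp: c homeomorphism_def)
  then have "continuous_on (\<phi> ` U) (inv_into U \<phi>)"
    using h continuous_on_cong[of "\<phi> ` U" "\<phi> ` U" "inv_into U \<phi>" \<psi>] by (auto simp: homeomorphism_def)
  then show "open (fst c)" "open (snd c ` fst c)" "continuous_on (fst c) (snd c)"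
    "continuous_on (snd c ` fst c) (inv_into (fst c) (snd c))"
    using o h by (auto simp: c homeomorphism_def)
qed

lemma inv_chart: "is_chart c \<Longrightarrow> q \<in> fst c \<Longrightarrow> inv_into (fst c) (snd c) (snd c q) = q"
  using is_chartD(3) by (rule inv_into_f_f)

lemma open_chart_image:
  assumes "is_chart c" "open V" shows "open (snd c ` (V \<inter> fst c))"
proof -
  have "snd c ` (V \<inter> fst c) = (snd c ` fst c) \<inter> inv_into (fst c) (snd c) -` V"
    using inv_chart[OF assms(1)] by (auto simp: image_iff)
  then show ?thesis
    using continuous_on_open_vimage[OF is_chartD(2)[OF assms(1)]] is_chartD(5)[OF assms(1)] assms(2)
    by (metis Int_commute)
qed

lemma open_chart_vimage:
  assumes "is_chart c" "open W" shows "open {q \<in> fst c. snd c q \<in> W}"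
proof -
  have "{q \<in> fst c. snd c q \<in> W} = snd c -` W \<inter> fst c" by auto
  then show ?thesis
    using continuous_on_open_vimage[OF is_chartD(1)[OF assms(1)]] is_chartD(4)[OF assms(1)] assms(2) by metis
qed

lemma transition_eq: "is_chart c \<Longrightarrow> q \<in> fst c \<Longrightarrow> transition c d (snd c q) = snd d q"
  by (simp add: transition_def inv_chart)

definition coord_ball :: "('a, 'n::finite) chart \<Rightarrow> real^'n \<Rightarrow> real \<Rightarrow> 'a set"
  where "coord_ball c z r = {q \<in> fst c. snd c q \<in> ball z r}"

lemma open_coord_ball: "is_chart c \<Longrightarrow> open (coord_ball c z r)"
  unfolding coord_ball_def by (intro open_chart_vimage open_ball)

lemma mchart_atlas: "smooth_atlas A \<Longrightarrow> c \<in> A \<Longrightarrow> mchart A c"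
  by (auto simp: smooth_atlas_def mchart_def)

lemma mchart_is_chart: "mchart A c \<Longrightarrow> is_chart c"
  by (simp add: mchart_def)

text \<open>Compatibility is given directly only against charts of \<open>A\<close>. Chart changes
  between arbitrary charts of the maximal atlas are therefore routed through a chart of
  \<open>A\<close>.\<close>

lemma mchart_compatible: "mchart A c \<Longrightarrow> d \<in> A \<Longrightarrow> smoothly_compatible c d \<and> smoothly_compatible d c"
  by (auto simp: mchart_def smoothly_compatible_def Int_commute)

subsection \<open>The spray of a connection\<close>

text \<open>The geodesic equation solved for the second derivative and read in coordinates; hence
  the minus sign and the inverse chart.\<close>

definition chart_spray :: "('a, 'n::finite) connection \<Rightarrow> ('a, 'n) chart \<Rightarrow> (real^'n) \<times> (real^'n) \<Rightarrow> real^'n"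
  where "chart_spray \<Gamma> c = (\<lambda>(x, v). \<chi> i. - (\<Sum>j\<in>UNIV. \<Sum>k\<in>UNIV. \<Gamma> c i j k (inv_into (fst c) (snd c) x) * v $ j * v $ k))"

lemma vec_axis_expand: "(\<Sum>k\<in>UNIV. v $ k *\<^sub>R axis k 1) = (v :: real^'n::finite)"
  by (simp add: vec_eq_iff axis_def if_distrib[of "\<lambda>x. _ * x"] cong: if_cong)

lemma Ck_on_vec:
  fixes f :: "'n::finite \<Rightarrow> 'a::real_normed_vector \<Rightarrow> real"
  assumes "open U" "\<And>i. Ck_on k U (f i)"
  shows "Ck_on k U (\<lambda>z. \<chi> i. f i z)"
proof -
  have "Ck_on k U (\<lambda>z. \<Sum>i\<in>UNIV. f i z *\<^sub>R (axis i 1 :: real^'n))"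
    by (intro Ck_on_sum Ck_on_scaleR assms Ck_on_const)
  then show ?thesis using vec_axis_expand[of "\<chi> i. f i _"] by simp
qed

lemma spray_chart_spray:
  assumes "smooth_connection A \<Gamma>" "mchart A c"
  shows "spray (snd c ` fst c) (chart_spray \<Gamma> c)"
  unfolding spray_def
proof (intro conjI allI ballI)
  let ?\<Omega> = "snd c ` fst c"
  show "open ?\<Omega>" using assms(2) by (auto simp: mchart_def intro: is_chartD(2))
  then have o: "open (?\<Omega> \<times> (UNIV :: (real^'b) set))" by (simp add: open_Times)
  show "Ck_on k (?\<Omega> \<times> UNIV) (chart_spray \<Gamma> c)" for k
  proof -
    have G: "Ck_on k (?\<Omega> \<times> (UNIV :: (real^'b) set)) (\<lambda>z. \<Gamma> c i j m (inv_into (fst c) (snd c) (fst z)))" for i j m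
    proof (rule Ck_on_compose[OF o \<open>open ?\<Omega>\<close> _ Ck_on_linear[OF o bounded_linear_fst]])
      show "Ck_on k ?\<Omega> (\<lambda>y. \<Gamma> c i j m (inv_into (fst c) (snd c) y))"
        using assms unfolding smooth_connection_def smooth_on_def by blast
    qed auto
    have "Ck_on k (?\<Omega> \<times> UNIV) (\<lambda>z. (snd z :: real^'b) $ j)" for j
      by (rule Ck_on_linear[OF o bounded_linear_compose[OF bounded_linear_vec_nth bounded_linear_snd]])
    then have "Ck_on k (?\<Omega> \<times> UNIV) (\<lambda>z. \<chi> i. - (\<Sum>j\<in>UNIV. \<Sum>m\<in>UNIV. \<Gamma> c i j m (inv_into (fst c) (snd c) (fst z)) * snd z $ j * snd z $ m))"
      by (intro Ck_on_vec Ck_on_uminus Ck_on_sum Ck_on_mult o G)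
    then show ?thesis by (simp add: chart_spray_def case_prod_unfold)
  qed
  show "chart_spray \<Gamma> c (x, s *\<^sub>R v) = s\<^sup>2 *\<^sub>R chart_spray \<Gamma> c (x, v)" for x v s
    by (simp add: chart_spray_def vec_eq_iff sum_distrib_left power2_eq_square algebra_simps)
qed

text \<open>A notion between the two kinds of geodesics: one fixed chart, but any parameter set, so
  that open intervals and \<open>{0..1}\<close> are treated alike.\<close>

definition geodesic_on :: "('a, 'n::finite) connection \<Rightarrow> ('a, 'n) chart \<Rightarrow> real set \<Rightarrow> (real \<Rightarrow> 'a) \<Rightarrow> bool"
  where "geodesic_on \<Gamma> c S g \<longleftrightarrow> g ` S \<subseteq> fst c \<and> (\<exists>v. geod_eq (chart_spray \<Gamma> c) S (\<lambda>t. snd c (g t)) v)"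

lemma geodesic_on_affine:
  assumes "smooth_connection A \<Gamma>" "mchart A c" "geodesic_on \<Gamma> c S g" "\<And>t. t \<in> T \<Longrightarrow> \<alpha> + t * \<beta> \<in> S"
  shows "geodesic_on \<Gamma> c T (\<lambda>t. g (\<alpha> + t * \<beta>))"
proof -
  obtain v where v: "g ` S \<subseteq> fst c" "geod_eq (chart_spray \<Gamma> c) S (\<lambda>t. snd c (g t)) v"
    using assms(3) by (auto simp: geodesic_on_def)
  have "geod_eq (chart_spray \<Gamma> c) T (\<lambda>t. snd c (g (\<alpha> + t * \<beta>))) (\<lambda>t. \<beta> *\<^sub>R v (\<alpha> + t * \<beta>))"
    by (rule geod_eq_affine[OF v(2) _ assms(4)])
      (use v(1) spray_chart_spray[OF assms(1,2)] in \<open>auto simp: spray_def image_subset_iff\<close>)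
  then show ?thesis using v(1) assms(4) unfolding geodesic_on_def by blast
qed

lemma geodesic_on_cong:
  assumes "geodesic_on \<Gamma> c S g" "\<And>t. t \<in> S \<Longrightarrow> h t = g t"
  shows "geodesic_on \<Gamma> c S h"
proof -
  obtain v where v: "g ` S \<subseteq> fst c" "geod_eq (chart_spray \<Gamma> c) S (\<lambda>t. snd c (g t)) v"
    using assms(1) by (auto simp: geodesic_on_def)
  have "geod_eq (chart_spray \<Gamma> c) S (\<lambda>t. snd c (h t)) v"
    by (rule geod_eq_cong[OF v(2)]) (simp add: assms(2))
  then show ?thesis using v(1) assms(2) unfolding geodesic_on_def by auto
qed

lemma geodesic_on_subset: "geodesic_on \<Gamma> c S g \<Longrightarrow> T \<subseteq> S \<Longrightarrow> geodesic_on \<Gamma> c T g"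
  unfolding geodesic_on_def using geod_eq_subset by blast

lemma continuous_on_geodesic:
  assumes "is_chart c" "geodesic_on \<Gamma> c S g"
  shows "continuous_on S g"
proof -
  obtain v where v: "g ` S \<subseteq> fst c" "geod_eq (chart_spray \<Gamma> c) S (\<lambda>t. snd c (g t)) v"
    using assms(2) by (auto simp: geodesic_on_def)
  have "continuous_on S (\<lambda>t. snd c (g t))"
    unfolding continuous_on_eq_continuous_within
    using v(2) by (auto simp: geod_eq_def intro: has_vector_derivative_continuous)
  then have "continuous_on S (\<lambda>t. inv_into (fst c) (snd c) (snd c (g t)))"
    by (rule continuous_on_compose2[OF is_chartD(5)[OF assms(1)]]) (use v(1) in auto)
  moreover have "inv_into (fst c) (snd c) (snd c (g t)) = g t" if "t \<in> S" for t
    using inv_chart[OF assms(1)] v(1) that by auto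
  ultimately show ?thesis by (simp cong: continuous_on_cong)
qed

text \<open>For the second formula the velocity is expanded along the coordinate axes first, since
  only derivatives in fixed directions are known to be differentiable. The resulting sum is the
  second derivative of \<open>\<tau>\<close> in the directions \<open>v, v\<close>.\<close>

lemma second_derivative_compose:
  fixes \<tau> :: "real^'n::finite \<Rightarrow> 'b::real_normed_vector"
  assumes "open W" "\<And>k. Ck_on k W \<tau>" "x ` S \<subseteq> W"
    and x: "\<And>t. t \<in> S \<Longrightarrow> (x has_vector_derivative v t) (at t within S)"
    and v: "\<And>t. t \<in> S \<Longrightarrow> (v has_vector_derivative w t) (at t within S)" and t: "t \<in> S"
  shows "((\<lambda>t. \<tau> (x t)) has_vector_derivative frechet_derivative \<tau> (at (x t)) (v t)) (at t within S)"
    and "((\<lambda>t. frechet_derivative \<tau> (at (x t)) (v t)) has_vector_derivative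
      (\<Sum>k\<in>UNIV. v t $ k *\<^sub>R frechet_derivative (\<lambda>y. frechet_derivative \<tau> (at y) (axis k 1)) (at (x t)) (v t))
      + frechet_derivative \<tau> (at (x t)) (w t)) (at t within S)"
proof -
  have D: "(\<tau> has_derivative frechet_derivative \<tau> (at y)) (at y)" if "y \<in> W" for y
    using Ck_on_SucD[OF assms(1,2) that] .
  have D2: "((\<lambda>y. frechet_derivative \<tau> (at y) (axis k 1)) has_derivative
      frechet_derivative (\<lambda>y. frechet_derivative \<tau> (at y) (axis k 1)) (at y)) (at y)" if "y \<in> W" for y k
  proof -
    have "Ck_on (Suc 0) W (\<lambda>y. frechet_derivative \<tau> (at y) (axis k 1))"
      using assms(2)[of "Suc (Suc 0)"] by simp
    from Ck_on_SucD[OF assms(1) this that] show ?thesis .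
  qed
  have chain: "((\<lambda>t. h (x t)) has_vector_derivative h' (v t)) (at t within S)" if "(h has_derivative h') (at (x t))"
    for h :: "real^'n \<Rightarrow> 'b" and h'
    using vector_derivative_diff_chain_within[OF x[OF t] has_derivative_at_withinI[OF that]] by (simp add: o_def)
  have xW: "x t \<in> W" if "t \<in> S" for t using assms(3) that by auto
  show "((\<lambda>t. \<tau> (x t)) has_vector_derivative frechet_derivative \<tau> (at (x t)) (v t)) (at t within S)"
    by (rule chain[OF D[OF xW[OF t]]])
  have expand: "frechet_derivative \<tau> (at (x t)) u = (\<Sum>k\<in>UNIV. u $ k *\<^sub>R frechet_derivative \<tau> (at (x t)) (axis k 1))"
    if "t \<in> S" for t u
  proof -
    have l: "linear (frechet_derivative \<tau> (at (x t)))" using D[OF xW[OF that]] has_derivative_linear by blast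
    have "frechet_derivative \<tau> (at (x t)) u = frechet_derivative \<tau> (at (x t)) (\<Sum>k\<in>UNIV. u $ k *\<^sub>R axis k 1)"
      by (simp only: vec_axis_expand)
    also have "\<dots> = (\<Sum>k\<in>UNIV. u $ k *\<^sub>R frechet_derivative \<tau> (at (x t)) (axis k 1))"
      by (simp add: linear_sum[OF l] linear_scale[OF l])
    finally show ?thesis .
  qed
  have "((\<lambda>t. \<Sum>k\<in>UNIV. v t $ k *\<^sub>R frechet_derivative \<tau> (at (x t)) (axis k 1)) has_vector_derivative
      (\<Sum>k\<in>UNIV. v t $ k *\<^sub>R frechet_derivative (\<lambda>y. frechet_derivative \<tau> (at y) (axis k 1)) (at (x t)) (v t)
        + w t $ k *\<^sub>R frechet_derivative \<tau> (at (x t)) (axis k 1))) (at t within S)"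
    by (intro has_vector_derivative_sum bounded_bilinear.has_vector_derivative[OF bounded_bilinear_scaleR]
        chain[OF D2[OF xW[OF t]]] bounded_linear.has_vector_derivative[OF bounded_linear_vec_nth v[OF t]])
  then show "((\<lambda>t. frechet_derivative \<tau> (at (x t)) (v t)) has_vector_derivative
      (\<Sum>k\<in>UNIV. v t $ k *\<^sub>R frechet_derivative (\<lambda>y. frechet_derivative \<tau> (at y) (axis k 1)) (at (x t)) (v t))
      + frechet_derivative \<tau> (at (x t)) (w t)) (at t within S)"
    unfolding sum.distrib expand[OF t, of "w t", symmetric]
    by (rule has_vector_derivative_transform[OF t, rotated]) (rule expand)
qed

lemma chart_change_second_derivative:
  assumes "is_chart c" "smoothly_compatible c d" "g ` S \<subseteq> fst c \<inter> fst d"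
    and "\<And>t. t \<in> S \<Longrightarrow> ((\<lambda>t. snd c (g t)) has_vector_derivative v t) (at t within S)"
    and "\<And>t. t \<in> S \<Longrightarrow> (v has_vector_derivative w t) (at t within S)" and t: "t \<in> S"
  shows "((\<lambda>t. snd d (g t)) has_vector_derivative frechet_derivative (transition c d) (at (snd c (g t))) (v t)) (at t within S)"
    and "((\<lambda>t. frechet_derivative (transition c d) (at (snd c (g t))) (v t)) has_vector_derivative
      (\<Sum>k\<in>UNIV. v t $ k *\<^sub>R frechet_derivative (\<lambda>y. frechet_derivative (transition c d) (at y) (axis k 1)) (at (snd c (g t))) (v t))
      + frechet_derivative (transition c d) (at (snd c (g t))) (w t)) (at t within S)"
proof -
  have W: "open (snd c ` (fst c \<inter> fst d))" "\<And>k. Ck_on k (snd c ` (fst c \<inter> fst d)) (transition c d)"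
    using assms(2) by (auto simp: smoothly_compatible_def smooth_on_def)
  have sub: "(\<lambda>t. snd c (g t)) ` S \<subseteq> snd c ` (fst c \<inter> fst d)" using assms(3) by auto
  note * = second_derivative_compose[OF W sub assms(4,5) t]
  show "((\<lambda>t. snd d (g t)) has_vector_derivative frechet_derivative (transition c d) (at (snd c (g t))) (v t)) (at t within S)"
    by (rule has_vector_derivative_transform[OF t _ *(1)]) (use assms(3) transition_eq[OF assms(1), where d=d] in auto)
  show "((\<lambda>t. frechet_derivative (transition c d) (at (snd c (g t))) (v t)) has_vector_derivative
      (\<Sum>k\<in>UNIV. v t $ k *\<^sub>R frechet_derivative (\<lambda>y. frechet_derivative (transition c d) (at y) (axis k 1)) (at (snd c (g t))) (v t))
      + frechet_derivative (transition c d) (at (snd c (g t))) (w t)) (at t within S)"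
    by (rule *(2))
qed

lemma sum_swap4:
  "(\<Sum>j\<in>J. \<Sum>k\<in>K. \<Sum>l\<in>L. \<Sum>m\<in>M. f j k l m) = (\<Sum>l\<in>L. \<Sum>m\<in>M. \<Sum>j\<in>J. \<Sum>k\<in>K. f j k l m)"
proof -
  have "(\<Sum>j\<in>J. \<Sum>k\<in>K. \<Sum>l\<in>L. \<Sum>m\<in>M. f j k l m) = (\<Sum>j\<in>J. \<Sum>l\<in>L. \<Sum>m\<in>M. \<Sum>k\<in>K. f j k l m)"
    by (rule sum.cong[OF refl], subst sum.swap, rule sum.cong[OF refl], rule sum.swap)
  also have "\<dots> = (\<Sum>l\<in>L. \<Sum>m\<in>M. \<Sum>j\<in>J. \<Sum>k\<in>K. f j k l m)"
    by (subst sum.swap, rule sum.cong[OF refl], rule sum.swap)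
  finally show ?thesis .
qed

text \<open>The transformation law of the connection, contracted twice with \<open>v\<close>. The
  first sum is the second derivative of the coordinate change, the term that the chain rule adds to
  the acceleration.\<close>

lemma spray_transformation:
  assumes lin: "linear_connection A \<Gamma>" and c: "mchart A c" and d: "mchart A d" and comp: "smoothly_compatible c d"
    and q: "q \<in> fst c" "q \<in> fst d"
  defines "T \<equiv> frechet_derivative (transition c d) (at (snd c q))"
  shows "(\<Sum>k\<in>UNIV. v $ k *\<^sub>R frechet_derivative (\<lambda>y. frechet_derivative (transition c d) (at y) (axis k 1)) (at (snd c q)) v)
      + T (chart_spray \<Gamma> c (snd c q, v)) = chart_spray \<Gamma> d (snd d q, T v)"
proof -
  have W: "open (snd c ` (fst c \<inter> fst d))" "\<And>k. Ck_on k (snd c ` (fst c \<inter> fst d)) (transition c d)"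
    using comp by (auto simp: smoothly_compatible_def smooth_on_def)
  have qW: "snd c q \<in> snd c ` (fst c \<inter> fst d)" using q by auto
  have ex: "h u $ i = (\<Sum>j\<in>UNIV. u $ j * h (axis j 1) $ i)" if "linear h" for h :: "real^'b \<Rightarrow> real^'b" and u i
  proof -
    have "h u = h (\<Sum>j\<in>UNIV. u $ j *\<^sub>R axis j 1)" by (simp only: vec_axis_expand)
    also have "\<dots> = (\<Sum>j\<in>UNIV. u $ j *\<^sub>R h (axis j 1))" by (simp add: linear_sum[OF that] linear_scale[OF that])
    finally show ?thesis by (simp add: sum_component)
  qed
  have T: "T u $ i = (\<Sum>j\<in>UNIV. dbar c d i j q * u $ j)" for u i
    unfolding dbar_def T_def
    by (subst ex) (use has_derivative_linear[OF Ck_on_SucD[OF W qW]] in \<open>auto simp: mult.commute\<close>)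
  have H: "frechet_derivative (\<lambda>y. frechet_derivative (transition c d) (at y) (axis k 1)) (at (snd c q)) u $ i
      = (\<Sum>j\<in>UNIV. ddbar c d i j k q * u $ j)" for u i k
  proof -
    have "Ck_on (Suc 0) (snd c ` (fst c \<inter> fst d)) (\<lambda>y. frechet_derivative (transition c d) (at y) (axis k 1))"
      using W(2)[of "Suc (Suc 0)"] by simp
    from has_derivative_linear[OF Ck_on_SucD[OF W(1) this qW]] show ?thesis
      unfolding ddbar_def by (subst ex) (auto simp: mult.commute)
  qed
  have inv: "inv_into (fst c) (snd c) (snd c q) = q" "inv_into (fst d) (snd d) (snd d q) = q"
    using inv_chart mchart_is_chart c d q by blast+
  show ?thesis
  proof (rule vec_eq_iff[THEN iffD2], rule allI)
    fix i :: 'b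
    let ?D = "\<lambda>j k. ddbar c d i j k q" and ?B = "\<lambda>i j. dbar c d i j q"
      and ?G = "\<lambda>i j k. \<Gamma> d i j k q" and ?H = "\<lambda>i j k. \<Gamma> c i j k q"
    have law: "?D j k = (\<Sum>l\<in>UNIV. ?B i l * ?H l j k) - (\<Sum>l\<in>UNIV. \<Sum>m\<in>UNIV. ?G i l m * ?B l j * ?B m k)" for j k
    proof -
      have "?D j k + (\<Sum>l\<in>UNIV. \<Sum>m\<in>UNIV. ?G i l m * ?B l j * ?B m k) = (\<Sum>l\<in>UNIV. ?B i l * ?H l j k)"
        using lin c d q unfolding linear_connection_def by blast
      then show ?thesis by simp
    qed
    have 1: "(\<Sum>k\<in>UNIV. v $ k * (\<Sum>j\<in>UNIV. ?D j k * v $ j)) = (\<Sum>j\<in>UNIV. \<Sum>k\<in>UNIV. v $ j * v $ k * ?D j k)"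
      by (subst sum.swap) (simp add: sum_distrib_left mult_ac)
    have 2: "(\<Sum>j\<in>UNIV. \<Sum>k\<in>UNIV. v $ j * v $ k * (\<Sum>l\<in>UNIV. ?B i l * ?H l j k))
      = (\<Sum>l\<in>UNIV. ?B i l * (\<Sum>j\<in>UNIV. \<Sum>k\<in>UNIV. ?H l j k * v $ j * v $ k))" (is "?lhs = _")
    proof -
      \<comment> \<open>The one-element index set \<open>{()}\<close> pads the triple sum so that
        \<open>sum_swap4\<close> applies.\<close>
      have "?lhs = (\<Sum>j\<in>UNIV. \<Sum>k\<in>UNIV. \<Sum>l\<in>UNIV. \<Sum>m\<in>{()}. ?B i l * (?H l j k * v $ j * v $ k))"
        by (simp add: sum_distrib_left mult_ac)
      also have "\<dots> = (\<Sum>l\<in>UNIV. \<Sum>m\<in>{()}. \<Sum>j\<in>UNIV. \<Sum>k\<in>UNIV. ?B i l * (?H l j k * v $ j * v $ k))"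
        by (rule sum_swap4)
      finally show ?thesis by (simp add: sum_distrib_left)
    qed
    have 3: "(\<Sum>j\<in>UNIV. \<Sum>k\<in>UNIV. v $ j * v $ k * (\<Sum>l\<in>UNIV. \<Sum>m\<in>UNIV. ?G i l m * ?B l j * ?B m k))
      = (\<Sum>l\<in>UNIV. \<Sum>m\<in>UNIV. ?G i l m * T v $ l * T v $ m)" (is "?lhs = _")
    proof -
      have "?lhs = (\<Sum>j\<in>UNIV. \<Sum>k\<in>UNIV. \<Sum>l\<in>UNIV. \<Sum>m\<in>UNIV. ?G i l m * ((?B l j * v $ j) * (?B m k * v $ k)))"
        by (simp add: sum_distrib_left mult_ac)
      also have "\<dots> = (\<Sum>l\<in>UNIV. \<Sum>m\<in>UNIV. \<Sum>j\<in>UNIV. \<Sum>k\<in>UNIV. ?G i l m * ((?B l j * v $ j) * (?B m k * v $ k)))"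
        by (rule sum_swap4)
      also have "\<dots> = (\<Sum>l\<in>UNIV. \<Sum>m\<in>UNIV. ?G i l m * (T v $ l * T v $ m))"
        unfolding T sum_product by (simp only: sum_distrib_left)
      finally show ?thesis by (simp add: mult.assoc)
    qed
    have "(\<Sum>j\<in>UNIV. \<Sum>k\<in>UNIV. v $ j * v $ k * ?D j k)
      = (\<Sum>l\<in>UNIV. ?B i l * (\<Sum>j\<in>UNIV. \<Sum>k\<in>UNIV. ?H l j k * v $ j * v $ k)) - (\<Sum>l\<in>UNIV. \<Sum>m\<in>UNIV. ?G i l m * T v $ l * T v $ m)"
      unfolding law right_diff_distrib sum_subtractf 2 3 ..
    moreover have "T (chart_spray \<Gamma> c (snd c q, v)) $ i = - (\<Sum>l\<in>UNIV. ?B i l * (\<Sum>j\<in>UNIV. \<Sum>k\<in>UNIV. ?H l j k * v $ j * v $ k))"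
      unfolding T by (simp add: chart_spray_def inv sum_negf)
    ultimately show "((\<Sum>k\<in>UNIV. v $ k *\<^sub>R frechet_derivative (\<lambda>y. frechet_derivative (transition c d) (at y) (axis k 1)) (at (snd c q)) v)
      + T (chart_spray \<Gamma> c (snd c q, v))) $ i = chart_spray \<Gamma> d (snd d q, T v) $ i"
      using 1 by (simp add: sum_component H chart_spray_def inv)
  qed
qed

lemma geodesic_on_chart_change:
  assumes "linear_connection A \<Gamma>" "mchart A c" "mchart A d" "smoothly_compatible c d"
    and "geodesic_on \<Gamma> c S g" "g ` S \<subseteq> fst d"
  shows "geodesic_on \<Gamma> d S g"
proof -
  obtain v where v: "g ` S \<subseteq> fst c" "geod_eq (chart_spray \<Gamma> c) S (\<lambda>t. snd c (g t)) v"
    using assms(5) by (auto simp: geodesic_on_def)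
  let ?v = "\<lambda>t. frechet_derivative (transition c d) (at (snd c (g t))) (v t)"
  have "geod_eq (chart_spray \<Gamma> d) S (\<lambda>t. snd d (g t)) ?v"
    unfolding geod_eq_def
  proof (intro ballI conjI)
    fix t assume t: "t \<in> S"
    have sub: "g ` S \<subseteq> fst c \<inter> fst d" using v(1) assms(6) by auto
    have x: "\<And>t. t \<in> S \<Longrightarrow> ((\<lambda>t. snd c (g t)) has_vector_derivative v t) (at t within S)"
      "\<And>t. t \<in> S \<Longrightarrow> (v has_vector_derivative chart_spray \<Gamma> c (snd c (g t), v t)) (at t within S)"
      using v(2) by (auto simp: geod_eq_def)
    note * = chart_change_second_derivative[OF mchart_is_chart[OF assms(2)] assms(4) sub x t]
    show "((\<lambda>t. snd d (g t)) has_vector_derivative ?v t) (at t within S)" by (rule *(1))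
    have "g t \<in> fst c" "g t \<in> fst d" using sub t by auto
    from *(2)[unfolded spray_transformation[OF assms(1-4) this]]
    show "(?v has_vector_derivative chart_spray \<Gamma> d (snd d (g t), ?v t)) (at t within S)" .
  qed
  then show ?thesis using assms(6) unfolding geodesic_on_def by blast
qed

subsection \<open>Geodesics of a connection\<close>

lemma has_derivative_imp_has_vector_derivative_1:
  assumes "(f has_derivative f') F" shows "(f has_vector_derivative f' 1) F"
proof -
  have "f' = (\<lambda>h. h *\<^sub>R f' 1)"
  proof
    show "f' h = h *\<^sub>R f' 1" for h
      using linear_scale[OF has_derivative_linear[OF assms], of h 1] by simp
  qed
  with assms show ?thesis unfolding has_vector_derivative_def by metis
qed

lemma open_interval_around:
  assumes "open S" "(\<tau>::real) \<in> S"
  obtains \<epsilon> where "0 < \<epsilon>" "{\<tau>-\<epsilon><..<\<tau>+\<epsilon>} \<subseteq> S"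
proof -
  obtain e where "e > 0" "ball \<tau> e \<subseteq> S" using assms open_contains_ball by blast
  moreover have "{\<tau>-e<..<\<tau>+e} = ball \<tau> e" by (auto simp: dist_real_def)
  ultimately show ?thesis using that by metis
qed

lemma open_interval_greaterThanLessThan: "open_interval {a<..<b}"
  by (simp add: open_interval_def is_interval_oo)

text \<open>Near \<open>\<tau>\<close> the definition supplies two charts: \<open>x1\<close>, in
  which the curve is C^2, and \<open>x2\<close>, in which the equation holds. The equation uses
  \<open>vector_derivative\<close>, which is informative only where derivatives exist, so
  differentiability is carried from \<open>x1\<close> through \<open>c\<close> to \<open>x2\<close>,
  and the equation is then carried back from \<open>x2\<close> to \<open>c\<close>.\<close>

lemma Geo_conn_imp_geodesic_on:
  assumes at: "smooth_atlas A" and lin: "linear_connection A \<Gamma>" and G: "Geo_conn A \<Gamma> I g"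
    and \<tau>: "\<tau> \<in> I" and c: "c \<in> A" "g \<tau> \<in> fst c"
  obtains \<epsilon> where "0 < \<epsilon>" "{\<tau>-\<epsilon><..<\<tau>+\<epsilon>} \<subseteq> I" "geodesic_on \<Gamma> c {\<tau>-\<epsilon><..<\<tau>+\<epsilon>} g"
proof -
  have I: "open I" "continuous_on I g"
    using G by (auto simp: Geo_conn_def open_interval_def Ck_curve_def)
  obtain J1 x1 where J1: "open_interval J1" "\<tau> \<in> J1" "J1 \<subseteq> I" "mchart A x1" "g ` J1 \<subseteq> fst x1" "Ck_on 2 J1 (snd x1 \<circ> g)"
    using G \<tau> unfolding Geo_conn_def Ck_curve_def by blast
  obtain J2 x2 where J2': "open_interval J2 \<and> \<tau> \<in> J2 \<and> J2 \<subseteq> I \<and> mchart A x2 \<and> g ` J2 \<subseteq> fst x2 \<and>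
        (\<forall>t\<in>J2. \<forall>i. vector_derivative (\<lambda>s. vector_derivative (snd x2 \<circ> g) (at s)) (at t) $ i
           + (\<Sum>j\<in>UNIV. \<Sum>k\<in>UNIV. \<Gamma> x2 i j k (g t) * vector_derivative (snd x2 \<circ> g) (at t) $ j
                * vector_derivative (snd x2 \<circ> g) (at t) $ k) = 0)"
    using bspec[OF conjunct2[OF conjunct2[OF G[unfolded Geo_conn_def]]] \<tau>] by (elim exE) (rule that)
  have J2: "open_interval J2" "\<tau> \<in> J2" "J2 \<subseteq> I" "mchart A x2" "g ` J2 \<subseteq> fst x2"
    using J2' by simp_all
  note eq = J2'[THEN conjunct2, THEN conjunct2, THEN conjunct2, THEN conjunct2, THEN conjunct2, rule_format]
  have mc: "mchart A c" by (rule mchart_atlas[OF at c(1)])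
  have "open (g -` fst c \<inter> I)"
    using continuous_on_open_vimage[OF I(1)] I(2) is_chartD(1)[OF mchart_is_chart[OF mc]] by blast
  then have "open (J1 \<inter> J2 \<inter> (g -` fst c \<inter> I))" using J1(1) J2(1) by (auto simp: open_interval_def)
  then obtain \<epsilon> where \<epsilon>: "0 < \<epsilon>" "{\<tau>-\<epsilon><..<\<tau>+\<epsilon>} \<subseteq> J1 \<inter> J2 \<inter> (g -` fst c \<inter> I)"
    by (rule open_interval_around) (use J1 J2 \<tau> c in auto)
  define J where "J = {\<tau>-\<epsilon><..<\<tau>+\<epsilon>}"
  have J: "open J" "J \<subseteq> J1" "J \<subseteq> J2" "J \<subseteq> I" "g ` J \<subseteq> fst c"
    using \<epsilon> by (auto simp: J_def)
  have Jx: "g ` J \<subseteq> fst x1" "g ` J \<subseteq> fst x2"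
    using J1(5) J2(5) J(2,3) by blast+
  have J_at: "at t within J = at t" if "t \<in> J" for t
    using J(1) that by (rule at_within_open[rotated])
  have C2: "Ck_on (Suc (Suc 0)) J (\<lambda>t. snd x1 (g t))"
    using Ck_on_subset[OF _ J(1,2) J1(6)] J1(1) by (simp add: open_interval_def o_def numeral_2_eq_2)
  define v where "v t = frechet_derivative (\<lambda>t. snd x1 (g t)) (at t) 1" for t
  define w where "w t = frechet_derivative v (at t) 1" for t
  have v: "((\<lambda>t. snd x1 (g t)) has_vector_derivative v t) (at t within J)" if t: "t \<in> J" for t
    unfolding J_at[OF t] v_def by (rule has_derivative_imp_has_vector_derivative_1[OF Ck_on_SucD[OF J(1) C2 t]])
  have w: "(v has_vector_derivative w t) (at t within J)" if t: "t \<in> J" for t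
  proof -
    have "Ck_on (Suc 0) J v" unfolding v_def using C2 by simp
    then show ?thesis
      unfolding J_at[OF t] w_def by (rule has_derivative_imp_has_vector_derivative_1[OF Ck_on_SucD[OF J(1) _ t]])
  qed
  have s1: "g ` J \<subseteq> fst x1 \<inter> fst c" and s2: "g ` J \<subseteq> fst c \<inter> fst x2" using J Jx by auto
  have comp: "smoothly_compatible x1 c" "smoothly_compatible c x2" "smoothly_compatible x2 c"
    using mchart_compatible J1(4) J2(4) c(1) by blast+
  note cc = chart_change_second_derivative[OF mchart_is_chart[OF J1(4)] comp(1) s1 v w]
  note cx = chart_change_second_derivative[OF mchart_is_chart[OF mc] comp(2) s2 cc]
  define V where "V = (\<lambda>t. frechet_derivative (transition c x2) (at (snd c (g t)))
    (frechet_derivative (transition x1 c) (at (snd x1 (g t))) (v t)))"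
  have V: "((\<lambda>t. snd x2 (g t)) has_vector_derivative V t) (at t within J)" if "t \<in> J" for t
    unfolding V_def by (rule cx(1)) (assumption | rule that)+
  have "\<exists>W. (V has_vector_derivative W) (at t within J)" if "t \<in> J" for t
    unfolding V_def by (rule exI, rule cx(2)) (assumption | rule that)+
  then obtain W where W: "\<And>t. t \<in> J \<Longrightarrow> (V has_vector_derivative W t) (at t within J)"
    by metis
  have "geod_eq (chart_spray \<Gamma> x2) J (\<lambda>t. snd x2 (g t)) V"
    unfolding geod_eq_def
  proof (intro ballI conjI V)
    fix t assume t: "t \<in> J"
    have vd: "vector_derivative (snd x2 \<circ> g) (at s) = V s" if "s \<in> J" for s
      using V[OF that] unfolding J_at[OF that] by (auto simp: o_def intro: vector_derivative_at)
    have "((\<lambda>s. vector_derivative (snd x2 \<circ> g) (at s)) has_vector_derivative W t) (at t)"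
      by (rule has_vector_derivative_transform_within_open[OF W[OF t, unfolded J_at[OF t]] J(1) t]) (simp add: vd)
    then have Wt: "vector_derivative (\<lambda>s. vector_derivative (snd x2 \<circ> g) (at s)) (at t) = W t"
      by (rule vector_derivative_at)
    have "g t \<in> fst x2" using Jx t by auto
    then have "inv_into (fst x2) (snd x2) (snd x2 (g t)) = g t"
      by (rule inv_chart[OF mchart_is_chart[OF J2(4)]])
    moreover have "t \<in> J2" using J t by auto
    ultimately have "W t = chart_spray \<Gamma> x2 (snd x2 (g t), V t)"
      using eq[of t] by (simp add: chart_spray_def vec_eq_iff vd[OF t] Wt add_eq_0_iff2)
    then show "(V has_vector_derivative chart_spray \<Gamma> x2 (snd x2 (g t), V t)) (at t within J)"
      using W[OF t] by simp
  qed
  then have "geodesic_on \<Gamma> x2 J g" using Jx unfolding geodesic_on_def by blast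
  then have "geodesic_on \<Gamma> c J g"
    by (rule geodesic_on_chart_change[OF lin J2(4) mc comp(3) _ J(5)])
  then show ?thesis using that[of \<epsilon>] \<epsilon>(1) J(4) by (simp add: J_def)
qed

text \<open>The C^2 property is automatic: the acceleration is \<open>chart_spray\<close> along
  position and velocity, hence continuous.\<close>

lemma geodesic_on_imp_Geo_conn:
  assumes con: "smooth_connection A \<Gamma>" and I: "open_interval I"
    and ex: "\<And>\<tau>. \<tau> \<in> I \<Longrightarrow> \<exists>J c. open_interval J \<and> \<tau> \<in> J \<and> J \<subseteq> I \<and> mchart A c \<and> geodesic_on \<Gamma> c J g"
  shows "Geo_conn A \<Gamma> I g"
proof -
  have loc: "Ck_on 2 J (snd c \<circ> g) \<and> continuous_on J g \<and> g ` J \<subseteq> fst c \<and>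
      (\<forall>t\<in>J. \<forall>i. vector_derivative (\<lambda>s. vector_derivative (snd c \<circ> g) (at s)) (at t) $ i
           + (\<Sum>j\<in>UNIV. \<Sum>k\<in>UNIV. \<Gamma> c i j k (g t) * vector_derivative (snd c \<circ> g) (at t) $ j
                * vector_derivative (snd c \<circ> g) (at t) $ k) = 0)"
    if J: "open_interval J" and c: "mchart A c" and g: "geodesic_on \<Gamma> c J g" for J c
  proof -
    have oJ: "open J" using J by (simp add: open_interval_def)
    have J_at: "at t within J = at t" if "t \<in> J" for t
      using oJ that by (rule at_within_open[rotated])
    obtain v where gc: "g ` J \<subseteq> fst c" and v: "geod_eq (chart_spray \<Gamma> c) J (\<lambda>t. snd c (g t)) v"
      using g by (auto simp: geodesic_on_def)
    let ?w = "\<lambda>t. chart_spray \<Gamma> c (snd c (g t), v t)"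
    have v1: "((\<lambda>t. snd c (g t)) has_vector_derivative v t) (at t)" and v2: "(v has_vector_derivative ?w t) (at t)"
      if "t \<in> J" for t
      using v that J_at[OF that] by (auto simp: geod_eq_def)
    have cont: "continuous_on J (\<lambda>t. snd c (g t))" "continuous_on J v"
      by (auto intro!: continuous_at_imp_continuous_on has_vector_derivative_continuous v1 v2)
    have sp: "spray (snd c ` fst c) (chart_spray \<Gamma> c)" by (rule spray_chart_spray[OF con c])
    then have "open (snd c ` fst c \<times> (UNIV :: (real^'b) set))" "Ck_on 0 (snd c ` fst c \<times> UNIV) (chart_spray \<Gamma> c)"
      by (auto simp: spray_def intro: open_Times)
    then have "continuous_on (snd c ` fst c \<times> UNIV) (chart_spray \<Gamma> c)" by simp
    then have contw: "continuous_on J ?w"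
      by (rule continuous_on_compose2) (use gc in \<open>auto intro!: continuous_intros cont\<close>)
    have "Ck_on (Suc (Suc 0)) J (\<lambda>t. snd c (g t))"
    proof (rule Ck_on_SucI[OF oJ v1[unfolded has_vector_derivative_def]])
      fix h
      have "((\<lambda>t. h *\<^sub>R v t) has_derivative (\<lambda>k. h *\<^sub>R k *\<^sub>R ?w t)) (at t)" if "t \<in> J" for t
        using v2[OF that] unfolding has_vector_derivative_def
        by (rule bounded_linear.has_derivative[OF bounded_linear_scaleR_right])
      then show "Ck_on (Suc 0) J (\<lambda>t. h *\<^sub>R v t)"
        by (rule Ck_on_SucI[OF oJ]) (auto intro!: continuous_intros contw)
    qed
    then have "Ck_on 2 J (snd c \<circ> g)" by (simp only: o_def numeral_2_eq_2)
    moreover have "continuous_on J g" by (rule continuous_on_geodesic[OF mchart_is_chart[OF c] g])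
    moreover have "vector_derivative (\<lambda>s. vector_derivative (snd c \<circ> g) (at s)) (at t) $ i
           + (\<Sum>j\<in>UNIV. \<Sum>k\<in>UNIV. \<Gamma> c i j k (g t) * vector_derivative (snd c \<circ> g) (at t) $ j
                * vector_derivative (snd c \<circ> g) (at t) $ k) = 0" if t: "t \<in> J" for t i
    proof -
      have vd: "vector_derivative (snd c \<circ> g) (at s) = v s" if "s \<in> J" for s
        using v1[OF that] by (auto simp: o_def intro: vector_derivative_at)
      have "((\<lambda>s. vector_derivative (snd c \<circ> g) (at s)) has_vector_derivative ?w t) (at t)"
        by (rule has_vector_derivative_transform_within_open[OF v2[OF t] oJ t]) (simp add: vd)
      then have "vector_derivative (\<lambda>s. vector_derivative (snd c \<circ> g) (at s)) (at t) = ?w t"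
        by (rule vector_derivative_at)
      moreover have "inv_into (fst c) (snd c) (snd c (g t)) = g t"
        using inv_chart[OF mchart_is_chart[OF c]] gc t by auto
      ultimately show ?thesis by (simp add: vd[OF t] chart_spray_def)
    qed
    ultimately show ?thesis using gc by blast
  qed
  have "continuous_on I g"
  proof (rule continuous_at_imp_continuous_on, rule ballI)
    fix \<tau> assume "\<tau> \<in> I"
    then obtain J c where J: "open_interval J" "\<tau> \<in> J" "mchart A c" "geodesic_on \<Gamma> c J g" using ex by blast
    then have "continuous_on J g" "open J" using loc by (auto simp: open_interval_def)
    then show "isCont g \<tau>" using J(2) continuous_on_eq_continuous_at by blast
  qed
  moreover have "\<exists>J c. open_interval J \<and> \<tau> \<in> J \<and> J \<subseteq> I \<and> mchart A c \<and> g ` J \<subseteq> fst c \<and> Ck_on 2 J (snd c \<circ> g)"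
    if "\<tau> \<in> I" for \<tau>
    using ex[OF that] loc by blast
  moreover have "\<exists>J c. open_interval J \<and> \<tau> \<in> J \<and> J \<subseteq> I \<and> mchart A c \<and> g ` J \<subseteq> fst c \<and>
      (\<forall>t\<in>J. \<forall>i. vector_derivative (\<lambda>s. vector_derivative (snd c \<circ> g) (at s)) (at t) $ i
           + (\<Sum>j\<in>UNIV. \<Sum>k\<in>UNIV. \<Gamma> c i j k (g t) * vector_derivative (snd c \<circ> g) (at t) $ j
                * vector_derivative (snd c \<circ> g) (at t) $ k) = 0)" if "\<tau> \<in> I" for \<tau>
    using ex[OF that] loc by meson
  ultimately show ?thesis using I unfolding Geo_conn_def Ck_curve_def by blast
qed

subsection \<open>A star refinement\<close>

text \<open>Lindelof's theorem applied to the open sets on which the functions are positive.\<close>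

lemma countable_positive_family:
  fixes \<eta> :: "'a::second_countable_topology \<Rightarrow> 'a \<Rightarrow> real"
  assumes "\<And>p. continuous_on UNIV (\<eta> p)" "\<And>p. 0 < \<eta> p p"
  obtains e :: "nat \<Rightarrow> 'a" where "\<And>z. \<exists>n. 0 < \<eta> (e n) z"
proof -
  have "open S" if "S \<in> range (\<lambda>p. {z. 0 < \<eta> p z})" for S
    using that assms(1) by (auto intro: open_Collect_less continuous_on_const)
  then obtain F where F: "F \<subseteq> range (\<lambda>p. {z. 0 < \<eta> p z})" "countable F" "\<Union>F = \<Union>(range (\<lambda>p. {z. 0 < \<eta> p z}))"
    using Lindelof by blast
  obtain P where P: "countable P" "F = (\<lambda>p. {z. 0 < \<eta> p z}) ` P"
    using F(1,2) countable_subset_image[of F "\<lambda>p. {z. 0 < \<eta> p z}" UNIV] by blast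
  have cover: "\<exists>p\<in>P. 0 < \<eta> p z" for z
  proof -
    have "z \<in> \<Union>F" unfolding F(3) using assms(2) by blast
    then show ?thesis unfolding P(2) by blast
  qed
  then have "P \<noteq> {}" by blast
  then show ?thesis using that[of "from_nat_into P"] cover P(1) from_nat_into_surj by metis
qed

text \<open>The functions \<open>2 ^ (- n) * \<eta> (e n)\<close> define a pseudometric, and a point \<open>p\<close> at which one of them is
  positive has a ball on which that one stays positive; of two such balls that meet, the larger one
  blown up by a constant factor contains both.\<close>

lemma star_refinement:
  fixes \<eta> :: "'a::second_countable_topology \<Rightarrow> 'a \<Rightarrow> real"
  assumes cont: "\<And>p. continuous_on UNIV (\<eta> p)" and pos: "\<And>p. 0 < \<eta> p p" and bnd: "\<And>p q. 0 \<le> \<eta> p q" "\<And>p q. \<eta> p q \<le> 1"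
  obtains N where "\<And>p. open (N p)" "\<And>p. p \<in> N p"
    "\<And>p q. N p \<inter> N q \<noteq> {} \<Longrightarrow> \<exists>k. \<forall>z\<in>N p \<union> N q. 0 < \<eta> k z"
proof -
  obtain e :: "nat \<Rightarrow> 'a" where e: "\<And>z. \<exists>n. 0 < \<eta> (e n) z"
    using countable_positive_family[OF cont pos] by blast
  \<comment> \<open>The weights make all but finitely many terms uniformly small, so that
    \<open>\<iota>\<close> is continuous into the sup norm although the functions are only
    separately continuous.\<close>
  define \<iota> :: "'a \<Rightarrow> nat \<Rightarrow>\<^sub>C real" where "\<iota> z = Bcontfun (\<lambda>n. (1/2)^n * \<eta> (e n) z)" for z
  have \<iota>: "apply_bcontfun (\<iota> z) n = (1/2)^n * \<eta> (e n) z" for z n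
  proof -
    have "(\<lambda>n. (1/2)^n * \<eta> (e n) z) \<in> bcontfun"
    proof (rule bcontfun_normI)
      show "norm ((1/2)^n * \<eta> (e n) z) \<le> 1" for n
        using bnd mult_le_one[of "(1/2)^n" "\<eta> (e n) z"] by (simp add: abs_mult power_le_one)
    qed simp
    then show ?thesis by (simp add: \<iota>_def Bcontfun_inverse)
  qed
  have c\<iota>: "continuous_on UNIV \<iota>"
    unfolding continuous_on_def
  proof (rule ballI, rule tendstoI)
    fix z :: 'a and \<epsilon> :: real assume "0 < \<epsilon>"
    then obtain M where M: "(1/2)^M < \<epsilon> / 2"
      using real_arch_pow_inv[of "\<epsilon> / 2" "1/2"] by auto
    have "\<forall>\<^sub>F w in at z. \<forall>n\<in>{..<M}. dist (\<eta> (e n) w) (\<eta> (e n) z) < \<epsilon> / 2"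
    proof (rule eventually_ball_finite)
      have "(\<eta> (e n) \<longlongrightarrow> \<eta> (e n) z) (at z)" for n
        using cont unfolding continuous_on_def by blast
      then show "\<forall>n\<in>{..<M}. \<forall>\<^sub>F w in at z. dist (\<eta> (e n) w) (\<eta> (e n) z) < \<epsilon> / 2"
        using half_gt_zero[OF \<open>0 < \<epsilon>\<close>] by (intro ballI tendstoD)
    qed simp
    then show "\<forall>\<^sub>F w in at z. dist (\<iota> w) (\<iota> z) < \<epsilon>"
    proof eventually_elim
      case (elim w)
      have "dist (\<iota> w) (\<iota> z) \<le> \<epsilon> / 2"
      proof (rule dist_bound)
        fix n
        have d: "dist (apply_bcontfun (\<iota> w) n) (apply_bcontfun (\<iota> z) n) = (1/2)^n * \<bar>\<eta> (e n) w - \<eta> (e n) z\<bar>"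
          by (simp add: \<iota> dist_real_def abs_mult flip: right_diff_distrib)
        show "dist (apply_bcontfun (\<iota> w) n) (apply_bcontfun (\<iota> z) n) \<le> \<epsilon> / 2"
        proof (cases "n < M")
          case True
          then have "\<bar>\<eta> (e n) w - \<eta> (e n) z\<bar> \<le> \<epsilon> / 2" using elim by (auto simp: dist_real_def less_imp_le)
          then have "(1/2)^n * \<bar>\<eta> (e n) w - \<eta> (e n) z\<bar> \<le> 1 * (\<epsilon> / 2)"
            by (intro mult_mono) (auto simp: power_le_one)
          then show ?thesis using d by simp
        next
          case False
          have "\<bar>\<eta> (e n) w - \<eta> (e n) z\<bar> \<le> 1"
            using bnd[of "e n" w] bnd[of "e n" z] by linarith
          moreover have "(1/2::real)^n \<le> (1/2)^M" using False by (intro power_decreasing) auto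
          ultimately have "(1/2)^n * \<bar>\<eta> (e n) w - \<eta> (e n) z\<bar> \<le> (1/2)^M * 1"
            by (intro mult_mono) auto
          then show ?thesis using d M by simp
        qed
      qed
      then show ?case using \<open>0 < \<epsilon>\<close> by simp
    qed
  qed
  \<comment> \<open>A coordinate above half of \<open>norm (\<iota> p)\<close> stays positive at
    distances below \<open>norm (\<iota> p) / 2\<close>. Reaching a point of a meeting ball of no
    larger norm takes three steps of at most 1/8 of that norm, 3/8 in all.\<close>
  define N where "N p = {w. dist (\<iota> p) (\<iota> w) < norm (\<iota> p) / 8}" for p
  have npos: "0 < norm (\<iota> p)" for p
  proof -
    obtain n where "0 < \<eta> (e n) p" using e by blast
    then have "0 < norm (apply_bcontfun (\<iota> p) n)" by (simp add: \<iota>)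
    then show ?thesis using norm_bounded[of "\<iota> p" n] by linarith
  qed
  have star: "\<exists>k. \<forall>z\<in>N p \<union> N q. 0 < \<eta> k z" if pq: "N p \<inter> N q \<noteq> {}" "norm (\<iota> q) \<le> norm (\<iota> p)" for p q
  proof -
    obtain n where n: "norm (\<iota> p) / 2 < apply_bcontfun (\<iota> p) n"
    proof (rule ccontr)
      assume "\<not> thesis"
      then have "apply_bcontfun (\<iota> p) n \<le> norm (\<iota> p) / 2" for n
        using that[of n] by (meson not_le)
      moreover have "0 \<le> apply_bcontfun (\<iota> p) n" for n using bnd(1) by (simp add: \<iota>)
      ultimately have "norm (apply_bcontfun (\<iota> p) n) \<le> norm (\<iota> p) / 2" for n by simp
      then have "norm (\<iota> p) \<le> norm (\<iota> p) / 2" by (rule norm_bound)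
      then show False using npos[of p] by simp
    qed
    obtain a where a: "a \<in> N p" "a \<in> N q" using pq by blast
    have near: "dist (\<iota> p) (\<iota> z) < norm (\<iota> p) / 2" if "z \<in> N p \<union> N q" for z
    proof (cases "z \<in> N p")
      case True
      then have "dist (\<iota> p) (\<iota> z) < norm (\<iota> p) / 8" by (simp add: N_def)
      then show ?thesis using npos[of p] by linarith
    next
      case False
      then have "dist (\<iota> q) (\<iota> z) < norm (\<iota> q) / 8" using that by (simp add: N_def)
      moreover have "dist (\<iota> p) (\<iota> a) < norm (\<iota> p) / 8" "dist (\<iota> q) (\<iota> a) < norm (\<iota> q) / 8"
        using a by (simp_all add: N_def)
      ultimately show ?thesis
        using pq(2) npos[of p] dist_triangle[of "\<iota> p" "\<iota> z" "\<iota> a"] dist_triangle[of "\<iota> a" "\<iota> z" "\<iota> q"]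
          dist_commute[of "\<iota> a" "\<iota> q"] by linarith
    qed
    have "0 < \<eta> (e n) z" if z: "z \<in> N p \<union> N q" for z
    proof -
      have "dist (apply_bcontfun (\<iota> p) n) (apply_bcontfun (\<iota> z) n) < norm (\<iota> p) / 2"
        by (rule dist_fun_lt_imp_dist_val_lt[OF near[OF z]])
      then have "0 < apply_bcontfun (\<iota> z) n" using n unfolding dist_real_def by linarith
      then show ?thesis by (simp add: \<iota> zero_less_mult_iff)
    qed
    then show ?thesis by blast
  qed
  show ?thesis
  proof (rule that[of N])
    show "open (N p)" for p
      unfolding N_def by (intro open_Collect_less continuous_intros c\<iota>)
    show "p \<in> N p" for p using npos[of p] by (simp add: N_def)
    show "\<exists>k. \<forall>z\<in>N p \<union> N q. 0 < \<eta> k z" if "N p \<inter> N q \<noteq> {}" for p q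
      using star[of p q] star[of q p] that by (cases "norm (\<iota> q) \<le> norm (\<iota> p)") (auto simp: Int_commute Un_commute)
  qed
qed

text \<open>Cutting off at radius \<open>r / 2\<close> confines the support to the preimage of a
  closed ball. That set is compact, hence closed in a Hausdorff space, so the extension by zero is
  continuous.\<close>

lemma chart_bump_function:
  fixes c :: "('a::t2_space, 'n::finite) chart"
  assumes c: "is_chart c" "p \<in> fst c" and r: "0 < r" "ball (snd c p) r \<subseteq> snd c ` fst c"
  obtains \<eta> where "continuous_on UNIV \<eta>" "0 < \<eta> p" "\<And>q. 0 \<le> \<eta> q" "\<And>q. \<eta> q \<le> (1::real)"
    "\<And>q. 0 < \<eta> q \<Longrightarrow> q \<in> coord_ball c (snd c p) r"
proof -
  define b where "b q = max 0 (min 1 (r / 2 - dist (snd c p) (snd c q)))" for q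
  define \<eta> where "\<eta> q = (if q \<in> fst c then b q else 0)" for q
  let ?K = "inv_into (fst c) (snd c) ` cball (snd c p) (r / 2)"
  have sub: "cball (snd c p) (r / 2) \<subseteq> snd c ` fst c"
    using r by (intro order_trans[OF _ r(2)]) auto
  have "closed ?K"
    by (intro compact_imp_closed compact_continuous_image compact_cball continuous_on_subset[OF is_chartD(5)[OF c(1)] sub])
  then have oK: "open (- ?K)" by (rule open_Compl)
  have out: "\<eta> q = 0" if "q \<notin> ?K" for q
  proof (cases "q \<in> fst c")
    case True
    then have "snd c q \<notin> cball (snd c p) (r / 2)"
      using that inv_chart[OF c(1) True] by (metis image_eqI)
    then show ?thesis by (simp add: \<eta>_def b_def)
  qed (simp add: \<eta>_def)
  have "continuous_on (fst c) b"
    unfolding b_def by (intro continuous_intros is_chartD(4)[OF c(1)])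
  then have "continuous_on (fst c) \<eta>"
    using continuous_on_cong[of "fst c" "fst c" \<eta> b] by (simp add: \<eta>_def)
  moreover have "continuous_on (- ?K) \<eta>"
    using continuous_on_cong[of "- ?K" "- ?K" \<eta> "\<lambda>_. 0"] out by auto
  ultimately have "continuous_on (fst c \<union> - ?K) \<eta>"
    by (rule continuous_on_open_Un[OF is_chartD(1)[OF c(1)] oK])
  moreover have "?K \<subseteq> fst c" using sub by (auto intro!: inv_into_into)
  then have "fst c \<union> - ?K = UNIV" by auto
  ultimately have "continuous_on UNIV \<eta>" by simp
  moreover have "0 < \<eta> p" using c r by (simp add: \<eta>_def b_def)
  moreover have "q \<in> coord_ball c (snd c p) r" if "0 < \<eta> q" for q
    using that r(1) by (auto simp: \<eta>_def b_def coord_ball_def split: if_splits)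
  ultimately show ?thesis using that[of \<eta>] by (auto simp: \<eta>_def b_def)
qed

subsection \<open>Gluing local solutions\<close>

text \<open>Existence is asked for in all concentric balls up to radius \<open>R\<close>, uniqueness
  in the full ball: later, segments are constructed in balls of radius \<open>s p\<close> and
  compared in balls of radius \<open>R k\<close>.\<close>

definition geodesic_ball :: "('a, 'n::finite) connection \<Rightarrow> ('a, 'n) chart \<Rightarrow> real^'n \<Rightarrow> real
    \<Rightarrow> (((real^'n) \<times> (real^'n)) \<times> real \<Rightarrow> real^'n) \<Rightarrow> bool"
  where "geodesic_ball \<Gamma> c z R F \<longleftrightarrow> 0 < R \<and> ball z R \<subseteq> snd c ` fst c \<and>
    (\<forall>k. Ck_on k ((ball z R \<times> ball z R) \<times> {-1<..<2}) F) \<and>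
    (\<forall>g h. geodesic_on \<Gamma> c {0..1} g \<longrightarrow> geodesic_on \<Gamma> c {0..1} h \<longrightarrow> g ` {0..1} \<subseteq> coord_ball c z R \<longrightarrow>
      h ` {0..1} \<subseteq> coord_ball c z R \<longrightarrow> g 0 = h 0 \<longrightarrow> g 1 = h 1 \<longrightarrow> (\<forall>t\<in>{0..1}. g t = h t)) \<and>
    (\<forall>r\<le>R. \<forall>a\<in>ball z r. \<forall>b\<in>ball z r. F ((a, b), 0) = a \<and> F ((a, b), 1) = b \<and>
      (\<forall>t\<in>{0..1}. F ((a, b), t) \<in> ball z r) \<and> (\<exists>v. geod_eq (chart_spray \<Gamma> c) {0..1} (\<lambda>t. F ((a, b), t)) v))"

lemma geodesic_ball_exists:
  assumes "smooth_connection A \<Gamma>" and c: "mchart A c" "p \<in> fst c"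
  shows "\<exists>R F. geodesic_ball \<Gamma> c (snd c p) R F"
proof -
  let ?z = "snd c p"
  have "?z \<in> snd c ` fst c" using c by simp
  from spray_chart_spray[OF assms(1) c(1)] this show ?thesis
  proof (rule local_geodesics)
    fix R F assume R: "0 < R" "ball ?z R \<subseteq> snd c ` fst c"
      and C: "\<And>k. Ck_on k ((ball ?z R \<times> ball ?z R) \<times> {-1<..<2::real}) F"
      and U: "\<And>x x' y y' t. geod_eq (chart_spray \<Gamma> c) {0..1} x x' \<Longrightarrow> geod_eq (chart_spray \<Gamma> c) {0..1} y y' \<Longrightarrow>
        x ` {0..1} \<subseteq> ball ?z R \<Longrightarrow> y ` {0..1} \<subseteq> ball ?z R \<Longrightarrow> x 0 = y 0 \<Longrightarrow> x 1 = y 1 \<Longrightarrow> t \<in> {0..1} \<Longrightarrow> x t = y t"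
      and E: "\<And>r a b. r \<le> R \<Longrightarrow> a \<in> ball ?z r \<Longrightarrow> b \<in> ball ?z r \<Longrightarrow>
        F ((a, b), 0) = a \<and> F ((a, b), 1) = b \<and> (\<forall>t\<in>{0..1}. F ((a, b), t) \<in> ball ?z r) \<and>
        (\<exists>c'. geod_eq (chart_spray \<Gamma> c) {0..1} (\<lambda>t. F ((a, b), t)) c')"
    have "\<forall>t\<in>{0..1}. g t = h t" if g: "geodesic_on \<Gamma> c {0..1} g" and h: "geodesic_on \<Gamma> c {0..1} h"
      and gb: "g ` {0..1} \<subseteq> coord_ball c ?z R" and hb: "h ` {0..1} \<subseteq> coord_ball c ?z R" and e: "g 0 = h 0" "g 1 = h 1" for g h
    proof
      fix t :: real assume t: "t \<in> {0..1}"
      obtain v w where vw: "geod_eq (chart_spray \<Gamma> c) {0..1} (\<lambda>t. snd c (g t)) v" "geod_eq (chart_spray \<Gamma> c) {0..1} (\<lambda>t. snd c (h t)) w"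
        using g h by (auto simp: geodesic_on_def)
      have "snd c (g t) = snd c (h t)"
        by (rule U[OF vw]) (use gb hb e t in \<open>auto simp: coord_ball_def image_subset_iff\<close>)
      moreover have "g t \<in> fst c" "h t \<in> fst c" using gb hb t by (auto simp: coord_ball_def image_subset_iff)
      ultimately show "g t = h t"
        using is_chartD(3)[OF mchart_is_chart[OF c(1)]] by (simp add: inj_on_eq_iff)
    qed
    then have "geodesic_ball \<Gamma> c ?z R F"
      unfolding geodesic_ball_def by (intro conjI R allI ballI impI C) (use E in auto)
    then show ?thesis by blast
  qed
qed

lemma geodesic_ball_segment:
  assumes c: "is_chart c" and G: "geodesic_ball \<Gamma> c z R F" and r: "r \<le> R"
    and ab: "a \<in> coord_ball c z r" "b \<in> coord_ball c z r"
  defines "g \<equiv> \<lambda>t. inv_into (fst c) (snd c) (F ((snd c a, snd c b), t))"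
  shows "geodesic_on \<Gamma> c {0..1} g" "g ` {0..1} \<subseteq> coord_ball c z r" "g 0 = a" "g 1 = b"
    and "t \<in> {0..1} \<Longrightarrow> snd c (g t) = F ((snd c a, snd c b), t)"
proof -
  have ab': "snd c a \<in> ball z r" "snd c b \<in> ball z r" "a \<in> fst c" "b \<in> fst c"
    using ab by (auto simp: coord_ball_def)
  have sub: "ball z r \<subseteq> snd c ` fst c"
    using G r by (auto simp: geodesic_ball_def)
  have F: "F ((snd c a, snd c b), 0) = snd c a" "F ((snd c a, snd c b), 1) = snd c b"
    "\<And>t. t \<in> {0..1} \<Longrightarrow> F ((snd c a, snd c b), t) \<in> ball z r"
    "\<exists>v. geod_eq (chart_spray \<Gamma> c) {0..1} (\<lambda>t. F ((snd c a, snd c b), t)) v"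
    using G r ab' unfolding geodesic_ball_def by blast+
  show *: "snd c (g t) = F ((snd c a, snd c b), t)" if "t \<in> {0..1}" for t
    unfolding g_def by (rule f_inv_into_f) (use F(3)[OF that] sub in blast)
  have in_dom: "g t \<in> fst c" if "t \<in> {0..1}" for t
    unfolding g_def by (rule inv_into_into) (use F(3)[OF that] sub in blast)
  show cb: "g ` {0..1} \<subseteq> coord_ball c z r"
    using * F(3) in_dom by (auto simp: coord_ball_def image_subset_iff)
  show "g 0 = a" "g 1 = b" using F(1,2) ab' inv_chart[OF c] by (auto simp: g_def)
  obtain v where "geod_eq (chart_spray \<Gamma> c) {0..1} (\<lambda>t. F ((snd c a, snd c b), t)) v" using F(4) by blast
  then have "geod_eq (chart_spray \<Gamma> c) {0..1} (\<lambda>t. snd c (g t)) v"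
    by (rule geod_eq_cong) (rule *)
  then show "geodesic_on \<Gamma> c {0..1} g" using in_dom unfolding geodesic_on_def by blast
qed

lemma geodesic_ball_smooth:
  assumes "geodesic_ball \<Gamma> c z R F" "r \<le> R"
  shows "smooth_on ((ball z r \<times> ball z r) \<times> {-1<..<2}) F"
proof -
  have o: "open ((ball z e \<times> ball z e) \<times> {-1<..<2::real})" for e
    by (intro open_Times open_ball open_greaterThanLessThan)
  have "(ball z r \<times> ball z r) \<times> {-1<..<2::real} \<subseteq> (ball z R \<times> ball z R) \<times> {-1<..<2}"
    using assms(2) by auto
  moreover have "Ck_on k ((ball z R \<times> ball z R) \<times> {-1<..<2}) F" for k
    using assms(1) by (simp add: geodesic_ball_def)
  ultimately show ?thesis
    unfolding smooth_on_def using Ck_on_subset[OF o o] o by blast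
qed

text \<open>Each point carries a bump function positive only inside its ball of radius
  \<open>R p\<close>, and \<open>s p\<close> is chosen so that the smaller ball lies in the star
  refined neighbourhood. Where two small balls meet, a single bump function is positive on both,
  which puts them in one uniqueness ball.\<close>

lemma geodesic_segment_family:
  fixes A :: "('a::{t2_space, second_countable_topology}, 'n::finite) chart set"
  assumes at: "smooth_atlas A"
    and con: "smooth_connection A \<Gamma>"
  obtains c :: "'a \<Rightarrow> ('a, 'n) chart" and R s F V
  where "\<And>p. c p \<in> A" "\<And>p. p \<in> fst (c p)" "\<And>p. geodesic_ball \<Gamma> (c p) (snd (c p) p) (R p) (F p)" "\<And>p. 0 < s p" "\<And>p. s p \<le> R p"
    and "\<And>p q. coord_ball (c p) (snd (c p) p) (s p) \<inter> coord_ball (c q) (snd (c q) q) (s q) \<noteq> {} \<Longrightarrow>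
      \<exists>k. coord_ball (c p) (snd (c p) p) (s p) \<union> coord_ball (c q) (snd (c q) q) (s q) \<subseteq> coord_ball (c k) (snd (c k) k) (R k)"
proof -
  have "\<exists>c. c \<in> A \<and> p \<in> fst c" for p
  proof -
    have "(\<Union>c\<in>A. fst c) = UNIV" using at by (simp add: smooth_atlas_def)
    then show ?thesis by blast
  qed
  then obtain c where c: "\<And>p. c p \<in> A" "\<And>p. p \<in> fst (c p)" by metis
  have mc: "mchart A (c p)" and ic: "is_chart (c p)" for p
    using mchart_atlas[OF at c(1)] mchart_is_chart by blast+
  let ?z = "\<lambda>p. snd (c p) p"
  have "\<forall>p. \<exists>R F. geodesic_ball \<Gamma> (c p) (?z p) R F"
    using geodesic_ball_exists[OF con mc c(2)] by blast
  then obtain R F where RF: "\<And>p. geodesic_ball \<Gamma> (c p) (?z p) (R p) (F p)" by metis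
  have "\<exists>\<eta>. continuous_on UNIV \<eta> \<and> 0 < \<eta> p \<and> (\<forall>q. 0 \<le> \<eta> q \<and> \<eta> q \<le> (1::real) \<and> (0 < \<eta> q \<longrightarrow> q \<in> coord_ball (c p) (?z p) (R p)))" for p
    by (rule chart_bump_function[OF ic[of p] c(2)[of p], of "R p"]) (use RF[of p] in \<open>auto simp: geodesic_ball_def\<close>)
  then obtain \<eta> where \<eta>: "\<And>p. continuous_on UNIV (\<eta> p)" "\<And>p. 0 < \<eta> p p" "\<And>p q. 0 \<le> \<eta> p q" "\<And>p q. \<eta> p q \<le> (1::real)"
    "\<And>p q. 0 < \<eta> p q \<Longrightarrow> q \<in> coord_ball (c p) (?z p) (R p)"
    by metis
  obtain N where N: "\<And>p. open (N p)" "\<And>p. p \<in> N p" "\<And>p q. N p \<inter> N q \<noteq> {} \<Longrightarrow> \<exists>k. \<forall>z\<in>N p \<union> N q. 0 < \<eta> k z"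
    by (rule star_refinement[of \<eta>]) (use \<eta> in auto)
  have "\<exists>s>0. s \<le> R p \<and> coord_ball (c p) (?z p) s \<subseteq> N p" for p
  proof -
    have "open (snd (c p) ` (N p \<inter> fst (c p)))" by (rule open_chart_image[OF ic N(1)])
    moreover have "?z p \<in> snd (c p) ` (N p \<inter> fst (c p))" using N(2) c(2) by blast
    ultimately obtain s where s: "s > 0" "ball (?z p) s \<subseteq> snd (c p) ` (N p \<inter> fst (c p))"
      using open_contains_ball by blast
    have "coord_ball (c p) (?z p) (min s (R p)) \<subseteq> N p"
    proof
      fix q assume "q \<in> coord_ball (c p) (?z p) (min s (R p))"
      then have q: "q \<in> fst (c p)" "snd (c p) q \<in> ball (?z p) s" by (auto simp: coord_ball_def)
      then obtain q' where "q' \<in> N p" "q' \<in> fst (c p)" "snd (c p) q = snd (c p) q'" using s(2) by blast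
      then show "q \<in> N p" using q(1) is_chartD(3)[OF ic] by (metis inj_on_eq_iff)
    qed
    moreover have "0 < R p" using RF by (simp add: geodesic_ball_def)
    ultimately show ?thesis using s(1) by (intro exI[of _ "min s (R p)"]) auto
  qed
  then obtain s where s: "\<And>p. 0 < s p" "\<And>p. s p \<le> R p" "\<And>p. coord_ball (c p) (?z p) (s p) \<subseteq> N p" by metis
  have "\<exists>k. coord_ball (c p) (?z p) (s p) \<union> coord_ball (c q) (?z q) (s q) \<subseteq> coord_ball (c k) (?z k) (R k)"
    if "coord_ball (c p) (?z p) (s p) \<inter> coord_ball (c q) (?z q) (s q) \<noteq> {}" for p q
  proof -
    have "N p \<inter> N q \<noteq> {}" using that s(3) by blast
    then obtain k where "\<forall>z\<in>N p \<union> N q. 0 < \<eta> k z" using N(3) by blast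
    then show ?thesis using \<eta>(5) s(3) by blast
  qed
  then show ?thesis using that[of c R F s] c RF s(1,2) by blast
qed

section \<open>The glued solution and its geodesics\<close>

theorem mainTheorem5:
  fixes A :: "('a::{t2_space, second_countable_topology}, 'n::finite) chart set"
    and \<Gamma> :: "('a, 'n) connection"
  assumes "smooth_atlas A"
    and "smooth_connection A \<Gamma>"
  shows "\<exists>D f. geo_solution D f \<and> smooth_geo_map A D f \<and>
           (\<forall>I g. Geo_fun D f I g \<longleftrightarrow> Geo_conn A \<Gamma> I g)"
proof -
  have lin: "linear_connection A \<Gamma>" using assms(2) by (simp add: smooth_connection_def)
  obtain c :: "'a \<Rightarrow> ('a, 'n) chart" and R s F where c: "\<And>p. c p \<in> A" "\<And>p. p \<in> fst (c p)"
    and GB: "\<And>p. geodesic_ball \<Gamma> (c p) (snd (c p) p) (R p) (F p)" and s: "\<And>p. 0 < s p" "\<And>p. s p \<le> R p"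
    and star: "\<And>p q. coord_ball (c p) (snd (c p) p) (s p) \<inter> coord_ball (c q) (snd (c q) q) (s q) \<noteq> {} \<Longrightarrow>
      \<exists>k. coord_ball (c p) (snd (c p) p) (s p) \<union> coord_ball (c q) (snd (c q) q) (s q) \<subseteq> coord_ball (c k) (snd (c k) k) (R k)"
    using geodesic_segment_family[OF assms] by metis
  have mc: "mchart A (c p)" and ic: "is_chart (c p)" for p
    using mchart_atlas[OF assms(1) c(1)] mchart_is_chart by blast+
  define U where "U p = coord_ball (c p) (snd (c p) p) (s p)" for p
  have oU: "open (U p)" for p unfolding U_def by (rule open_coord_ball[OF ic])
  have pU: "p \<in> U p" for p using s(1) c(2) by (simp add: U_def coord_ball_def)
  have Ufst: "U p \<subseteq> fst (c p)" for p by (auto simp: U_def coord_ball_def)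
  define D where "D = (\<Union>p. U p \<times> U p)"
  define G where "G p a b t = inv_into (fst (c p)) (snd (c p)) (F p ((snd (c p) a, snd (c p) b), t))" for p a b t
  \<comment> \<open>Any ball containing both points may be selected; \<open>key\<close> shows that
    the segment does not depend on the choice.\<close>
  define sel where "sel a b = (SOME p. a \<in> U p \<and> b \<in> U p)" for a b
  define f where "f a b t = G (sel a b) a b t" for a b t
  have seg: "geodesic_on \<Gamma> (c p) {0..1} (G p a b)" "G p a b ` {0..1} \<subseteq> U p" "G p a b 0 = a" "G p a b 1 = b"
    "\<And>t. t \<in> {0..1} \<Longrightarrow> snd (c p) (G p a b t) = F p ((snd (c p) a, snd (c p) b), t)"
    if "a \<in> U p" "b \<in> U p" for p a b
    using geodesic_ball_segment[OF ic GB s(2) that[unfolded U_def]] unfolding G_def U_def by blast+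
  have change: "geodesic_on \<Gamma> (c q) S g" if "geodesic_on \<Gamma> (c p) S g" "g ` S \<subseteq> fst (c q)" for p q S g
    using geodesic_on_chart_change[OF lin mc mc _ that] mchart_compatible[OF mc c(1)] by blast
  \<comment> \<open>\<open>U p\<close> and \<open>U (sel a b)\<close> share the point
    \<open>a\<close>, so both lie in one ball with unique geodesics. Hence \<open>f\<close> agrees
    with every geodesic from \<open>a\<close> to \<open>b\<close> inside some \<open>U p\<close>;
    the functional equation and both inclusions of geodesics rest on this.\<close>
  have key: "f a b t = g t" if ab: "a \<in> U p" "b \<in> U p" and g: "geodesic_on \<Gamma> (c p) {0..1} g" "g ` {0..1} \<subseteq> U p"
    and e: "g 0 = a" "g 1 = b" and t: "t \<in> {0..1}" for p a b g t
  proof -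
    define q where "q = sel a b"
    have q: "a \<in> U q" "b \<in> U q"
      using someI[of "\<lambda>p. a \<in> U p \<and> b \<in> U p" p] ab by (auto simp: q_def sel_def)
    then obtain k where k: "U p \<union> U q \<subseteq> coord_ball (c k) (snd (c k) k) (R k)"
      using star[of p q] ab(1) unfolding U_def by blast
    have inV: "g ` {0..1} \<subseteq> coord_ball (c k) (snd (c k) k) (R k)" "G q a b ` {0..1} \<subseteq> coord_ball (c k) (snd (c k) k) (R k)"
      using g(2) seg(2)[OF q] k by auto
    moreover have "geodesic_on \<Gamma> (c k) {0..1} g" "geodesic_on \<Gamma> (c k) {0..1} (G q a b)"
      using inV by (auto intro!: change[OF g(1)] change[OF seg(1)[OF q]] simp: coord_ball_def image_subset_iff)
    ultimately have "G q a b t = g t"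
      using GB[of k] seg(3,4)[OF q] e t unfolding geodesic_ball_def by metis
    then show ?thesis by (simp add: f_def q_def)
  qed
  have fG: "f a b t = G p a b t" if "a \<in> U p" "b \<in> U p" "t \<in> {0..1}" for p a b t
    using key[OF that(1,2) seg(1-4)[OF that(1,2)] that(3)] .
  have contG: "continuous_on ((U p \<times> U p) \<times> {0..1}) (\<lambda>((a, b), t). G p a b t)" for p
  proof -
    have "continuous_on ((U p \<times> U p) \<times> {0..1::real}) (\<lambda>z. F p ((snd (c p) (fst (fst z)), snd (c p) (snd (fst z))), snd z))"
    proof (rule continuous_on_compose2[of "(ball (snd (c p) p) (s p) \<times> ball (snd (c p) p) (s p)) \<times> {-1<..<2}" "F p"])
      show "continuous_on ((ball (snd (c p) p) (s p) \<times> ball (snd (c p) p) (s p)) \<times> {-1<..<2}) (F p)"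
        using geodesic_ball_smooth[OF GB s(2)] Ck_on_continuous unfolding smooth_on_def by blast
      show "continuous_on ((U p \<times> U p) \<times> {0..1::real}) (\<lambda>z. ((snd (c p) (fst (fst z)), snd (c p) (snd (fst z))), snd z))"
        by (intro continuous_intros continuous_on_compose2[OF is_chartD(4)[OF ic]])
          (use Ufst[of p] in auto)
    qed (auto simp: U_def coord_ball_def)
    then have "continuous_on ((U p \<times> U p) \<times> {0..1::real})
      (\<lambda>z. inv_into (fst (c p)) (snd (c p)) (F p ((snd (c p) (fst (fst z)), snd (c p) (snd (fst z))), snd z)))"
    proof (rule continuous_on_compose2[OF is_chartD(5)[OF ic]])
      show "(\<lambda>z. F p ((snd (c p) (fst (fst z)), snd (c p) (snd (fst z))), snd z)) ` ((U p \<times> U p) \<times> {0..1}) \<subseteq> snd (c p) ` fst (c p)"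
      proof clarsimp
        fix a b and t :: real assume *: "a \<in> U p" "b \<in> U p" "0 \<le> t" "t \<le> 1"
        then have "G p a b t \<in> fst (c p)" using seg(2)[OF *(1,2)] Ufst[of p] by (meson atLeastAtMost_iff image_subset_iff subsetD)
        then show "F p ((snd (c p) a, snd (c p) b), t) \<in> snd (c p) ` fst (c p)"
          using seg(5)[OF *(1,2), of t] * by (metis atLeastAtMost_iff imageI)
      qed
    qed
    then show ?thesis by (simp add: G_def case_prod_unfold)
  qed
  have "geo_solution D f"
    unfolding geo_solution_def
  proof (intro conjI)
    show "open D" unfolding D_def by (intro open_UN ballI open_Times oU)
    show "\<forall>a. (a, a) \<in> D" using pU by (auto simp: D_def)
    show "continuous_on (D \<times> {0..1}) (\<lambda>((a, b), t). f a b t)"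
      unfolding continuous_on_eq_continuous_within
    proof
      fix z assume z: "z \<in> D \<times> {0..1::real}"
      then obtain p where p: "z \<in> (U p \<times> U p) \<times> {0..1}" by (auto simp: D_def)
      have "continuous_on ((U p \<times> U p) \<times> {0..1}) (\<lambda>((a, b), t). f a b t)"
        by (rule continuous_on_eq[OF contG]) (auto simp: fG)
      then have "continuous (at z within (U p \<times> U p) \<times> {0..1}) (\<lambda>((a, b), t). f a b t)"
        using p unfolding continuous_on_eq_continuous_within by blast
      \<comment> \<open>Continuity is local: near \<open>z\<close> the set \<open>D\<close> may be
        replaced by its open subset \<open>U p \<times> U p\<close>.\<close>
      moreover have "at z within D \<times> {0..1} = at z within (U p \<times> U p) \<times> {0..1}"
        by (rule at_within_nhd[of z "(U p \<times> U p) \<times> UNIV"])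
          (use p oU in \<open>auto simp: D_def intro!: open_Times\<close>)
      ultimately show "continuous (at z within D \<times> {0..1}) (\<lambda>((a, b), t). f a b t)" by simp
    qed
    show "\<forall>(a, b)\<in>D. \<forall>\<alpha>\<in>{0..1}. \<forall>\<beta>\<in>{0..1}. \<forall>\<gamma>\<in>{0..1}.
        f a b 0 = a \<and> f a b 1 = b \<and> (f a b \<alpha>, f a b \<beta>) \<in> D \<and>
        f a b ((1 - \<gamma>) * \<alpha> + \<gamma> * \<beta>) = f (f a b \<alpha>) (f a b \<beta>) \<gamma>"
    proof (clarify, intro conjI)
      fix a b and \<alpha> \<beta> \<gamma> :: real assume "(a, b) \<in> D" and t: "\<alpha> \<in> {0..1}" "\<beta> \<in> {0..1}" "\<gamma> \<in> {0..1}"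
      then obtain p where p: "a \<in> U p" "b \<in> U p" by (auto simp: D_def)
      note S = seg[OF p] and E = fG[OF p]
      show "f a b 0 = a" "f a b 1 = b" using E S(3,4) by auto
      have in_U: "f a b \<alpha> \<in> U p" "f a b \<beta> \<in> U p" using E S(2) t by (auto simp: image_subset_iff)
      then show "(f a b \<alpha>, f a b \<beta>) \<in> D" by (auto simp: D_def)
      have conv: "\<alpha> + \<gamma> * (\<beta> - \<alpha>) \<in> {0..1}" if "\<gamma> \<in> {0..1}" for \<gamma>
      proof -
        have "(1 - \<gamma>) *\<^sub>R \<alpha> + \<gamma> *\<^sub>R \<beta> \<in> {0..1}"
          using convexD[OF convex_real_interval(5), of \<alpha> 0 1 \<beta> "1 - \<gamma>" \<gamma>] t that by auto
        then show ?thesis by (simp add: algebra_simps)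
      qed
      \<comment> \<open>The piece of the segment between \<open>\<alpha>\<close> and
        \<open>\<beta>\<close>, reparametrised over \<open>{0..1}\<close>, is a geodesic in the same
        \<open>U p\<close>; the case \<open>\<beta> \<le> \<alpha>\<close> is included.\<close>
      have "f (f a b \<alpha>) (f a b \<beta>) \<gamma> = G p a b (\<alpha> + \<gamma> * (\<beta> - \<alpha>))"
      proof (rule key[OF in_U geodesic_on_affine[OF assms(2) mc S(1) conv] _ _ _ t(3)])
        show "(\<lambda>\<gamma>. G p a b (\<alpha> + \<gamma> * (\<beta> - \<alpha>))) ` {0..1} \<subseteq> U p"
          using S(2) conv by blast
      qed (use E t in auto)
      also have "\<dots> = f a b (\<alpha> + \<gamma> * (\<beta> - \<alpha>))" using E[OF conv[OF t(3)]] by simp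
      also have "\<alpha> + \<gamma> * (\<beta> - \<alpha>) = (1 - \<gamma>) * \<alpha> + \<gamma> * \<beta>" by (simp add: algebra_simps)
      finally show "f a b ((1 - \<gamma>) * \<alpha> + \<gamma> * \<beta>) = f (f a b \<alpha>) (f a b \<beta>) \<gamma>" by simp
    qed
  qed
  moreover have "smooth_geo_map A D f"
    unfolding smooth_geo_map_def
  proof (intro allI impI)
    fix a b and t :: real assume ab: "(a, b) \<in> D" and t: "t \<in> {0..1}"
    then obtain p where p: "a \<in> U p" "b \<in> U p" by (auto simp: D_def)
    let ?B = "ball (snd (c p) p) (s p)"
    \<comment> \<open>The open time interval around \<open>{0..1}\<close> provides the smooth
      extension past both ends.\<close>
    let ?W = "(?B \<times> ?B) \<times> {-1<..<2::real}"
    have "f a' b' t' \<in> fst (c p) \<and> snd (c p) (f a' b' t') = F p ((snd (c p) a', snd (c p) b'), t')"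
      if "t' \<in> {0..1}" "a' \<in> fst (c p)" "b' \<in> fst (c p)" "((snd (c p) a', snd (c p) b'), t') \<in> ?W" for a' b' t'
    proof -
      have U: "a' \<in> U p" "b' \<in> U p" using that by (auto simp: U_def coord_ball_def)
      show ?thesis using fG[OF U that(1)] seg(2)[OF U] seg(5)[OF U that(1)] that(1) Ufst[of p]
        by (metis image_subset_iff subsetD)
    qed
    moreover have "smooth_on ?W (F p)" by (rule geodesic_ball_smooth[OF GB s(2)])
    moreover have "open ?W" by (intro open_Times open_ball open_greaterThanLessThan)
    moreover have "((snd (c p) a, snd (c p) b), t) \<in> ?W" "a \<in> fst (c p)" "b \<in> fst (c p)"
      using p t by (auto simp: U_def coord_ball_def)
    ultimately show "\<exists>x1 x2 y W F. mchart A x1 \<and> mchart A x2 \<and> mchart A y \<and>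
          a \<in> fst x1 \<and> b \<in> fst x2 \<and> open W \<and> ((snd x1 a, snd x2 b), t) \<in> W \<and>
          smooth_on W (F :: ((real^'n) \<times> (real^'n)) \<times> real \<Rightarrow> real^'n) \<and>
          (\<forall>a' b' t'. (a', b') \<in> D \<longrightarrow> t' \<in> {0..1} \<longrightarrow> a' \<in> fst x1 \<longrightarrow> b' \<in> fst x2 \<longrightarrow>
              ((snd x1 a', snd x2 b'), t') \<in> W \<longrightarrow>
              f a' b' t' \<in> fst y \<and> snd y (f a' b' t') = F ((snd x1 a', snd x2 b'), t'))"
      using mc[of p] by (intro exI[of _ "c p"] exI[of _ ?W] exI[of _ "F p"]) blast
  qed
  moreover have "Geo_conn A \<Gamma> I g" if G: "Geo_fun D f I g" for I g
  proof (rule geodesic_on_imp_Geo_conn[OF assms(2)])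
    show I: "open_interval I" using G by (simp add: Geo_fun_def)
    fix \<tau> assume "\<tau> \<in> I"
    then obtain \<alpha> \<beta> where ab: "\<alpha> \<in> I" "\<beta> \<in> I" "\<alpha> < \<tau>" "\<tau> < \<beta>" "(g \<alpha>, g \<beta>) \<in> D"
      and eq: "\<And>\<gamma>. \<gamma> \<in> {0..1} \<Longrightarrow> g ((1 - \<gamma>) * \<alpha> + \<gamma> * \<beta>) = f (g \<alpha>) (g \<beta>) \<gamma>"
      using G unfolding Geo_fun_def by blast
    obtain p where p: "g \<alpha> \<in> U p" "g \<beta> \<in> U p" using ab(5) by (auto simp: D_def)
    let ?J = "{\<alpha><..<\<beta>}"
    \<comment> \<open>The inverse of \<open>\<gamma> \<mapsto> (1 - \<gamma>) * \<alpha> + \<gamma>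
      * \<beta>\<close>, in the affine form that \<open>geodesic_on_affine\<close> expects.\<close>
    let ?\<gamma> = "\<lambda>t. - \<alpha> / (\<beta> - \<alpha>) + t * (1 / (\<beta> - \<alpha>))"
    have \<gamma>: "?\<gamma> t = (t - \<alpha>) / (\<beta> - \<alpha>)" for t by (simp add: diff_divide_distrib)
    have \<gamma>01: "?\<gamma> t \<in> {0..1}" if "t \<in> ?J" for t
      unfolding \<gamma> using that ab by (simp add: field_simps)
    have "geodesic_on \<Gamma> (c p) ?J (\<lambda>t. G p (g \<alpha>) (g \<beta>) (?\<gamma> t))"
      by (rule geodesic_on_affine[OF assms(2) mc seg(1)[OF p] \<gamma>01])
    then have "geodesic_on \<Gamma> (c p) ?J g"
    proof (rule geodesic_on_cong)
      fix t assume t: "t \<in> ?J"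
      have "(1 - x) * \<alpha> + x * \<beta> = \<alpha> + x * (\<beta> - \<alpha>)" for x by (simp add: algebra_simps)
      then have "(1 - ?\<gamma> t) * \<alpha> + ?\<gamma> t * \<beta> = \<alpha> + ?\<gamma> t * (\<beta> - \<alpha>)" .
      also have "\<dots> = t" unfolding \<gamma> using ab by simp
      finally have "g t = g ((1 - ?\<gamma> t) * \<alpha> + ?\<gamma> t * \<beta>)" by simp
      also have "\<dots> = f (g \<alpha>) (g \<beta>) (?\<gamma> t)" by (rule eq[OF \<gamma>01[OF t]])
      also have "\<dots> = G p (g \<alpha>) (g \<beta>) (?\<gamma> t)" by (rule fG[OF p \<gamma>01[OF t]])
      finally show "g t = G p (g \<alpha>) (g \<beta>) (?\<gamma> t)" .
    qed
    moreover have "?J \<subseteq> I"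
      using I ab(1,2) unfolding open_interval_def is_interval_1 by (meson greaterThanLessThan_iff less_imp_le subsetI)
    ultimately show "\<exists>J c. open_interval J \<and> \<tau> \<in> J \<and> J \<subseteq> I \<and> mchart A c \<and> geodesic_on \<Gamma> c J g"
      using ab(3,4) mc by (intro exI[of _ ?J] exI[of _ "c p"]) (simp add: open_interval_greaterThanLessThan)
  qed
  moreover have "Geo_fun D f I g" if G: "Geo_conn A \<Gamma> I g" for I g
    unfolding Geo_fun_def
  proof (intro conjI ballI)
    show "open_interval I" using G by (simp add: Geo_conn_def)
    fix \<tau> assume \<tau>: "\<tau> \<in> I"
    define p where "p = g \<tau>"
    have "g \<tau> \<in> fst (c p)" unfolding p_def by (rule c(2))
    then obtain \<epsilon> where \<epsilon>: "0 < \<epsilon>" "{\<tau>-\<epsilon><..<\<tau>+\<epsilon>} \<subseteq> I" "geodesic_on \<Gamma> (c p) {\<tau>-\<epsilon><..<\<tau>+\<epsilon>} g"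
      using Geo_conn_imp_geodesic_on[OF assms(1) lin G \<tau> c(1)] by metis
    have "continuous_on {\<tau>-\<epsilon><..<\<tau>+\<epsilon>} g" by (rule continuous_on_geodesic[OF ic \<epsilon>(3)])
    then have "open (g -` U p \<inter> {\<tau>-\<epsilon><..<\<tau>+\<epsilon>})"
      using continuous_on_open_vimage[OF open_greaterThanLessThan] oU by blast
    moreover have "\<tau> \<in> g -` U p \<inter> {\<tau>-\<epsilon><..<\<tau>+\<epsilon>}" using \<epsilon>(1) pU by (simp add: p_def)
    ultimately obtain e where e: "0 < e" "{\<tau>-e<..<\<tau>+e} \<subseteq> g -` U p \<inter> {\<tau>-\<epsilon><..<\<tau>+\<epsilon>}"
      by (rule open_interval_around)
    \<comment> \<open>Halving \<open>e\<close> keeps the closed interval from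
      \<open>\<alpha>\<close> to \<open>\<beta>\<close> inside the open one on which
      \<open>g\<close> stays in \<open>U p\<close>.\<close>
    define \<alpha> \<beta> where "\<alpha> = \<tau> - e / 2" and "\<beta> = \<tau> + e / 2"
    have lin_in: "\<alpha> + \<gamma> * (\<beta> - \<alpha>) \<in> {\<tau>-e<..<\<tau>+e}" if "\<gamma> \<in> {0..1}" for \<gamma>
    proof -
      have "0 \<le> \<gamma> * e" "\<gamma> * e \<le> e" using that e(1) by (auto simp: mult_left_le_one_le)
      moreover have "\<alpha> + \<gamma> * (\<beta> - \<alpha>) = \<tau> - e / 2 + \<gamma> * e" by (simp add: \<alpha>_def \<beta>_def)
      ultimately show ?thesis using e(1) unfolding greaterThanLessThan_iff by linarith
    qed
    have gU: "g t \<in> U p" if "t \<in> {\<tau>-e<..<\<tau>+e}" for t using that e(2) by blast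
    have gs: "geodesic_on \<Gamma> (c p) {\<tau>-e<..<\<tau>+e} g"
      by (rule geodesic_on_subset[OF \<epsilon>(3)]) (use e(2) in blast)
    have ab: "\<alpha> \<in> {\<tau>-e<..<\<tau>+e}" "\<beta> \<in> {\<tau>-e<..<\<tau>+e}" using e(1) by (auto simp: \<alpha>_def \<beta>_def)
    have "g ((1 - \<gamma>) * \<alpha> + \<gamma> * \<beta>) = f (g \<alpha>) (g \<beta>) \<gamma>" if \<gamma>: "\<gamma> \<in> {0..1}" for \<gamma>
    proof -
      have "f (g \<alpha>) (g \<beta>) \<gamma> = g (\<alpha> + \<gamma> * (\<beta> - \<alpha>))"
        by (rule key[OF gU[OF ab(1)] gU[OF ab(2)] geodesic_on_affine[OF assms(2) mc gs lin_in] _ _ _ \<gamma>])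
          (use gU lin_in in auto)
      also have "\<alpha> + \<gamma> * (\<beta> - \<alpha>) = (1 - \<gamma>) * \<alpha> + \<gamma> * \<beta>" by (simp add: algebra_simps)
      finally show ?thesis by simp
    qed
    moreover have "\<alpha> \<in> I" "\<beta> \<in> I" using ab e(2) \<epsilon>(2) by blast+
    moreover have "(g \<alpha>, g \<beta>) \<in> D" using gU ab by (auto simp: D_def)
    moreover have "\<alpha> < \<tau>" "\<tau> < \<beta>" using e(1) by (auto simp: \<alpha>_def \<beta>_def)
    ultimately show "\<exists>\<alpha>\<in>I. \<exists>\<beta>\<in>I. \<alpha> < \<tau> \<and> \<tau> < \<beta> \<and> (g \<alpha>, g \<beta>) \<in> D \<and>
        (\<forall>\<gamma>\<in>{0..1}. g ((1 - \<gamma>) * \<alpha> + \<gamma> * \<beta>) = f (g \<alpha>) (g \<beta>) \<gamma>)"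
      by blast
  qed
  ultimately show ?thesis by blast
qed

end
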